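(* Let $f\in\mu_{q-1}[x_1^{\pm1},\dots,x_n^{\pm1}]$ be a non-constant Laurent polynomial, let $v_1,\dots,v_m$ be an integral basis of $\mathbb{R}^m$, let $g(y)=\sum_{j=1}^m b_jy^{v_j}$ with $b_j\in\mu_{q-1}^n$, and let $d\in\mathbb{Z}^{nm}/(q-1)$. Then $$C_{f\otimes g,\omega^{-d}}(s,T)=\prod_{\substack{(u_1,\dots,u_m)\in q\backslash(\mathbb{Z}_{(p)}^n/\mathbb{Z}^n)^m\\ u_1\otimes v_1+\cdots+u_m\otimes v_m\equiv\frac{d}{q-1}}}\ \bigotimes_{j=1}^m C_{f,\omega^{-u_j(q^{|u|}-1)}}\Big(s^{|u|}\prod_{j=1}^m b_j^{-u_j(q^{|u|}-1)},\,T,\,\mathbb{F}_{q^{|u|}}\Big).$$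
   Context: $p$ is a prime, $q$ a power of $p$, $\mathbb{Z}_{q^k}=W(\mathbb{F}_{q^k})$, $\mu_{q^k-1}\subset\mathbb{Z}_{q^k}$ the group of $(q^k-1)$-th roots of unity, $\psi(x)=(1+T)^x$ for $x\in\mathbb{Z}_p$, $\psi_{q^k}=\psi\circ\mathrm{Tr}_{\mathbb{Z}_{q^k}/\mathbb{Z}_p}$. The notation $f\in\mu_{q-1}[x_1^{\pm1},\dots,x_n^{\pm1}]$ means $f=\sum_{u\in I}a_ux^u$ with $I\subset\mathbb{Z}^n$ finite and $a_u\in\mu_{q-1}$. For a Laurent polynomial $h$ in $N$ variables over $\mathbb{Z}_q$, $k\ge1$ and $e\in\mathbb{Z}^N/(q^k-1)$, put $$S_h(T,\omega^{-e},\mathbb{F}_{q^k})=\sum_{x\in\mu_{q^k-1}^N}x^{-e}\psi_{q^k}(h(x)),$$ $$C_{h,\omega^{-e}}(s,T,\mathbb{F}_{q^k})=\exp\Big(\sum_{l\ge1}\frac{-1}{(q^{kl}-1)^N}\,S_h\big(T,\omega^{-e\frac{q^{kl}-1}{q^k-1}},\mathbb{F}_{q^{kl}}\big)\frac{s^l}{l}\Big),$$ where $x^{-e}=\prod_i x_i^{-e_i}$ and $\omega$ denotes the Teichmüller character of the finite field in question. $C_{h,\omega^{-e}}(s,T)$ without a field means $k=1$. An integral basis of $\mathbb{R}^m$ is an $\mathbb{R}$-basis consisting of vectors in $\mathbb{Z}^m$. For $f=\sum_u a_ux^u$ and $g=\sum_v b_vy^v$ with $b_v\in\mu_{q-1}^n$,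 the diagonal base change is $f\otimes g=\sum_{u,v}a_ub_v^uz^{u\otimes v}$, a Laurent polynomial in the $nm$ variables $z_{ij}$ ($1\le i\le n$, $1\le j\le m$), with $b_v^u=\prod_i b_{v,i}^{u_i}$ and $z^{u\otimes v}=\prod_{i,j}z_{ij}^{u_iv_j}$; $\mathbb{Z}^n\otimes\mathbb{Z}^m$ is identified with $\mathbb{Z}^{nm}$. Tensor operation on power series in $s$: if $A(s,T)=\exp(-\sum_{k\ge1}a_k(T)\frac{s^k}{k})$ and $B(s,T)=\exp(-\sum_{k\ge1}b_k(T)\frac{s^k}{k})$, then $A\otimes B(s,T)=\exp(-\sum_{k\ge1}a_k(T)b_k(T)\frac{s^k}{k})$. $\mathbb{Z}_{(p)}$ is the localization of $\mathbb{Z}$ at $p$. Multiplication by $q$ acts on the $m$-tuples $u=(u_1,\dots,u_m)\in(\mathbb{Z}_{(p)}^n/\mathbb{Z}^n)^m$; $q\backslash(\mathbb{Z}_{(p)}^n/\mathbb{Z}^n)^m$ is the set of orbits, and $|u|$ is the length of the orbit of $u$, so $u_j(q^{|u|}-1)$ is an element of $\mathbb{Z}^n/(q^{|u|}-1)$. The congruence $u_1\otimes v_1+\cdots+u_m\otimes v_m\equiv\frac{d}{q-1}$ is modulo $\mathbb{Z}^n\otimes\mathbb{Z}^m$; it is defined on the orbit space, as is the tensor product on the right-hand side, and the product over its solutions is finite. For $c\in\mathbb{Z}^n$, $b_j^{c}=\prod_i b_{j,i}^{c_i}$.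
   Formalization: The exponent of b_j in the variable is corrected from -u_j(q^{|u|}-1) to +u_j(q^{|u|}-1); the printed sign fails for f=x, g=by, d=1, q=p≥5, b²≠1. The tensor product over j is formed first, then s is replaced by s^{|u|} times the product of the b_j powers. *)

theory Defs
  imports "HOL-Analysis.Analysis" "HOL-Computational_Algebra.Fraction_Field"
    "HOL-Computational_Algebra.Formal_Power_Series"
    "HOL-Library.Poly_Mapping"
begin

section \<open>Integer polynomials and their evaluation\<close>

type_synonym 'v ipoly = "('v \<Rightarrow>\<^sub>0 nat) \<Rightarrow>\<^sub>0 int"

definition ipoly_var :: "'v \<Rightarrow> 'v ipoly" where
  "ipoly_var v = Poly_Mapping.single (Poly_Mapping.single v 1) 1"

definition monom_eval :: "('v \<Rightarrow> 'a::comm_ring_1) \<Rightarrow> ('v \<Rightarrow>\<^sub>0 nat) \<Rightarrow> 'a" where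
  "monom_eval \<rho> m = (\<Prod>v\<in>Poly_Mapping.keys m. \<rho> v ^ Poly_Mapping.lookup m v)"

definition ipoly_eval :: "('v \<Rightarrow> 'a::comm_ring_1) \<Rightarrow> 'v ipoly \<Rightarrow> 'a" where
  "ipoly_eval \<rho> P = (\<Sum>m\<in>Poly_Mapping.keys P. of_int (Poly_Mapping.lookup P m) * monom_eval \<rho> m)"

lemma monom_eval_superset:
  assumes "finite S" "Poly_Mapping.keys m \<subseteq> S"
  shows "monom_eval \<rho> m = (\<Prod>v\<in>S. \<rho> v ^ Poly_Mapping.lookup m v)"
  unfolding monom_eval_def using assms
  by (intro prod.mono_neutral_left) (auto simp: not_in_keys_iff_lookup_eq_zero)

lemma monom_eval_0 [simp]: "monom_eval \<rho> 0 = 1"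
  by (simp add: monom_eval_def)

lemma monom_eval_add: "monom_eval \<rho> (m + n) = monom_eval \<rho> m * monom_eval \<rho> n"
proof -
  let ?S = "Poly_Mapping.keys m \<union> Poly_Mapping.keys n"
  have "Poly_Mapping.keys (m + n) \<subseteq> ?S" by (rule Poly_Mapping.keys_add)
  then show ?thesis
    by (simp add: monom_eval_superset[of ?S] lookup_add power_add prod.distrib)
qed

lemma monom_eval_single [simp]: "monom_eval \<rho> (Poly_Mapping.single v k) = \<rho> v ^ k"
  by (cases "k = 0") (auto simp: monom_eval_def)

lemma ipoly_eval_superset:
  assumes "finite S" "Poly_Mapping.keys P \<subseteq> S"
  shows "ipoly_eval \<rho> P = (\<Sum>m\<in>S. of_int (Poly_Mapping.lookup P m) * monom_eval \<rho> m)"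
  unfolding ipoly_eval_def using assms
  by (intro sum.mono_neutral_left) (auto simp: not_in_keys_iff_lookup_eq_zero)

lemma ipoly_eval_0 [simp]: "ipoly_eval \<rho> 0 = 0"
  by (simp add: ipoly_eval_def)

lemma ipoly_eval_single [simp]:
  "ipoly_eval \<rho> (Poly_Mapping.single m c) = of_int c * monom_eval \<rho> m"
  by (cases "c = 0") (auto simp: ipoly_eval_def)

lemma ipoly_eval_1 [simp]: "ipoly_eval \<rho> 1 = 1"
  by (simp flip: single_one)

lemma ipoly_eval_var [simp]: "ipoly_eval \<rho> (ipoly_var v) = \<rho> v"
  by (simp add: ipoly_var_def)

lemma ipoly_eval_add [simp]: "ipoly_eval \<rho> (P + Q) = ipoly_eval \<rho> P + ipoly_eval \<rho> Q"
proof -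
  let ?S = "Poly_Mapping.keys P \<union> Poly_Mapping.keys Q"
  have "Poly_Mapping.keys (P + Q) \<subseteq> ?S" by (rule Poly_Mapping.keys_add)
  then show ?thesis
    by (simp add: ipoly_eval_superset[of ?S] lookup_add algebra_simps sum.distrib)
qed

lemma ipoly_eval_sum: "ipoly_eval \<rho> (\<Sum>i\<in>I. P i) = (\<Sum>i\<in>I. ipoly_eval \<rho> (P i))"
  by (induction I rule: infinite_finite_induct) auto

lemma poly_mapping_sum_single:
  "P = (\<Sum>m\<in>Poly_Mapping.keys P. Poly_Mapping.single m (Poly_Mapping.lookup P m))"
proof (rule poly_mapping_eqI)
  fix k
  show "Poly_Mapping.lookup P k = Poly_Mapping.lookup
    (\<Sum>m\<in>Poly_Mapping.keys P. Poly_Mapping.single m (Poly_Mapping.lookup P m)) k"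
    by (cases "k \<in> Poly_Mapping.keys P")
      (auto simp: lookup_sum lookup_single when_def not_in_keys_iff_lookup_eq_zero sum.delta cong: if_cong)
qed

lemma ipoly_eval_mult [simp]: "ipoly_eval \<rho> (P * Q) = ipoly_eval \<rho> P * ipoly_eval \<rho> Q"
proof -
  have "ipoly_eval \<rho> (P * Q) = ipoly_eval \<rho>
      ((\<Sum>m\<in>Poly_Mapping.keys P. Poly_Mapping.single m (Poly_Mapping.lookup P m)) *
       (\<Sum>m\<in>Poly_Mapping.keys Q. Poly_Mapping.single m (Poly_Mapping.lookup Q m)))"
    by (simp flip: poly_mapping_sum_single)
  also have "\<dots> = ipoly_eval \<rho> P * ipoly_eval \<rho> Q"
    unfolding sum_product ipoly_eval_sum mult_single ipoly_eval_single monom_eval_add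
    unfolding ipoly_eval_def sum_product by (simp add: mult_ac)
  finally show ?thesis .
qed

lemma ipoly_eval_uminus [simp]: "ipoly_eval \<rho> (- P) = - ipoly_eval \<rho> P"
  using ipoly_eval_add[of \<rho> P "-P"] by (simp add: add_eq_0_iff)

lemma ipoly_eval_diff [simp]: "ipoly_eval \<rho> (P - Q) = ipoly_eval \<rho> P - ipoly_eval \<rho> Q"
  using ipoly_eval_add[of \<rho> P "-Q"] by simp

lemma ipoly_eval_power [simp]: "ipoly_eval \<rho> (P ^ k) = ipoly_eval \<rho> P ^ k"
  by (induction k) auto

lemma ipoly_eval_of_nat [simp]: "ipoly_eval \<rho> (of_nat k) = of_nat k"
  by (induction k) auto

lemma ipoly_induct [case_names const var add mult]:
  assumes const: "\<And>c. R (Poly_Mapping.single 0 c)"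
    and var: "\<And>v. R (ipoly_var v)"
    and add: "\<And>P Q. R P \<Longrightarrow> R Q \<Longrightarrow> R (P + Q)"
    and mult: "\<And>P Q. R P \<Longrightarrow> R Q \<Longrightarrow> R (P * Q)"
  shows "R (P :: 'v ipoly)"
proof -
  have R0: "R 0" and R1: "R 1"
    using const[of 0] const[of 1] by simp_all
  have sum: "R (\<Sum>i\<in>I. F i)" if "\<And>i. i \<in> I \<Longrightarrow> R (F i)" for I :: "('v \<Rightarrow>\<^sub>0 nat) set" and F
    using that by (induction I rule: infinite_finite_induct) (auto intro: R0 add)
  have pw: "R (Poly_Mapping.single (Poly_Mapping.single v k) 1)" for v k
  proof (induction k)
    case (Suc k)
    have "Poly_Mapping.single (Poly_Mapping.single v (Suc k)) 1 =
        ipoly_var v * Poly_Mapping.single (Poly_Mapping.single v k) (1::int)"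
      by (simp add: ipoly_var_def mult_single flip: single_add)
    then show ?case using mult[OF var Suc] by simp
  qed (use R1 in simp)
  have prd: "R (Poly_Mapping.single (\<Sum>v\<in>V. Poly_Mapping.single v (g v)) 1)" for V :: "'v set" and g
  proof (induction V rule: infinite_finite_induct)
    case (insert v V)
    then show ?case using mult[OF pw insert(3)] by (simp add: mult_single)
  qed (use R1 in simp_all)
  have mon: "R (Poly_Mapping.single m c)" for m c
  proof -
    have "Poly_Mapping.single m c = Poly_Mapping.single 0 c * Poly_Mapping.single m (1::int)"
      by (simp add: mult_single)
    also have "R \<dots>"
      by (subst (2) poly_mapping_sum_single) (rule mult[OF const prd])
    finally show ?thesis .
  qed
  show ?thesis by (subst poly_mapping_sum_single) (rule sum, rule mon)
qed

lemma ipoly_of_nat_mult_cancel: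
  fixes P Q :: "'v ipoly"
  assumes "of_nat k * P = of_nat k * Q" "k \<noteq> 0"
  shows "P = Q"
proof (rule poly_mapping_eqI)
  fix m
  have *: "Poly_Mapping.lookup (of_nat k * P) m = int k * Poly_Mapping.lookup P m" for P :: "'v ipoly"
    by (induction k) (auto simp: lookup_add algebra_simps)
  show "Poly_Mapping.lookup P m = Poly_Mapping.lookup Q m"
    using *[of P] *[of Q] assms by simp
qed

section \<open>Ghost components and the Witt polynomials\<close>

definition ghost :: "nat \<Rightarrow> nat \<Rightarrow> (nat \<Rightarrow> 'a::comm_ring_1) \<Rightarrow> 'a" where
  "ghost p n x = (\<Sum>i\<le>n. of_nat p ^ i * x i ^ (p ^ (n - i)))"

lemma ipoly_eval_ghost: "ipoly_eval \<rho> (ghost p n a) = ghost p n (\<lambda>i. ipoly_eval \<rho> (a i))"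
  by (simp add: ghost_def ipoly_eval_sum)

lemma ghost_unique:
  fixes s t :: "nat \<Rightarrow> 'v ipoly"
  assumes "p > 0" "\<And>n. ghost p n s = ghost p n t"
  shows "s = t"
proof
  fix n
  show "s n = t n"
  proof (induction n rule: less_induct)
    case (less n)
    have *: "ghost p n s = (\<Sum>i<n. of_nat p ^ i * s i ^ (p ^ (n - i))) + of_nat (p ^ n) * s n"
      for s :: "nat \<Rightarrow> 'v ipoly"
      by (simp add: ghost_def flip: lessThan_Suc_atMost)
    have "(\<Sum>i<n. of_nat p ^ i * s i ^ (p ^ (n - i))) = (\<Sum>i<n. of_nat p ^ i * t i ^ (p ^ (n - i)))"
      using less by (intro sum.cong) auto
    with assms(2)[of n] have "of_nat (p ^ n) * s n = of_nat (p ^ n) * t n"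
      unfolding * by simp
    then show ?case
      by (rule ipoly_of_nat_mult_cancel) (use assms in simp)
  qed
qed

lemma prime_dvd_power_diff:
  fixes x y :: "'a::comm_ring_1"
  assumes "of_nat p ^ Suc j dvd x - y"
  shows "of_nat p ^ Suc (Suc j) dvd x ^ p - y ^ p"
proof (cases "p = 0")
  case False
  then obtain r where r: "p = Suc r" by (cases p) auto
  have px: "of_nat p dvd x - y"
    using assms dvd_trans[of "of_nat p" "of_nat p ^ Suc j" "x - y"] by simp
  have pw: "of_nat p dvd x ^ i - y ^ i" for i
  proof (induction i)
    case (Suc i)
    have "x ^ Suc i - y ^ Suc i = x * (x ^ i - y ^ i) + (x - y) * y ^ i"
      by (simp add: algebra_simps)
    then show ?case using Suc px by simp
  qed simp
  have "of_nat p dvd (\<Sum>i<Suc r. (x ^ i - y ^ i) * y ^ (r - i))"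
    by (intro dvd_sum dvd_mult2 pw)
  also have "(\<Sum>i<Suc r. (x ^ i - y ^ i) * y ^ (r - i)) = (\<Sum>i<Suc r. x ^ i * y ^ (r - i)) - (\<Sum>i<Suc r. y ^ r)"
    unfolding sum_subtractf[symmetric]
    by (intro sum.cong) (simp_all add: left_diff_distrib flip: power_add)
  also have "(\<Sum>i<Suc r. y ^ r) = of_nat p * y ^ r" by (simp add: r)
  finally have "of_nat p dvd (\<Sum>i<Suc r. x ^ i * y ^ (r - i))"
    by (metis diff_add_cancel dvd_add dvd_triv_left)
  then have "of_nat p ^ Suc j * of_nat p dvd (x - y) * (\<Sum>i<Suc r. x ^ i * y ^ (r - i))"
    by (intro mult_dvd_mono assms)
  moreover have "x ^ p - y ^ p = (x - y) * (\<Sum>i<Suc r. x ^ i * y ^ (r - i))"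
    unfolding r using power_diff_sumr2[of x "Suc r" y] by (simp add: mult_ac)
  ultimately show ?thesis by (simp add: mult_ac)
qed simp

lemma prime_dvd_power_power_diff:
  fixes x y :: "'a::comm_ring_1"
  assumes "of_nat p dvd x - y"
  shows "of_nat p ^ Suc n dvd x ^ (p ^ n) - y ^ (p ^ n)"
proof (induction n)
  case (Suc n)
  then show ?case
    using prime_dvd_power_diff[OF Suc] by (simp add: power_mult[symmetric] mult.commute)
qed (use assms in simp)

lemma ipoly_freshman:
  fixes a b :: "'a::comm_ring_1"
  assumes "prime p"
  shows "of_nat p dvd (a + b) ^ p - (a ^ p + b ^ p)"
proof -
  have p: "p > 0" using assms prime_gt_0_nat by blast
  have "(a + b) ^ p = (\<Sum>k\<le>p. of_nat (p choose k) * a ^ k * b ^ (p - k))"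
    by (rule binomial_ring)
  also have "{..p} = insert 0 (insert p {0<..<p})" using p by auto
  also have "(\<Sum>k\<in>\<dots>. of_nat (p choose k) * a ^ k * b ^ (p - k)) =
      b ^ p + a ^ p + (\<Sum>k\<in>{0<..<p}. of_nat (p choose k) * a ^ k * b ^ (p - k))"
    using p by (subst sum.insert) (auto simp: add_ac)
  finally have "(a + b) ^ p - (a ^ p + b ^ p) = (\<Sum>k\<in>{0<..<p}. of_nat (p choose k) * a ^ k * b ^ (p - k))"
    by simp
  also have "of_nat p dvd \<dots>"
  proof (intro dvd_sum)
    fix k assume "k \<in> {0<..<p}"
    then have "p dvd (p choose k)" using assms p by (intro dvd_choose_prime) auto
    then have "(of_nat p :: 'a) dvd of_nat (p choose k)" by (metis dvd_def of_nat_mult)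
    then show "of_nat p dvd of_nat (p choose k) * a ^ k * b ^ (p - k)" by simp
  qed
  finally show ?thesis .
qed

definition frob_lift :: "nat \<Rightarrow> 'v ipoly \<Rightarrow> 'v ipoly" where
  "frob_lift p = ipoly_eval (\<lambda>v. ipoly_var v ^ p)"

lemma int_fermat:
  assumes "prime p"
  shows "int p dvd c ^ p - c"
proof -
  have p: "p > 0" using assms prime_gt_0_nat by blast
  have nat: "int p dvd int k ^ p - int k" for k
  proof (induction k)
    case (Suc k)
    have "int p dvd (int k + 1) ^ p - (int k ^ p + 1 ^ p)"
      using ipoly_freshman[OF assms, of "int k" 1] by simp
    then have "int p dvd ((int k + 1) ^ p - (int k ^ p + 1 ^ p)) + (int k ^ p - int k)"
      using Suc by (rule dvd_add)
    then show ?case by (simp add: algebra_simps)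
  qed (use p in \<open>simp add: zero_power\<close>)
  define k where "k = nat (c mod int p)"
  have k: "int k = c mod int p" using p by (simp add: k_def)
  have ck: "int p dvd c - int k" by (simp add: k)
  have "int p dvd c ^ p - int k ^ p"
    using prime_dvd_power_diff[of p 0 c "int k"] ck dvd_trans[of "int p" "int p ^ Suc (Suc 0)"]
    by simp
  then have "int p dvd (c ^ p - int k ^ p) + (int k ^ p - int k) + (int k - c)"
    using nat ck by (intro dvd_add) (simp_all add: dvd_diff_commute)
  then show ?thesis by simp
qed


lemma frob_lift_cong:
  fixes P :: "'v ipoly"
  assumes "prime p"
  shows "of_nat p dvd frob_lift p P - P ^ p"
proof (induction P rule: ipoly_induct)
  case (const c)
  obtain k where "c ^ p - c = int p * k" using int_fermat[OF assms, of c] by (auto elim: dvdE)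
  then have k: "c - c ^ p = int p * (- k)" by simp
  have pw: "Poly_Mapping.single 0 c ^ m = (Poly_Mapping.single 0 (c ^ m) :: 'v ipoly)" for m
    by (induction m) (auto simp: mult_single)
  have "frob_lift p (Poly_Mapping.single 0 c) = (Poly_Mapping.single 0 c :: 'v ipoly)"
    by (simp add: frob_lift_def flip: single_of_int)
  moreover have "Poly_Mapping.single 0 (c - c ^ p) = (of_nat p * Poly_Mapping.single 0 (- k) :: 'v ipoly)"
    unfolding k by (simp add: mult_single flip: single_of_nat)
  ultimately have "frob_lift p (Poly_Mapping.single 0 c) - Poly_Mapping.single 0 c ^ p =
      (of_nat p * Poly_Mapping.single 0 (- k) :: 'v ipoly)"
    by (simp add: pw single_diff)
  then show ?case by simp
next
  case (var v)
  then show ?case by (simp add: frob_lift_def)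
next
  case (add P Q)
  have "of_nat p dvd (frob_lift p P - P ^ p) + (frob_lift p Q - Q ^ p) - ((P + Q) ^ p - (P ^ p + Q ^ p))"
    by (intro dvd_diff dvd_add add ipoly_freshman assms)
  then show ?case by (simp add: frob_lift_def algebra_simps)
next
  case (mult P Q)
  have "frob_lift p (P * Q) - (P * Q) ^ p =
      (frob_lift p P - P ^ p) * frob_lift p Q + P ^ p * (frob_lift p Q - Q ^ p)"
    by (simp add: frob_lift_def algebra_simps)
  then show ?case using mult by simp
qed

lemma ghost_cong:
  fixes a b :: "nat \<Rightarrow> 'a::comm_ring_1"
  assumes "\<And>i. i \<le> n \<Longrightarrow> of_nat p dvd a i - b i"
  shows "of_nat p ^ Suc n dvd ghost p n a - ghost p n b"
proof -
  have "of_nat p ^ Suc n dvd of_nat p ^ i * (a i ^ (p ^ (n - i)) - b i ^ (p ^ (n - i)))"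
    if "i \<le> n" for i
  proof -
    have "of_nat p ^ i * of_nat p ^ Suc (n - i) dvd of_nat p ^ i * (a i ^ (p ^ (n - i)) - b i ^ (p ^ (n - i)))"
      by (intro mult_dvd_mono prime_dvd_power_power_diff assms that dvd_refl)
    moreover have "i + Suc (n - i) = Suc n" using that by simp
    ultimately show ?thesis by (metis power_add)
  qed
  then show ?thesis
    by (auto simp: ghost_def right_diff_distrib simp flip: sum_subtractf intro!: dvd_sum)
qed

lemma ghost_Suc:
  "ghost p (Suc n) a = ghost p n (\<lambda>i. a i ^ p) + of_nat p ^ Suc n * a (Suc n)"
proof -
  have "(\<Sum>i\<le>n. of_nat p ^ i * a i ^ (p ^ (Suc n - i))) = ghost p n (\<lambda>i. a i ^ p)"
    unfolding ghost_def
    by (intro sum.cong refl arg_cong2[where f = "(*)"]) (simp add: Suc_diff_le power_mult)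
  then show ?thesis by (simp add: ghost_def)
qed

lemma ghost_frob_lift:
  fixes a :: "nat \<Rightarrow> 'v ipoly"
  assumes "prime p"
  shows "of_nat p ^ Suc n dvd ghost p (Suc n) a - frob_lift p (ghost p n a)"
proof -
  have "frob_lift p (ghost p n a) = ghost p n (\<lambda>i. frob_lift p (a i))"
    by (simp add: frob_lift_def ipoly_eval_ghost)
  moreover have "of_nat p ^ Suc n dvd ghost p n (\<lambda>i. a i ^ p) - ghost p n (\<lambda>i. frob_lift p (a i))"
    by (intro ghost_cong) (metis dvd_minus_iff frob_lift_cong[OF assms] minus_diff_eq)
  ultimately have "of_nat p ^ Suc n dvd
      (ghost p n (\<lambda>i. a i ^ p) - frob_lift p (ghost p n a)) + of_nat p ^ Suc n * a (Suc n)"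
    by simp
  then show ?thesis by (simp only: ghost_Suc) (simp add: algebra_simps)
qed

function dwork_seq :: "nat \<Rightarrow> (nat \<Rightarrow> 'v ipoly) \<Rightarrow> nat \<Rightarrow> 'v ipoly" where
  "dwork_seq p g n = (SOME x. of_nat p ^ n * x =
     g n - (\<Sum>i<n. of_nat p ^ i * dwork_seq p g i ^ (p ^ (n - i))))"
  by auto
termination by (relation "inv_image less_than (\<lambda>(p, g, n). n)") auto
declare dwork_seq.simps [simp del]

lemma ghost_dwork_seq:
  fixes g :: "nat \<Rightarrow> 'v ipoly"
  assumes p: "prime p" and g: "\<And>n. of_nat p ^ Suc n dvd g (Suc n) - frob_lift p (g n)"
  shows "ghost p n (dwork_seq p g) = g n"
proof (induction n)
  let ?s = "dwork_seq p g"
  have step: "ghost p n ?s = g n"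
    if "of_nat p ^ n dvd g n - (\<Sum>i<n. of_nat p ^ i * ?s i ^ (p ^ (n - i)))" for n
  proof -
    let ?G = "g n - (\<Sum>i<n. of_nat p ^ i * ?s i ^ (p ^ (n - i)))"
    from that obtain x where "?G = of_nat p ^ n * x" by (elim dvdE)
    then have "of_nat p ^ n * x = ?G" by (rule sym)
    then have "of_nat p ^ n * (SOME x. of_nat p ^ n * x = ?G) = ?G" by (rule someI)
    then have "of_nat p ^ n * ?s n = ?G" by (simp only: dwork_seq.simps[of p g n])
    then show ?thesis by (simp add: ghost_def flip: lessThan_Suc_atMost)
  qed
  { case 0 show ?case by (rule step) simp }
  { case (Suc m)
    have "(\<Sum>i<Suc m. of_nat p ^ i * ?s i ^ (p ^ (Suc m - i))) = ghost p m (\<lambda>i. ?s i ^ p)"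
      unfolding ghost_def lessThan_Suc_atMost
      by (intro sum.cong refl arg_cong2[where f = "(*)"]) (simp add: Suc_diff_le power_mult)
    also have "of_nat p ^ Suc m dvd ghost p m (\<lambda>i. frob_lift p (?s i)) - \<dots>"
      by (intro ghost_cong frob_lift_cong p)
    also have "ghost p m (\<lambda>i. frob_lift p (?s i)) = frob_lift p (g m)"
      using Suc by (simp add: frob_lift_def flip: ipoly_eval_ghost)
    finally have "of_nat p ^ Suc m dvd (g (Suc m) - frob_lift p (g m)) +
        (frob_lift p (g m) - (\<Sum>i<Suc m. of_nat p ^ i * ?s i ^ (p ^ (Suc m - i))))"
      by (intro dvd_add g)
    then show ?case by (intro step) (simp add: algebra_simps) }
qed

lemma ghost_ex1:
  fixes g :: "nat \<Rightarrow> 'v ipoly"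
  assumes "prime p" "\<And>n. of_nat p ^ Suc n dvd g (Suc n) - frob_lift p (g n)"
  shows "\<exists>!s. \<forall>n. ghost p n s = g n"
proof (rule ex_ex1I)
  show "\<exists>s. \<forall>n. ghost p n s = g n" using ghost_dwork_seq[OF assms] by blast
  show "s = t" if "\<forall>n. ghost p n s = g n" "\<forall>n. ghost p n t = g n" for s t
    using that assms(1) by (intro ghost_unique[of p]) (auto simp: prime_gt_0_nat)
qed

definition witt_add_poly :: "nat \<Rightarrow> nat \<Rightarrow> (nat + nat) ipoly" where
  "witt_add_poly p = (THE s. \<forall>n. ghost p n s =
     ghost p n (\<lambda>i. ipoly_var (Inl i)) + ghost p n (\<lambda>i. ipoly_var (Inr i)))"

definition witt_mult_poly :: "nat \<Rightarrow> nat \<Rightarrow> (nat + nat) ipoly" where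
  "witt_mult_poly p = (THE s. \<forall>n. ghost p n s =
     ghost p n (\<lambda>i. ipoly_var (Inl i)) * ghost p n (\<lambda>i. ipoly_var (Inr i)))"

definition witt_uminus_poly :: "nat \<Rightarrow> nat \<Rightarrow> nat ipoly" where
  "witt_uminus_poly p = (THE s. \<forall>n. ghost p n s = - ghost p n ipoly_var)"

definition witt_frob_poly :: "nat \<Rightarrow> nat \<Rightarrow> nat ipoly" where
  "witt_frob_poly p = (THE s. \<forall>n. ghost p n s = ghost p (Suc n) ipoly_var)"

lemma ghost_witt_add_poly:
  assumes "prime p"
  shows "ghost p n (witt_add_poly p) =
    ghost p n (\<lambda>i. ipoly_var (Inl i)) + ghost p n (\<lambda>i. ipoly_var (Inr i))"
proof -
  let ?g = "\<lambda>n. ghost p n (\<lambda>i. ipoly_var (Inl i)) + ghost p n (\<lambda>i. ipoly_var (Inr i) :: (nat + nat) ipoly)"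
  have "\<exists>!s. \<forall>n. ghost p n s = ?g n"
  proof (rule ghost_ex1[OF assms])
    fix n
    show "of_nat p ^ Suc n dvd ?g (Suc n) - frob_lift p (?g n)"
      using dvd_add[OF ghost_frob_lift[OF assms, of n "\<lambda>i. ipoly_var (Inl i)"]
        ghost_frob_lift[OF assms, of n "\<lambda>i. ipoly_var (Inr i)"]]
      by (simp add: frob_lift_def algebra_simps del: power_Suc)
  qed
  from theI'[OF this] show ?thesis by (simp add: witt_add_poly_def)
qed

lemma ghost_witt_mult_poly:
  assumes "prime p"
  shows "ghost p n (witt_mult_poly p) =
    ghost p n (\<lambda>i. ipoly_var (Inl i)) * ghost p n (\<lambda>i. ipoly_var (Inr i))"
proof -
  let ?a = "\<lambda>n. ghost p n (\<lambda>i. ipoly_var (Inl i) :: (nat + nat) ipoly)"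
  let ?b = "\<lambda>n. ghost p n (\<lambda>i. ipoly_var (Inr i) :: (nat + nat) ipoly)"
  have "\<exists>!s. \<forall>n. ghost p n s = ?a n * ?b n"
  proof (rule ghost_ex1[OF assms])
    fix n
    have "?a (Suc n) * ?b (Suc n) - frob_lift p (?a n * ?b n) =
        (?a (Suc n) - frob_lift p (?a n)) * ?b (Suc n) + frob_lift p (?a n) * (?b (Suc n) - frob_lift p (?b n))"
      by (simp add: frob_lift_def algebra_simps)
    also have "of_nat p ^ Suc n dvd \<dots>"
      by (intro dvd_add dvd_mult dvd_mult2 ghost_frob_lift assms)
    finally show "of_nat p ^ Suc n dvd ?a (Suc n) * ?b (Suc n) - frob_lift p (?a n * ?b n)" .
  qed
  from theI'[OF this] show ?thesis by (simp add: witt_mult_poly_def)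
qed

lemma ghost_witt_uminus_poly:
  assumes "prime p"
  shows "ghost p n (witt_uminus_poly p) = - ghost p n ipoly_var"
proof -
  have "\<exists>!s. \<forall>n. ghost p n s = - ghost p n (ipoly_var :: nat \<Rightarrow> nat ipoly)"
  proof (rule ghost_ex1[OF assms])
    fix n
    show "of_nat p ^ Suc n dvd - ghost p (Suc n) (ipoly_var :: nat \<Rightarrow> nat ipoly) - frob_lift p (- ghost p n ipoly_var)"
      using ghost_frob_lift[OF assms, of n "ipoly_var :: nat \<Rightarrow> nat ipoly"]
      by (simp add: frob_lift_def del: power_Suc) (metis dvd_minus_iff minus_diff_eq)
  qed
  from theI'[OF this] show ?thesis by (simp add: witt_uminus_poly_def)
qed

lemma ghost_witt_frob_poly:
  assumes "prime p"
  shows "ghost p n (witt_frob_poly p) = ghost p (Suc n) ipoly_var"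
proof -
  have "\<exists>!s. \<forall>n. ghost p n s = ghost p (Suc n) (ipoly_var :: nat \<Rightarrow> nat ipoly)"
  proof (rule ghost_ex1[OF assms])
    fix n
    show "of_nat p ^ Suc n dvd ghost p (Suc (Suc n)) (ipoly_var :: nat \<Rightarrow> nat ipoly) - frob_lift p (ghost p (Suc n) ipoly_var)"
      using ghost_frob_lift[OF assms, of "Suc n" "ipoly_var :: nat \<Rightarrow> nat ipoly"]
      by (rule dvd_trans[rotated]) simp
  qed
  from theI'[OF this] show ?thesis by (simp add: witt_frob_poly_def)
qed

lemma witt_frob_poly_cong:
  assumes "prime p"
  shows "of_nat p dvd witt_frob_poly p n - ipoly_var n ^ p"
proof (induction n rule: less_induct)
  case (less n)
  let ?F = "witt_frob_poly p" and ?X = "\<lambda>i::nat. ipoly_var i ^ p"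
  have split: "ghost p n a = (\<Sum>i<n. of_nat p ^ i * a i ^ (p ^ (n - i))) + of_nat p ^ n * a n" for a :: "nat \<Rightarrow> nat ipoly"
    by (simp add: ghost_def flip: lessThan_Suc_atMost)
  let ?b = "\<lambda>i. if i < n then ?F i else ?X i"
  have "of_nat p ^ Suc n dvd ghost p n ?b - ghost p n ?X"
    using less by (intro ghost_cong) auto
  moreover have "ghost p n ?F = ghost p n ?X + of_nat p ^ Suc n * ipoly_var (Suc n)"
    by (simp only: ghost_witt_frob_poly[OF assms] ghost_Suc)
  moreover have "ghost p n ?F - ghost p n ?b = of_nat p ^ n * (?F n - ?X n)"
    by (simp add: split algebra_simps)
  ultimately have "of_nat p ^ n * (?F n - ?X n) =
      of_nat p ^ Suc n * ipoly_var (Suc n) - (ghost p n ?b - ghost p n ?X)"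
    by (simp add: algebra_simps)
  also have "of_nat p ^ Suc n dvd \<dots>"
    by (rule dvd_diff) (simp, fact)
  finally obtain z where "of_nat p ^ n * (?F n - ?X n) = of_nat p ^ Suc n * z" by (elim dvdE)
  then have "of_nat (p ^ n) * (?F n - ?X n) = of_nat (p ^ n) * (of_nat p * z)"
    by (simp add: mult_ac)
  then have "?F n - ?X n = of_nat p * z"
    by (rule ipoly_of_nat_mult_cancel) (use assms in auto)
  then show ?case by simp
qed


section \<open>Witt vector operations on sequences\<close>

definition witt_add :: "nat \<Rightarrow> (nat \<Rightarrow> 'a::comm_ring_1) \<Rightarrow> (nat \<Rightarrow> 'a) \<Rightarrow> nat \<Rightarrow> 'a" where
  "witt_add p x y n = ipoly_eval (case_sum x y) (witt_add_poly p n)"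

definition witt_mult :: "nat \<Rightarrow> (nat \<Rightarrow> 'a::comm_ring_1) \<Rightarrow> (nat \<Rightarrow> 'a) \<Rightarrow> nat \<Rightarrow> 'a" where
  "witt_mult p x y n = ipoly_eval (case_sum x y) (witt_mult_poly p n)"

definition witt_uminus :: "nat \<Rightarrow> (nat \<Rightarrow> 'a::comm_ring_1) \<Rightarrow> nat \<Rightarrow> 'a" where
  "witt_uminus p x n = ipoly_eval x (witt_uminus_poly p n)"

definition witt_one :: "nat \<Rightarrow> 'a::comm_ring_1" where
  "witt_one n = (if n = 0 then 1 else 0)"

definition witt_frob :: "nat \<Rightarrow> (nat \<Rightarrow> 'a::comm_ring_1) \<Rightarrow> nat \<Rightarrow> 'a" where
  "witt_frob p x n = ipoly_eval x (witt_frob_poly p n)"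

definition witt_versch :: "(nat \<Rightarrow> 'a::comm_ring_1) \<Rightarrow> nat \<Rightarrow> 'a" where
  "witt_versch x n = (case n of 0 \<Rightarrow> 0 | Suc m \<Rightarrow> x m)"

lemma ghost_witt_add:
  "prime p \<Longrightarrow> ghost p n (witt_add p x y) = ghost p n x + ghost p n y"
  using ipoly_eval_ghost[of "case_sum x y" p n "witt_add_poly p"]
  by (simp add: ghost_witt_add_poly ipoly_eval_ghost witt_add_def[abs_def])

lemma ghost_witt_mult:
  "prime p \<Longrightarrow> ghost p n (witt_mult p x y) = ghost p n x * ghost p n y"
  using ipoly_eval_ghost[of "case_sum x y" p n "witt_mult_poly p"]
  by (simp add: ghost_witt_mult_poly ipoly_eval_ghost witt_mult_def[abs_def])

lemma ghost_witt_uminus: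
  "prime p \<Longrightarrow> ghost p n (witt_uminus p x) = - ghost p n x"
  using ipoly_eval_ghost[of x p n "witt_uminus_poly p"]
  by (simp add: ghost_witt_uminus_poly ipoly_eval_ghost witt_uminus_def[abs_def])

lemma ghost_witt_frob:
  "prime p \<Longrightarrow> ghost p n (witt_frob p x) = ghost p (Suc n) x"
  using ipoly_eval_ghost[of x p n "witt_frob_poly p"]
  by (simp add: ghost_witt_frob_poly ipoly_eval_ghost witt_frob_def[abs_def])

lemma ghost_zero: "p > 0 \<Longrightarrow> ghost p n (\<lambda>_. 0) = 0"
  by (simp add: ghost_def power_0_left)

lemma ghost_one: "p > 0 \<Longrightarrow> ghost p n witt_one = 1"
proof -
  assume p: "p > 0"
  have "ghost p n witt_one = (\<Sum>i\<le>n. if i = 0 then 1 else 0)"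
    unfolding ghost_def using p by (intro sum.cong) (auto simp: witt_one_def power_0_left)
  then show ?thesis by simp
qed

lemma ghost_versch_0: "ghost p 0 (witt_versch x) = 0"
  by (simp add: ghost_def witt_versch_def)

lemma ghost_versch_Suc: "p > 0 \<Longrightarrow> ghost p (Suc n) (witt_versch x) = of_nat p * ghost p n x"
proof -
  assume p: "p > 0"
  have "ghost p (Suc n) (witt_versch x) =
      (\<Sum>i\<le>Suc n. of_nat p ^ i * witt_versch x i ^ (p ^ (Suc n - i)))"
    by (simp add: ghost_def)
  also have "\<dots> = of_nat p ^ 0 * witt_versch x 0 ^ (p ^ (Suc n - 0)) +
      (\<Sum>i\<le>n. of_nat p ^ Suc i * witt_versch x (Suc i) ^ (p ^ (Suc n - Suc i)))"
    by (rule sum.atMost_Suc_shift)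
  also have "\<dots> = of_nat p * ghost p n x"
    using p by (simp add: witt_versch_def ghost_def sum_distrib_left mult_ac power_0_left)
  finally show ?thesis .
qed

definition is_ring_hom :: "('a::comm_ring_1 \<Rightarrow> 'b::comm_ring_1) \<Rightarrow> bool" where
  "is_ring_hom h \<longleftrightarrow> h 1 = 1 \<and> (\<forall>x y. h (x + y) = h x + h y) \<and> (\<forall>x y. h (x * y) = h x * h y)"

lemma is_ring_hom_eval: "is_ring_hom (ipoly_eval \<rho>)"
  by (simp add: is_ring_hom_def)

lemma hom_ipoly_eval:
  assumes "is_ring_hom h"
  shows "h (ipoly_eval \<rho> P) = ipoly_eval (\<lambda>v. h (\<rho> v)) P"
proof (induction P rule: ipoly_induct)
  case (const c)
  have h: "h 1 = 1" "h (x + y) = h x + h y" for x y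
    using assms by (auto simp: is_ring_hom_def)
  have h0: "h 0 = 0" using h(2)[of 0 0] by simp
  have nat: "h (of_nat n) = of_nat n" for n
    by (induction n) (simp_all add: h h0)
  have "h (- x) = - h x" for x using h(2)[of x "-x"] by (simp add: h0 add_eq_0_iff)
  then have "h (of_int c) = of_int c"
    by (cases c) (simp_all add: nat h del: of_nat_Suc)
  then show ?case by simp
qed (use assms in \<open>auto simp: is_ring_hom_def\<close>)

lemma hom_witt_add:
  "is_ring_hom h \<Longrightarrow> h (witt_add p x y n) = witt_add p (\<lambda>i. h (x i)) (\<lambda>i. h (y i)) n"
  by (simp add: witt_add_def hom_ipoly_eval comp_def sum.case_distrib cong: sum.case_cong)

lemma hom_witt_mult:
  "is_ring_hom h \<Longrightarrow> h (witt_mult p x y n) = witt_mult p (\<lambda>i. h (x i)) (\<lambda>i. h (y i)) n"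
  by (simp add: witt_mult_def hom_ipoly_eval comp_def sum.case_distrib cong: sum.case_cong)

lemma hom_witt_uminus:
  "is_ring_hom h \<Longrightarrow> h (witt_uminus p x n) = witt_uminus p (\<lambda>i. h (x i)) n"
  by (simp add: witt_uminus_def hom_ipoly_eval)

lemma hom_witt_frob:
  "is_ring_hom h \<Longrightarrow> h (witt_frob p x n) = witt_frob p (\<lambda>i. h (x i)) n"
  by (simp add: witt_frob_def hom_ipoly_eval)

lemma hom_witt_versch:
  "is_ring_hom h \<Longrightarrow> h (witt_versch x n) = witt_versch (\<lambda>i. h (x i)) n"
  using hom_ipoly_eval[of h "\<lambda>_. 0" 0] by (simp add: witt_versch_def split: nat.split)

lemma hom_witt_one: "is_ring_hom h \<Longrightarrow> h (witt_one n) = witt_one n"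
  using hom_ipoly_eval[of h "\<lambda>_. 0" 0] by (simp add: witt_one_def is_ring_hom_def)

lemmas hom_witt = hom_witt_add hom_witt_mult hom_witt_uminus hom_witt_frob hom_witt_versch hom_witt_one

lemma obtain_lifts:
  fixes x y z :: "nat \<Rightarrow> 'a::comm_ring_1"
  obtains h :: "(nat \<times> nat) ipoly \<Rightarrow> 'a" and a b c
  where "is_ring_hom h" "x = (\<lambda>i. h (a i))" "y = (\<lambda>i. h (b i))" "z = (\<lambda>i. h (c i))"
proof
  let ?h = "ipoly_eval (\<lambda>(j, i). if j = (0::nat) then x i else if j = 1 then y i else z i)"
  show "is_ring_hom ?h" by (rule is_ring_hom_eval)
  show "x = (\<lambda>i. ?h (ipoly_var (0, i)))" "y = (\<lambda>i. ?h (ipoly_var (1, i)))"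
    "z = (\<lambda>i. ?h (ipoly_var (2, i)))" by simp_all
qed

context
  fixes p :: nat
  assumes p: "prime p"
begin

private lemma p0: "p > 0" using p by (rule prime_gt_0_nat)

lemmas ghost_witt = ghost_witt_add[OF p] ghost_witt_mult[OF p] ghost_witt_uminus[OF p]
  ghost_witt_frob[OF p] ghost_zero[OF p0] ghost_one[OF p0]

lemma witt_add_assoc: "witt_add p (witt_add p x y) z = witt_add p x (witt_add p y z)"
proof -
  obtain h :: "(nat \<times> nat) ipoly \<Rightarrow> 'a" and a b c where h: "is_ring_hom h"
    "x = (\<lambda>i. h (a i))" "y = (\<lambda>i. h (b i))" "z = (\<lambda>i. h (c i))" by (rule obtain_lifts)
  have "witt_add p (witt_add p a b) c = witt_add p a (witt_add p b c)"
    by (rule ghost_unique[OF p0]) (simp add: ghost_witt algebra_simps)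
  from arg_cong[where f = "\<lambda>s i. h (s i)", OF this] show ?thesis
    by (simp add: h hom_witt)
qed

lemma witt_add_commute: "witt_add p x y = witt_add p y x"
proof -
  obtain h :: "(nat \<times> nat) ipoly \<Rightarrow> 'a" and a b c where h: "is_ring_hom h"
    "x = (\<lambda>i. h (a i))" "y = (\<lambda>i. h (b i))" "x = (\<lambda>i. h (c i))" by (rule obtain_lifts)
  have "witt_add p a b = witt_add p b a"
    by (rule ghost_unique[OF p0]) (simp add: ghost_witt algebra_simps)
  from arg_cong[where f = "\<lambda>s i. h (s i)", OF this] show ?thesis
    by (simp add: h(1-3) hom_witt)
qed

lemma witt_add_zero: "witt_add p (\<lambda>_. 0) x = x"
proof -
  obtain h :: "(nat \<times> nat) ipoly \<Rightarrow> 'a" and a b c where h: "is_ring_hom h"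
    "x = (\<lambda>i. h (a i))" "x = (\<lambda>i. h (b i))" "x = (\<lambda>i. h (c i))" by (rule obtain_lifts)
  have h0: "h 0 = 0" using hom_ipoly_eval[OF h(1), of "\<lambda>_. 0" 0] by simp
  have "witt_add p (\<lambda>_. 0) a = a"
    by (rule ghost_unique[OF p0]) (simp add: ghost_witt)
  from arg_cong[where f = "\<lambda>s i. h (s i)", OF this] show ?thesis
    by (simp add: h(1-2) hom_witt h0)
qed

lemma witt_add_uminus: "witt_add p (witt_uminus p x) x = (\<lambda>_. 0)"
proof -
  obtain h :: "(nat \<times> nat) ipoly \<Rightarrow> 'a" and a b c where h: "is_ring_hom h"
    "x = (\<lambda>i. h (a i))" "x = (\<lambda>i. h (b i))" "x = (\<lambda>i. h (c i))" by (rule obtain_lifts)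
  have h0: "h 0 = 0" using hom_ipoly_eval[OF h(1), of "\<lambda>_. 0" 0] by simp
  have "witt_add p (witt_uminus p a) a = (\<lambda>_. 0)"
    by (rule ghost_unique[OF p0]) (simp add: ghost_witt)
  from arg_cong[where f = "\<lambda>s i. h (s i)", OF this] show ?thesis
    by (simp add: h(1-2) hom_witt h0)
qed

lemma witt_mult_assoc: "witt_mult p (witt_mult p x y) z = witt_mult p x (witt_mult p y z)"
proof -
  obtain h :: "(nat \<times> nat) ipoly \<Rightarrow> 'a" and a b c where h: "is_ring_hom h"
    "x = (\<lambda>i. h (a i))" "y = (\<lambda>i. h (b i))" "z = (\<lambda>i. h (c i))" by (rule obtain_lifts)
  have "witt_mult p (witt_mult p a b) c = witt_mult p a (witt_mult p b c)"
    by (rule ghost_unique[OF p0]) (simp add: ghost_witt algebra_simps)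
  from arg_cong[where f = "\<lambda>s i. h (s i)", OF this] show ?thesis
    by (simp add: h hom_witt)
qed

lemma witt_mult_commute: "witt_mult p x y = witt_mult p y x"
proof -
  obtain h :: "(nat \<times> nat) ipoly \<Rightarrow> 'a" and a b c where h: "is_ring_hom h"
    "x = (\<lambda>i. h (a i))" "y = (\<lambda>i. h (b i))" "x = (\<lambda>i. h (c i))" by (rule obtain_lifts)
  have "witt_mult p a b = witt_mult p b a"
    by (rule ghost_unique[OF p0]) (simp add: ghost_witt algebra_simps)
  from arg_cong[where f = "\<lambda>s i. h (s i)", OF this] show ?thesis
    by (simp add: h(1-3) hom_witt)
qed

lemma witt_mult_one: "witt_mult p witt_one x = x"
proof -
  obtain h :: "(nat \<times> nat) ipoly \<Rightarrow> 'a" and a b c where h: "is_ring_hom h"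
    "x = (\<lambda>i. h (a i))" "x = (\<lambda>i. h (b i))" "x = (\<lambda>i. h (c i))" by (rule obtain_lifts)
  have "witt_mult p witt_one a = a"
    by (rule ghost_unique[OF p0]) (simp add: ghost_witt)
  from arg_cong[where f = "\<lambda>s i. h (s i)", OF this] show ?thesis
    by (simp add: h(1-2) hom_witt)
qed

lemma witt_distrib: "witt_mult p (witt_add p x y) z = witt_add p (witt_mult p x z) (witt_mult p y z)"
proof -
  obtain h :: "(nat \<times> nat) ipoly \<Rightarrow> 'a" and a b c where h: "is_ring_hom h"
    "x = (\<lambda>i. h (a i))" "y = (\<lambda>i. h (b i))" "z = (\<lambda>i. h (c i))" by (rule obtain_lifts)
  have "witt_mult p (witt_add p a b) c = witt_add p (witt_mult p a c) (witt_mult p b c)"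
    by (rule ghost_unique[OF p0]) (simp add: ghost_witt algebra_simps)
  from arg_cong[where f = "\<lambda>s i. h (s i)", OF this] show ?thesis
    by (simp add: h hom_witt)
qed

lemma witt_versch_mult: "witt_mult p (witt_versch x) y = witt_versch (witt_mult p x (witt_frob p y))"
proof -
  obtain h :: "(nat \<times> nat) ipoly \<Rightarrow> 'a" and a b c where h: "is_ring_hom h"
    "x = (\<lambda>i. h (a i))" "y = (\<lambda>i. h (b i))" "x = (\<lambda>i. h (c i))" by (rule obtain_lifts)
  have "witt_mult p (witt_versch a) b = witt_versch (witt_mult p a (witt_frob p b))"
  proof (rule ghost_unique[OF p0])
    show "ghost p n (witt_mult p (witt_versch a) b) = ghost p n (witt_versch (witt_mult p a (witt_frob p b)))" for n
      by (cases n) (simp_all add: ghost_witt ghost_versch_0 ghost_versch_Suc[OF p0] mult_ac)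
  qed
  from arg_cong[where f = "\<lambda>s i. h (s i)", OF this] show ?thesis
    by (simp add: h(1-3) hom_witt)
qed

end

lemma witt_frob_prime_char:
  fixes x :: "nat \<Rightarrow> 'a::comm_ring_prime_char"
  shows "witt_frob CHAR('a) x = (\<lambda>i. x i ^ CHAR('a))"
proof
  fix i
  obtain P where "witt_frob_poly CHAR('a) i - ipoly_var i ^ CHAR('a) = of_nat CHAR('a) * P"
    using witt_frob_poly_cong[of "CHAR('a)" i] by (auto elim: dvdE)
  from arg_cong[where f = "ipoly_eval x", OF this] show "witt_frob CHAR('a) x i = x i ^ CHAR('a)"
    by (simp add: witt_frob_def)
qed


section \<open>The ring of Witt vectors\<close>

typedef 'a witt = "UNIV :: (nat \<Rightarrow> 'a) set"
  morphisms witt_coeff Witt ..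

setup_lifting type_definition_witt

instantiation witt :: (comm_ring_prime_char) comm_ring_1
begin

lift_definition zero_witt :: "'a witt" is "\<lambda>_. 0" .
lift_definition one_witt :: "'a witt" is witt_one .
lift_definition plus_witt :: "'a witt \<Rightarrow> 'a witt \<Rightarrow> 'a witt" is "witt_add CHAR('a)" .
lift_definition times_witt :: "'a witt \<Rightarrow> 'a witt \<Rightarrow> 'a witt" is "witt_mult CHAR('a)" .
lift_definition uminus_witt :: "'a witt \<Rightarrow> 'a witt" is "witt_uminus CHAR('a)" .
definition minus_witt :: "'a witt \<Rightarrow> 'a witt \<Rightarrow> 'a witt" where "minus_witt x y = x + - y"

instance
proof
  fix a b c :: "'a witt"
  show "a + b + c = a + (b + c)" by transfer (rule witt_add_assoc, simp)
  show "a + b = b + a" by transfer (rule witt_add_commute, simp)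
  show "0 + a = a" by transfer (rule witt_add_zero, simp)
  show "- a + a = 0" by transfer (rule witt_add_uminus, simp)
  show "a - b = a + - b" by (rule minus_witt_def)
  show "a * b * c = a * (b * c)" by transfer (rule witt_mult_assoc, simp)
  show "a * b = b * a" by transfer (rule witt_mult_commute, simp)
  show "1 * a = a" by transfer (rule witt_mult_one, simp)
  show "(a + b) * c = a * c + b * c" by transfer (rule witt_distrib, simp)
  have "witt_one 0 \<noteq> (0::'a)" by (simp add: witt_one_def)
  then show "(0::'a witt) \<noteq> 1" by transfer metis
qed

end

lift_definition frob_witt :: "'a::comm_ring_prime_char witt \<Rightarrow> 'a witt" is "\<lambda>x i. x i ^ CHAR('a)" .

lift_definition versch_witt :: "'a::comm_ring_prime_char witt \<Rightarrow> 'a witt" is witt_versch .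

lemma is_ring_hom_frob: "is_ring_hom (\<lambda>x::'a::comm_ring_prime_char. x ^ CHAR('a))"
  by (simp add: is_ring_hom_def freshmans_dream power_mult_distrib)

lemma frob_witt_add: "frob_witt (x + y) = frob_witt x + frob_witt y"
  by transfer (simp add: hom_witt_add[OF is_ring_hom_frob])

lemma frob_witt_mult: "frob_witt (x * y) = frob_witt x * frob_witt y"
  by transfer (simp add: hom_witt_mult[OF is_ring_hom_frob])

lemma frob_witt_1: "frob_witt 1 = 1"
  by transfer (simp add: hom_witt_one[OF is_ring_hom_frob])

lemma versch_witt_mult: "versch_witt x * y = versch_witt (x * frob_witt y)"
  by transfer (simp add: witt_versch_mult witt_frob_prime_char)

lemma witt_coeff_0_mult: "witt_coeff (x * y) 0 = witt_coeff x 0 * witt_coeff y 0"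
  using ghost_witt_mult[of "CHAR('a)" 0 "witt_coeff x" "witt_coeff (y::'a::comm_ring_prime_char witt)"]
  by (simp add: times_witt.rep_eq ghost_def)

lemma witt_coeff_0_add: "witt_coeff (x + y) 0 = witt_coeff x 0 + witt_coeff y 0"
  using ghost_witt_add[of "CHAR('a)" 0 "witt_coeff x" "witt_coeff (y::'a::comm_ring_prime_char witt)"]
  by (simp add: plus_witt.rep_eq ghost_def)

lemma witt_coeff_0_of_nat: "witt_coeff (of_nat n :: 'a::comm_ring_prime_char witt) 0 = of_nat n"
  by (induction n) (simp_all add: witt_coeff_0_add zero_witt.rep_eq one_witt.rep_eq witt_one_def)

lemma versch_pow_coeff: "witt_coeff ((versch_witt ^^ i) x) n = (if n < i then 0 else witt_coeff x (n - i))"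
  by (induction i arbitrary: n) (auto simp: versch_witt.rep_eq witt_versch_def split: nat.split)

lemma frob_pow_coeff:
  "witt_coeff ((frob_witt ^^ i) x) n = witt_coeff (x :: 'a::comm_ring_prime_char witt) n ^ (CHAR('a) ^ i)"
  by (induction i) (simp_all add: frob_witt.rep_eq mult.commute flip: power_mult)

lemma versch_pow_mult: "(versch_witt ^^ i) x * y = (versch_witt ^^ i) (x * (frob_witt ^^ i) y)"
proof (induction i arbitrary: y)
  case (Suc i)
  have "(versch_witt ^^ Suc i) x * y = versch_witt ((versch_witt ^^ i) x * frob_witt y)"
    by (simp add: versch_witt_mult)
  also have "\<dots> = (versch_witt ^^ Suc i) (x * (frob_witt ^^ Suc i) y)"
    by (simp only: Suc) (simp add: funpow_swap1)
  finally show ?case .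
qed simp

lemma witt_eqI: "(\<And>n. witt_coeff x n = witt_coeff y n) \<Longrightarrow> x = y"
  by transfer auto

lemma frob_versch_pow_commute:
  "(frob_witt ^^ i) ((versch_witt ^^ j) x) = (versch_witt ^^ j) ((frob_witt ^^ i) (x::'a::comm_ring_prime_char witt))"
  by (rule witt_eqI) (simp add: versch_pow_coeff frob_pow_coeff power_0_left)

lemma witt_nonzero_decomp:
  assumes "x \<noteq> (0 :: 'a::comm_ring_prime_char witt)"
  obtains i y where "x = (versch_witt ^^ i) y" "witt_coeff y 0 \<noteq> 0"
proof
  define i where "i = (LEAST i. witt_coeff x i \<noteq> 0)"
  have "\<exists>i. witt_coeff x i \<noteq> 0"
    using assms witt_eqI[of x 0] by (auto simp: zero_witt.rep_eq)
  then have i: "witt_coeff x i \<noteq> 0" unfolding i_def by (rule LeastI_ex)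
  have less: "witt_coeff x n = 0" if "n < i" for n
    using that not_less_Least unfolding i_def by blast
  show "x = (versch_witt ^^ i) (Witt (\<lambda>n. witt_coeff x (n + i)))"
    by (rule witt_eqI) (simp add: versch_pow_coeff less Witt_inverse)
  show "witt_coeff (Witt (\<lambda>n. witt_coeff x (n + i))) 0 \<noteq> 0"
    using i by (simp add: Witt_inverse)
qed

instance witt :: (idom_prime_char) idom
proof
  fix x y :: "'a witt"
  assume "x \<noteq> 0" "y \<noteq> 0"
  then obtain i j u v where x: "x = (versch_witt ^^ i) u" "witt_coeff u 0 \<noteq> 0"
    and y: "y = (versch_witt ^^ j) v" "witt_coeff v 0 \<noteq> 0"
    by (meson witt_nonzero_decomp)
  have "x * y = (versch_witt ^^ i) ((versch_witt ^^ j) ((frob_witt ^^ i) v) * u)"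
    by (simp add: x y versch_pow_mult frob_versch_pow_commute mult.commute[of u])
  also have "\<dots> = (versch_witt ^^ (i + j)) ((frob_witt ^^ i) v * (frob_witt ^^ j) u)"
    by (simp add: versch_pow_mult[of j] funpow_add)
  finally have "witt_coeff (x * y) (i + j) = witt_coeff v 0 ^ (CHAR('a) ^ i) * witt_coeff u 0 ^ (CHAR('a) ^ j)"
    by (simp add: versch_pow_coeff witt_coeff_0_mult frob_pow_coeff)
  then show "x * y \<noteq> 0" using x(2) y(2) by (auto simp: zero_witt.rep_eq)
qed

lemma witt_of_nat_char:
  "witt_coeff (of_nat CHAR('a) :: 'a::comm_ring_prime_char witt) 1 = 1"
proof -
  let ?p = "CHAR('a)"
  have p: "prime ?p" by simp
  define c :: "nat \<Rightarrow> nat \<Rightarrow> nat ipoly" where "c k = ((witt_add ?p witt_one) ^^ k) (\<lambda>_. 0)" for k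
  have ghost: "ghost ?p n (c k) = of_nat k" for n k
    by (induction k) (simp_all add: c_def ghost_witt_add[OF p] ghost_one ghost_zero)
  define h :: "nat ipoly \<Rightarrow> 'a" where "h = ipoly_eval (\<lambda>_. 0)"
  have h: "is_ring_hom h" unfolding h_def by (rule is_ring_hom_eval)
  have "(\<lambda>n. h (c k n)) = witt_coeff (of_nat k :: 'a witt)" for k
  proof (induction k)
    case 0
    then show ?case by (simp add: c_def h_def zero_witt.rep_eq)
  next
    case (Suc k)
    have "(\<lambda>n. h (c (Suc k) n)) = witt_add ?p witt_one (\<lambda>n. h (c k n))"
      by (simp add: c_def hom_witt_add[OF h] hom_witt_one[OF h])
    then show ?case by (simp add: Suc plus_witt.rep_eq one_witt.rep_eq)
  qed
  then have coeff: "witt_coeff (of_nat ?p :: 'a witt) 1 = h (c ?p 1)" by metis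
  have c0: "c ?p 0 = of_nat ?p" using ghost[of 0 ?p] by (simp add: ghost_def)
  obtain r where r: "?p = Suc (Suc r)"
    using prime_ge_2_nat[OF p] by (metis add_2_eq_Suc le_Suc_ex)
  have "of_nat ?p ^ ?p + of_nat ?p * c ?p 1 = of_nat ?p"
    using ghost[of 1 ?p] c0 by (simp add: ghost_def)
  then have "of_nat ?p * c ?p 1 = of_nat ?p * (1 - of_nat ?p ^ Suc r)"
    by (subst (asm) (2) r) (simp add: algebra_simps)
  then have "c ?p 1 = 1 - of_nat ?p ^ Suc r"
    by (rule ipoly_of_nat_mult_cancel) simp
  then show ?thesis unfolding coeff by (simp add: h_def)
qed

lemma CHAR_witt: "CHAR('a::idom_prime_char witt) = 0"
proof (rule ccontr)
  assume *: "CHAR('a witt) \<noteq> 0"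
  then have "prime CHAR('a witt)" using prime_CHAR_semidom[where ?'a = "'a witt"] by simp
  moreover have "(of_nat CHAR('a witt) :: 'a) = 0"
    using witt_coeff_0_of_nat[of "CHAR('a witt)", where ?'a = 'a] by (simp add: zero_witt.rep_eq)
  then have "CHAR('a) dvd CHAR('a witt)" by (simp add: of_nat_eq_0_iff_char_dvd)
  ultimately have "CHAR('a witt) = CHAR('a)"
    using primes_dvd_imp_eq[of "CHAR('a)" "CHAR('a witt)"] by simp
  then have "witt_coeff (0 :: 'a witt) 1 = 1"
    using witt_of_nat_char[where ?'a = 'a] of_nat_CHAR[where ?'a = "'a witt"] by simp
  then show False by (simp add: zero_witt.rep_eq)
qed

instance witt :: (idom_prime_char) ring_char_0
proof
  show "inj (of_nat :: nat \<Rightarrow> 'a witt)"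
  proof (rule injI)
    have *: "m = n" if "m \<le> n" "(of_nat m :: 'a witt) = of_nat n" for m n
    proof -
      have "(of_nat (n - m) :: 'a witt) = 0" using that by (simp add: of_nat_diff)
      then have "CHAR('a witt) dvd n - m" by (simp only: of_nat_eq_0_iff_char_dvd)
      then show ?thesis using that CHAR_witt[where ?'a = 'a] by simp
    qed
    show "m = n" if "(of_nat m :: 'a witt) = of_nat n" for m n
      using that *[of m n] *[of n m] by (cases "m \<le> n") auto
  qed
qed

lemma fract_of_nat: "(of_nat n :: 'a::idom fract) = Fract (of_nat n) 1"
  by (induction n) (simp_all add: Zero_fract_def One_fract_def)

instance fract :: ("{idom,ring_char_0}") ring_char_0
  by standard (auto simp: inj_on_def fract_of_nat eq_fract)

instance fract :: ("{idom,ring_char_0}") field_char_0 ..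


section \<open>Unramified extensions and characters\<close>

text \<open>
  Throughout, \<open>'k\<close> is an algebraically closed field of characteristic \<open>p = CHAR('k)\<close> and everything
  takes place in the fraction field of \<open>W('k)\<close>. The finite field with \<open>p ^ r\<close> elements is the
  set of roots of \<open>x ^ (p ^ r) = x\<close> in \<open>'k\<close>; its ring of Witt vectors consists of the Witt
  vectors whose components lie in it.
\<close>

definition of_witt :: "'k::idom_prime_char witt \<Rightarrow> 'k witt fract" where
  "of_witt w = Fract w 1"

definition finite_subfield :: "nat \<Rightarrow> 'k::field_prime_char set" where
  "finite_subfield r = {c. c ^ (CHAR('k) ^ r) = c}"

definition unram_ints :: "nat \<Rightarrow> 'k::field_prime_char witt fract set" where
  "unram_ints r = of_witt ` {w. \<forall>i. witt_coeff w i \<in> finite_subfield r}"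

definition mu :: "nat \<Rightarrow> 'k::field_prime_char witt fract set" where
  "mu r = {x \<in> unram_ints r. x ^ (CHAR('k) ^ r - 1) = 1}"

text \<open>
  The Galois group of \<open>W(F)\<close> over \<open>\<int>\<^sub>p\<close>, where \<open>F\<close> has \<open>p ^ r\<close> elements, is cyclic of order \<open>r\<close>,
  generated by the Frobenius automorphism, and the trace is the sum of the conjugates.
\<close>

definition unram_trace :: "nat \<Rightarrow> 'k::field_prime_char witt fract \<Rightarrow> 'k witt fract" where
  "unram_trace r x = of_witt (\<Sum>i<r. (frob_witt ^^ i) (THE w. of_witt w = x))"

lemma of_witt_eq_iff [simp]: "of_witt v = of_witt w \<longleftrightarrow> v = w"
  by (simp add: of_witt_def eq_fract)

lemma unram_trace_of_witt: "unram_trace r (of_witt w) = of_witt (\<Sum>i<r. (frob_witt ^^ i) w)"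
  by (simp add: unram_trace_def)

lemma frob_witt_0 [simp]: "frob_witt 0 = 0"
  using frob_witt_add[of 0 0] by simp

lemma frob_witt_sum: "frob_witt (\<Sum>i\<in>I. f i) = (\<Sum>i\<in>I. frob_witt (f i))"
  by (induction I rule: infinite_finite_induct) (auto simp: frob_witt_add)

lemma unram_trace_in_Zp:
  assumes "x \<in> unram_ints r"
  shows "unram_trace r x \<in> unram_ints 1"
proof -
  obtain w where w: "x = of_witt w" "\<forall>i. witt_coeff w i \<in> finite_subfield r"
    using assms by (auto simp: unram_ints_def)
  have fr: "(frob_witt ^^ r) w = w"
    using w(2) by (intro witt_eqI) (simp add: frob_pow_coeff finite_subfield_def)
  let ?t = "\<Sum>i<r. (frob_witt ^^ i) w"
  have "frob_witt ?t = (\<Sum>i<r. (frob_witt ^^ Suc i) w)"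
    by (simp add: frob_witt_sum)
  also have "\<dots> = ?t"
    using sum.lessThan_Suc_shift[of "\<lambda>i. (frob_witt ^^ i) w" r] fr by (simp add: add.commute)
  finally have "witt_coeff (frob_witt ?t) i = witt_coeff ?t i" for i by simp
  then show ?thesis
    by (auto simp: w(1) unram_trace_of_witt unram_ints_def finite_subfield_def frob_witt.rep_eq)
qed

lemma frob_pow_mult: "(frob_witt ^^ r) (v * w) = (frob_witt ^^ r) v * (frob_witt ^^ r) w"
  by (induction r) (simp_all add: frob_witt_mult)

lemma of_witt_mult: "of_witt (v * w) = of_witt v * of_witt w"
  by (simp add: of_witt_def)

lemma unram_ints_altdef: "unram_ints r = of_witt ` {w. (frob_witt ^^ r) w = w}"
  unfolding unram_ints_def finite_subfield_def
  by (rule arg_cong[where f = "\<lambda>S. of_witt ` S"]) (auto simp: frob_pow_coeff intro: witt_eqI, metis frob_pow_coeff)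

lemma unram_ints_mult: "x \<in> unram_ints r \<Longrightarrow> y \<in> unram_ints r \<Longrightarrow> x * y \<in> unram_ints r"
  unfolding unram_ints_altdef
  by (auto simp: frob_pow_mult simp flip: of_witt_mult)

lemma unram_ints_1: "1 \<in> unram_ints r"
proof -
  have "(frob_witt ^^ r) 1 = (1::'a witt)" by (induction r) (simp_all add: frob_witt_1)
  then show ?thesis unfolding unram_ints_altdef
    by (intro image_eqI[of _ _ 1]) (simp_all add: of_witt_def One_fract_def)
qed

lemma unram_ints_power: "x \<in> unram_ints r \<Longrightarrow> x ^ k \<in> unram_ints r"
  by (induction k) (auto intro: unram_ints_mult unram_ints_1)

lemma mu_mult: "x \<in> mu r \<Longrightarrow> y \<in> mu r \<Longrightarrow> x * y \<in> mu r"
  by (simp add: mu_def unram_ints_mult power_mult_distrib)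

lemma mu_inverse:
  assumes "r > 0" "x \<in> mu r"
  shows "inverse x \<in> mu r" "x \<noteq> 0"
proof -
  let ?n = "CHAR('a) ^ r - 1"
  have "CHAR('a) ^ r > 1" using assms(1) prime_gt_1_nat[of "CHAR('a)"] by (intro one_less_power) auto
  then have n: "?n > 0" by simp
  have x: "x ^ ?n = 1" "x \<in> unram_ints r" using assms(2) by (auto simp: mu_def)
  then show nz: "x \<noteq> 0" using n by (auto simp: power_0_left)
  have "x * x ^ (?n - 1) = 1" using x(1) n by (metis power_eq_if less_not_refl)
  then have "inverse x = x ^ (?n - 1)" by (metis inverse_unique)
  then show "inverse x \<in> mu r" using x(1) unram_ints_power[OF x(2), of "?n - 1"]
    by (simp add: mu_def) (metis power_inverse inverse_1)
qed

section \<open>Laurent polynomials\<close>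

type_synonym ('a, 'n) laurent = "(int ^ 'n) \<Rightarrow>\<^sub>0 'a"

definition monomial_at :: "'a::field ^ 'n \<Rightarrow> int ^ 'n::finite \<Rightarrow> 'a" where
  "monomial_at x u = (\<Prod>i\<in>UNIV. (x $ i) powi (u $ i))"

definition laurent_eval :: "('a::field, 'n::finite) laurent \<Rightarrow> 'a ^ 'n \<Rightarrow> 'a" where
  "laurent_eval h x = (\<Sum>u\<in>Poly_Mapping.keys h. Poly_Mapping.lookup h u * monomial_at x u)"

definition tensor_vec :: "'a::times ^ 'n \<Rightarrow> 'a ^ 'm \<Rightarrow> 'a ^ ('n \<times> 'm)" where
  "tensor_vec u v = (\<chi> ij. u $ fst ij * v $ snd ij)"

text \<open>The Laurent polynomial \<open>g\<close> has coefficients in the \<open>n\<close>-th power of a group of roots of unity.\<close>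

definition diag_base_change ::
  "('a::field, 'n::finite) laurent \<Rightarrow> ('a ^ 'n, 'm::finite) laurent \<Rightarrow> ('a, 'n \<times> 'm) laurent" where
  "diag_base_change f g = (\<Sum>u\<in>Poly_Mapping.keys f. \<Sum>v\<in>Poly_Mapping.keys g.
     Poly_Mapping.single (tensor_vec u v)
       (Poly_Mapping.lookup f u * monomial_at (Poly_Mapping.lookup g v) u))"

definition integral_basis :: "('m::finite \<Rightarrow> int ^ 'm) \<Rightarrow> bool" where
  "integral_basis v \<longleftrightarrow> (let v' = (\<lambda>j. \<chi> i. real_of_int (v j $ i)) in
     inj v' \<and> independent (range v') \<and> span (range v') = UNIV)"

section \<open>Exponential sums and the power series \<open>C\<close>\<close>

text \<open>
  Power series in \<open>T\<close> are the inner \<open>fps\<close>, power series in \<open>s\<close> the outer one. The argument \<open>r\<close> stands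
  for the finite field with \<open>p ^ r\<close> elements and a class in \<open>\<int>\<^sup>N/(p ^ r - 1)\<close> is given by an integer
  vector \<open>e\<close>. The constant \<^const>\<open>fps_binomial\<close> is \<open>x \<mapsto> (1 + T)\<^sup>x\<close>.
\<close>

definition exp_sum :: "('k::field_prime_char witt fract, 'n::finite) laurent \<Rightarrow> int ^ 'n \<Rightarrow> nat \<Rightarrow> 'k witt fract fps" where
  "exp_sum h e r = (\<Sum>x | \<forall>i. x $ i \<in> mu r.
     fps_const (monomial_at x (- e)) * fps_binomial (unram_trace r (laurent_eval h x)))"

lemma monomial_at_mult: "monomial_at (\<chi> i. b $ i * x $ i) u = monomial_at b u * monomial_at x u"
  by (simp add: monomial_at_def power_int_mult_distrib prod.distrib)

lemma monomial_at_minus: "monomial_at b (- u) = inverse (monomial_at b u)"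
  by (simp add: monomial_at_def power_int_minus prod_inversef[symmetric] comp_def)

text \<open>
  Replacing \<open>f(x)\<close> by \<open>f(bx)\<close>, as happens to each factor \<open>b\<^sub>j y\<^sup>v\<close> of a diagonal base change,
  multiplies the sum twisted by \<open>x\<^sup>-\<^sup>e\<close> by \<open>b\<^sup>e\<close>, with a positive exponent.
\<close>

lemma exp_sum_scale:
  assumes r: "r > 0" and b: "\<forall>i. b $ i \<in> mu r"
  shows "exp_sum (\<Sum>u\<in>Poly_Mapping.keys f. Poly_Mapping.single u (Poly_Mapping.lookup f u * monomial_at b u)) e r =
    fps_const (monomial_at b e) * exp_sum f e r"
proof -
  let ?h = "\<Sum>u\<in>Poly_Mapping.keys f. Poly_Mapping.single u (Poly_Mapping.lookup f u * monomial_at b u)"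
  let ?A = "{x. \<forall>i. x $ i \<in> mu r}"
  have b0: "b $ i \<noteq> 0" for i using mu_inverse[OF r] b by blast
  then have inv: "b $ i * (inverse (b $ i) * c) = c" for i c by (simp flip: mult.assoc)
  from b0 have mb: "monomial_at b e \<noteq> 0" by (simp add: monomial_at_def)
  have lk: "Poly_Mapping.lookup ?h u = Poly_Mapping.lookup f u * monomial_at b u" for u
    by (cases "u \<in> Poly_Mapping.keys f")
      (auto simp: lookup_sum lookup_single when_def not_in_keys_iff_lookup_eq_zero sum.delta cong: if_cong)
  have ev: "laurent_eval ?h x = laurent_eval f (\<chi> i. b $ i * x $ i)" for x
  proof -
    have "laurent_eval ?h x = (\<Sum>u\<in>Poly_Mapping.keys f. Poly_Mapping.lookup ?h u * monomial_at x u)"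
      unfolding laurent_eval_def
      by (intro sum.mono_neutral_left) (auto simp: in_keys_iff lk)
    then show ?thesis by (simp only: lk laurent_eval_def monomial_at_mult mult.assoc)
  qed
  have "exp_sum f e r = (\<Sum>x\<in>?A. fps_const (monomial_at (\<chi> i. b $ i * x $ i) (- e)) *
      fps_binomial (unram_trace r (laurent_eval f (\<chi> i. b $ i * x $ i))))"
    unfolding exp_sum_def
    by (rule sum.reindex_bij_witness[of _ "\<lambda>x. \<chi> i. b $ i * x $ i" "\<lambda>x. \<chi> i. inverse (b $ i) * x $ i"])
      (use b0 b in \<open>auto simp: vec_eq_iff inv intro!: mu_mult mu_inverse(1)[OF r]\<close>)
  also have "\<dots> = fps_const (monomial_at b (- e)) * exp_sum ?h e r"
    by (simp only: exp_sum_def ev monomial_at_mult sum_distrib_left fps_const_mult[symmetric] mult.assoc)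
  finally show ?thesis
    using mb by (simp add: monomial_at_minus flip: mult.assoc)
qed


definition exp_fps :: "'a::field_char_0 fps fps \<Rightarrow> 'a fps fps" where
  "exp_fps F = fps_compose (Abs_fps (\<lambda>n. fps_const (1 / fact n))) F"

definition C_fun :: "('k::field_prime_char witt fract, 'n::finite) laurent \<Rightarrow> int ^ 'n \<Rightarrow> nat \<Rightarrow> 'k witt fract fps fps" where
  "C_fun h e r = exp_fps (Abs_fps (\<lambda>l. if l = 0 then 0 else
     fps_const (- 1 / ((of_nat CHAR('k) ^ (r * l) - 1) ^ CARD('n)) / of_nat l) *
     exp_sum h (\<chi> i. e $ i * int ((CHAR('k) ^ (r * l) - 1) div (CHAR('k) ^ r - 1))) (r * l)))"

text \<open>
  The operation \<open>A \<otimes> B\<close> multiplies the coefficients \<open>a\<^sub>k\<close> in \<open>A = exp (- \<Sum>a\<^sub>k s\<^sup>k/k)\<close>. It is given here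
  for a finite family; the \<open>a\<^sub>k\<close> with \<open>k > 0\<close> are unique (see \<open>zeta_exp_eqD\<close> below), so the
  description is definite.
\<close>

definition zeta_exp :: "(nat \<Rightarrow> 'a::field_char_0 fps) \<Rightarrow> 'a fps fps" where
  "zeta_exp a = exp_fps (Abs_fps (\<lambda>k. if k = 0 then 0 else - fps_const (1 / of_nat k) * a k))"

definition tensor_fps :: "'j set \<Rightarrow> ('j \<Rightarrow> 'a::field_char_0 fps fps) \<Rightarrow> 'a fps fps" where
  "tensor_fps J A = (THE B. \<exists>a. (\<forall>j\<in>J. A j = zeta_exp (a j)) \<and> B = zeta_exp (\<lambda>k. \<Prod>j\<in>J. a j k))"

lemma exp_fps_inj:
  fixes F G :: "'a::field_char_0 fps fps"
  assumes "exp_fps F = exp_fps G" "fps_nth F 0 = 0" "fps_nth G 0 = 0"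
  shows "F = G"
proof -
  let ?E = "Abs_fps (\<lambda>n. fps_const (1 / fact n)) :: 'a fps fps"
  have dE: "fps_deriv ?E = ?E"
  proof (rule fps_ext)
    fix n
    have "fps_nth (fps_deriv ?E) n = of_nat (Suc n) * fps_const (1 / fact (Suc n))"
      by (simp only: fps_deriv_nth fps_nth_Abs_fps Suc_eq_plus1)
    also have "\<dots> = fps_const (of_nat (Suc n) * (1 / fact (Suc n)))"
      by (simp only: fps_of_nat[symmetric] fps_const_mult)
    also have "of_nat (Suc n) * (1 / fact (Suc n)) = (1 / fact n :: 'a)"
      by (simp only: fact_Suc) (simp del: of_nat_Suc)
    finally show "fps_nth (fps_deriv ?E) n = fps_nth ?E n" by (simp only: fps_nth_Abs_fps)
  qed
  have d: "fps_deriv (exp_fps F) = exp_fps F * fps_deriv F" if "fps_nth F 0 = 0" for F :: "'a fps fps"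
    using fps_compose_deriv[OF that, of ?E] by (simp add: exp_fps_def dE)
  have "fps_nth (exp_fps F) 0 = 1" by (simp add: exp_fps_def)
  then have "exp_fps F \<noteq> 0" by auto
  moreover have "exp_fps F * fps_deriv F = exp_fps F * fps_deriv G"
    using d[OF assms(2)] d[OF assms(3)] assms(1) by metis
  ultimately have D: "fps_deriv F = fps_deriv G" by (metis mult_cancel_left)
  show ?thesis
  proof (rule fps_ext)
    fix n
    show "fps_nth F n = fps_nth G n"
    proof (cases n)
      case (Suc m)
      have "of_nat (Suc m) * fps_nth F (Suc m) = of_nat (Suc m) * fps_nth G (Suc m)"
        using arg_cong[OF D, of "\<lambda>f. fps_nth f m"] by (simp only: fps_deriv_nth Suc_eq_plus1)
      moreover have "(of_nat (Suc m) :: 'a fps) \<noteq> 0"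
        by (simp only: fps_of_nat[symmetric] fps_const_eq_0_iff of_nat_eq_0_iff)
      ultimately show ?thesis unfolding Suc by (metis mult_cancel_left)
    qed (use assms in simp)
  qed
qed

lemma zeta_exp_eqD:
  fixes a b :: "nat \<Rightarrow> 'a::field_char_0 fps"
  assumes "zeta_exp a = zeta_exp b" "k > 0"
  shows "a k = b k"
proof -
  have "Abs_fps (\<lambda>k. if k = 0 then 0 else - fps_const (1 / of_nat k) * a k) =
      Abs_fps (\<lambda>k. if k = 0 then 0 else - fps_const (1 / of_nat k) * b k)"
    using assms(1) unfolding zeta_exp_def by (rule exp_fps_inj) simp_all
  from arg_cong[OF this, of "\<lambda>f. fps_nth f k"]
  have "- fps_const (1 / of_nat k) * a k = - fps_const (1 / of_nat k) * b k"
    using assms(2) by (simp only: fps_nth_Abs_fps) simp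
  moreover have "- fps_const (1 / of_nat k :: 'a) \<noteq> 0"
    using assms(2) by simp
  ultimately show ?thesis by (metis mult_cancel_left)
qed

lemma zeta_exp_cong: "(\<And>k. k > 0 \<Longrightarrow> a k = b k) \<Longrightarrow> zeta_exp a = zeta_exp b"
  unfolding zeta_exp_def by (rule arg_cong[of _ _ exp_fps], rule fps_ext) simp

lemma tensor_fps_zeta_exp:
  "tensor_fps J (\<lambda>j. zeta_exp (a j)) = zeta_exp (\<lambda>k. \<Prod>j\<in>J. a j k)"
  unfolding tensor_fps_def
proof (rule the_equality)
  fix B
  assume "\<exists>a'. (\<forall>j\<in>J. zeta_exp (a j) = zeta_exp (a' j)) \<and> B = zeta_exp (\<lambda>k. \<Prod>j\<in>J. a' j k)"
  then obtain a' where a': "\<forall>j\<in>J. zeta_exp (a j) = zeta_exp (a' j)" "B = zeta_exp (\<lambda>k. \<Prod>j\<in>J. a' j k)"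
    by blast
  show "B = zeta_exp (\<lambda>k. \<Prod>j\<in>J. a j k)"
    unfolding a'(2) using a'(1) by (intro zeta_exp_cong prod.cong) (auto dest: zeta_exp_eqD[OF sym])
qed auto

section \<open>Orbits of multiplication by \<open>q\<close>\<close>

text \<open>
  A tuple of classes in \<open>(\<int>\<^sub>(\<^sub>p\<^sub>)\<^sup>n/\<int>\<^sup>n)\<^sup>m\<close> is a coset of a matrix of rationals; an orbit is a set of such
  cosets, and its length is the cardinality of that set.
\<close>

definition Z_loc :: "nat \<Rightarrow> rat set" where
  "Z_loc p = {of_int a / of_int b |a b. \<not> int p dvd b}"

definition loc_tuples :: "nat \<Rightarrow> (rat ^ 'n ^ 'm) set" where
  "loc_tuples p = {u. \<forall>j i. u $ j $ i \<in> Z_loc p}"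

definition mod_Z_class :: "rat ^ 'n ^ 'm \<Rightarrow> (rat ^ 'n ^ 'm) set" where
  "mod_Z_class u = {w. \<forall>j i. w $ j $ i - u $ j $ i \<in> \<int>}"

definition q_orbit :: "nat \<Rightarrow> rat ^ 'n ^ 'm \<Rightarrow> (rat ^ 'n ^ 'm) set set" where
  "q_orbit q u = {mod_Z_class (\<chi> j i. of_nat q ^ k * u $ j $ i) |k. True}"

definition q_orbits :: "nat \<Rightarrow> nat \<Rightarrow> (rat ^ 'n ^ 'm) set set set" where
  "q_orbits p q = q_orbit q ` loc_tuples p"

definition orbit_solution :: "('m::finite \<Rightarrow> int ^ 'm) \<Rightarrow> int ^ ('n::finite \<times> 'm) \<Rightarrow> nat \<Rightarrow> rat ^ 'n ^ 'm \<Rightarrow> bool" where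
  "orbit_solution v d q u \<longleftrightarrow>
     (\<forall>ik. (\<Sum>j\<in>UNIV. tensor_vec (u $ j) (\<chi> k. of_int (v j $ k))) $ ik - of_int (d $ ik) / (of_nat q - 1) \<in> \<int>)"

text \<open>Applied to integral \<open>c * u\<close> only; the floor just changes the type.\<close>

definition int_multiple :: "rat \<Rightarrow> rat ^ 'n \<Rightarrow> int ^ 'n" where
  "int_multiple c u = (\<chi> i. \<lfloor>c * u $ i\<rfloor>)"

end

theory Submission
  imports Defs "HOL-Number_Theory.Residues"
begin

text \<open>
  Put \<open>N = q\<^sup>l - 1\<close> and \<open>\<mu> = \<mu>\<^sub>N\<close>. For \<open>z \<in> \<mu>\<^sup>n\<^sup>m\<close> let \<open>x\<^sub>j \<in> \<mu>\<^sup>n\<close> have the entries \<open>\<Prod>\<^sub>k z\<^sub>i\<^sub>k ^ (v\<^sub>j\<^sub>k)\<close>. Then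
  \<open>(f \<otimes> g)(z) = \<Sum>\<^sub>j f(b\<^sub>j x\<^sub>j)\<close>, so the additive character makes the summand of the exponential sum
  \<open>S\<close> of \<open>f \<otimes> g\<close> a product of functions of the \<open>x\<^sub>j\<close>. Expanding each of them in the characters
  \<open>x \<mapsto> x\<^sup>e\<close> of \<open>\<mu>\<^sup>n\<close> and summing over \<open>z\<close> gives, by orthogonality,

  \<open>S = \<Sum> \<Prod>\<^sub>j b\<^sub>j ^ (e\<^sub>j) S\<^sub>f(e\<^sub>j)\<close>,

  the sum being over the \<open>(e\<^sub>1, \<dots>, e\<^sub>m)\<close> modulo \<open>N\<close> with \<open>\<Sum>\<^sub>j e\<^sub>j \<otimes> v\<^sub>j \<equiv> d N/(q - 1)\<close>, where
  \<open>S\<^sub>f(e)\<close> is the sum of \<open>x\<^sup>-\<^sup>e \<psi>(f(x))\<close>; the substitution of \<open>b\<^sub>j x\<close> for \<open>x\<close> contributes the power of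
  \<open>b\<^sub>j\<close>. This is \<open>exp_sum_diag_base_change\<close>.

  In terms of \<open>u\<^sub>j = e\<^sub>j/N\<close> the sum is over the solutions of \<open>\<Sum>\<^sub>j u\<^sub>j \<otimes> v\<^sub>j \<equiv> d/(q - 1)\<close> in
  \<open>(\<int>\<^sub>(\<^sub>p\<^sub>)\<^sup>n/\<int>\<^sup>n)\<^sup>m\<close> that \<open>q\<^sup>l\<close> fixes, that is, over the points of those orbits \<open>X\<close> of solutions whose
  length \<open>r\<close> divides \<open>l\<close>. Frobenius leaves \<open>S\<^sub>f\<close> unchanged when its twist is multiplied by \<open>q\<close>, so the
  \<open>r\<close> points of \<open>X\<close> contribute equally (\<open>exp_sum_orbit_invariant\<close>, \<open>sum_solutions_by_orbit\<close>). For
  \<open>l = r k\<close> this contribution to the logarithm is \<open>r\<close> times a term in \<open>s\<^sup>r\<^sup>k/(r k)\<close>, hence a term in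
  \<open>(s\<^sup>r)\<^sup>k/k\<close>: exactly that of the tensor product of the series \<open>C\<^sub>f\<close> over the field with \<open>q\<^sup>r\<close> elements,
  in the variable \<open>s\<^sup>r\<close> (\<open>zeta_exp_compose\<close>). The scalars \<open>b\<^sub>j ^ (e\<^sub>j)\<close> for \<open>l = r k\<close> are the \<open>k\<close>-th powers
  of those for \<open>l = r\<close>, so they go into the variable as well. There are finitely many orbits of solutions
  because the determinant of the \<open>v\<^sub>j\<close> is not zero.
\<close>

section \<open>Teichmueller representatives and traces of roots of unity\<close>

text \<open>
  The derivative \<open>n x\<^sup>n\<^sup>-\<^sup>1\<close> of \<open>x\<^sup>n - 1\<close> has no root in common with it, so the \<open>n\<close> linear factors that
  algebraic closedness provides are distinct.
\<close>

lemma card_roots_of_unity_alg_closed: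
  assumes "of_nat n \<noteq> (0 :: 'a::alg_closed_field)"
  shows "card {x :: 'a. x ^ n = 1} = n"
proof -
  let ?P = "Polynomial.monom 1 n - 1 :: 'a poly"
  have n: "n > 0" using assms by (cases n) auto
  have deg: "degree ?P = n"
    using n degree_add_eq_left[of "-1" "Polynomial.monom 1 n :: 'a poly"] by (simp add: degree_monom_eq)
  then have nz: "?P \<noteq> 0" using n by auto
  obtain A where A: "size A = n" "?P = Polynomial.smult (lead_coeff ?P) (\<Prod>x\<in>#A. [:-x, 1:])"
    using alg_closed_imp_factorization[OF nz] deg by auto
  have root: "poly ?P x = 0 \<longleftrightarrow> x ^ n = 1" for x
    by (simp add: poly_monom)
  have mem: "x \<in># A \<longleftrightarrow> x ^ n = 1" for x
  proof -
    have "poly ?P x = lead_coeff ?P * (\<Prod>y\<in>#A. x - y)"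
      by (subst A(2)) (simp add: poly_prod_mset)
    moreover have "(\<Prod>y\<in>#A. x - y) = 0 \<longleftrightarrow> x \<in># A" by auto
    moreover have "lead_coeff ?P \<noteq> 0" using nz by (simp only: leading_coeff_0_iff) simp
    ultimately show ?thesis unfolding root[symmetric] by (metis mult_eq_0_iff)
  qed
  have "count A x \<le> 1" for x
  proof (rule ccontr)
    assume "\<not> count A x \<le> 1"
    then have x: "x \<in># A" "count A x = Suc (count (A - {#x#}) x)" "count (A - {#x#}) x > 0"
      by (auto simp: not_le simp flip: count_greater_zero_iff)
    then have "x \<in># A - {#x#}" by (simp only: count_greater_zero_iff)
    with x(1) obtain B where B: "A = add_mset x (add_mset x B)"
      by (metis insert_DiffM)
    define Q where "Q = Polynomial.smult (lead_coeff ?P) (\<Prod>y\<in>#B. [:-y, 1:])"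
    have "?P = [:-x, 1:] * ([:-x, 1:] * Q)"
      by (subst A(2)) (simp add: B Q_def mult_ac del: mult_pCons_left mult_pCons_right)
    then have "poly (pderiv ?P) x = 0"
      by (simp only: pderiv_mult) simp
    then have "of_nat n * x ^ (n - 1) = 0"
      by (simp add: pderiv_diff pderiv_monom poly_monom)
    then have "x = 0" using assms by simp
    moreover have "x ^ n = 1" using mem[of x] by (simp add: B)
    ultimately show False using n by (simp add: power_0_left)
  qed
  then have "A = mset_set (set_mset A)"
    by (intro multiset_eqI)
      (metis One_nat_def count_eq_zero_iff count_mset_set(1,3) finite_set_mset le_Suc_eq le_zero_eq)
  then have "card (set_mset A) = n" using A(1) by (metis size_mset_set)
  moreover have "set_mset A = {x. x ^ n = 1}" using mem by auto
  ultimately show ?thesis by simp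
qed

definition teichmueller :: "'a::comm_ring_prime_char \<Rightarrow> 'a witt" where
  "teichmueller c = Witt (\<lambda>n. if n = 0 then c else 0)"

lemma witt_coeff_teichmueller: "witt_coeff (teichmueller c) n = (if n = 0 then c else 0)"
  by (simp add: teichmueller_def Witt_inverse)

lemma teichmueller_1: "teichmueller 1 = 1"
  by (rule witt_eqI) (simp add: witt_coeff_teichmueller one_witt.rep_eq witt_one_def)

text \<open>
  Over the universal ring \<open>\<int>[X, Y]\<close> the ghost components of \<open>(X, 0, 0, \<dots>)\<close> are the powers
  \<open>X ^ (p ^ n)\<close>, which are multiplicative in \<open>X\<close>; there ghost components determine a Witt vector,
  and the identity specializes to \<open>X = c\<close>, \<open>Y = d\<close>.
\<close>

lemma teichmueller_mult:
  "teichmueller (c * d) = teichmueller c * teichmueller (d :: 'a::comm_ring_prime_char)"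
proof (rule witt_eqI)
  fix n
  let ?p = "CHAR('a)"
  have p: "prime ?p" by simp
  have ghost: "ghost ?p n (\<lambda>i. if i = 0 then X else 0) = X ^ (?p ^ n)" for X :: "nat ipoly" and n
  proof -
    have "ghost ?p n (\<lambda>i. if i = 0 then X else 0) = (\<Sum>i\<le>n. if i = 0 then X ^ (?p ^ n) else 0)"
      unfolding ghost_def by (intro sum.cong) (auto simp: power_0_left)
    then show ?thesis by simp
  qed
  define h :: "nat ipoly \<Rightarrow> 'a" where "h = ipoly_eval (\<lambda>i. if i = 0 then c else d)"
  have h: "is_ring_hom h" unfolding h_def by (rule is_ring_hom_eval)
  have h0: "h 0 = 0" by (simp add: h_def)
  let ?X = "ipoly_var 0 :: nat ipoly" and ?Y = "ipoly_var 1 :: nat ipoly"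
  let ?e = "\<lambda>X i. if i = (0::nat) then X else (0 :: nat ipoly)"
  have "witt_mult ?p (?e ?X) (?e ?Y) = ?e (?X * ?Y)"
    by (rule ghost_unique[of ?p]) (simp_all add: ghost_witt_mult[OF p] ghost power_mult_distrib prime_gt_0_nat)
  from arg_cong[OF this, of "\<lambda>s. h (s n)"]
  have "witt_mult ?p (\<lambda>i. h (?e ?X i)) (\<lambda>i. h (?e ?Y i)) n = h (?e (?X * ?Y) n)"
    by (simp only: hom_witt_mult[OF h])
  moreover have "(\<lambda>i. h (?e X i)) = (\<lambda>i. if i = 0 then h X else 0)" for X by (auto simp: h0)
  moreover have "h ?X = c" "h ?Y = d" "h (?X * ?Y) = c * d" by (simp_all add: h_def)
  ultimately have "witt_mult ?p (\<lambda>i. if i = 0 then c else 0) (\<lambda>i. if i = 0 then d else 0) n =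
      (if n = 0 then c * d else 0)"
    by (simp only: h0 if_distrib[of h])
  then show "witt_coeff (teichmueller (c * d)) n = witt_coeff (teichmueller c * teichmueller d) n"
    by (simp add: times_witt.rep_eq teichmueller_def Witt_inverse)
qed

lemma teichmueller_power: "teichmueller (c ^ k) = teichmueller c ^ k"
  by (induction k) (simp_all add: teichmueller_1 teichmueller_mult)

lemma frob_pow_teichmueller:
  "(frob_witt ^^ i) (teichmueller c) = teichmueller (c :: 'a::comm_ring_prime_char) ^ (CHAR('a) ^ i)"
  unfolding teichmueller_power[symmetric]
  by (rule witt_eqI) (simp add: frob_pow_coeff witt_coeff_teichmueller power_0_left)

lemma of_witt_add: "of_witt (v + w) = of_witt v + of_witt w"
  by (simp add: of_witt_def)

lemma of_witt_0: "of_witt 0 = 0"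
  by (simp add: of_witt_def Zero_fract_def)

lemma of_witt_1: "of_witt 1 = 1"
  by (simp add: of_witt_def One_fract_def)

lemma of_witt_power: "of_witt (w ^ k) = of_witt w ^ k"
  by (induction k) (simp_all add: of_witt_1 of_witt_mult)

lemma of_witt_sum: "of_witt (\<Sum>i\<in>I. w i) = (\<Sum>i\<in>I. of_witt (w i))"
  by (induction I rule: infinite_finite_induct) (simp_all add: of_witt_0 of_witt_add)

lemma frob_pow_sum: "(frob_witt ^^ r) (\<Sum>i\<in>I. f i) = (\<Sum>i\<in>I. (frob_witt ^^ r) (f i))"
  by (induction r) (simp_all add: frob_witt_sum)

lemma char_power_gt_1:
  assumes "r > 0"
  shows "CHAR('k::field_prime_char) ^ r > 1"
  using assms prime_gt_1_nat[of "CHAR('k)"] by (intro one_less_power) auto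

text \<open>
  The representatives of the \<open>(p\<^sup>r - 1)\<close>-th roots of unity of \<open>'k\<close> are already \<open>p\<^sup>r - 1\<close> many, and a
  field has no more roots of \<open>x ^ (p\<^sup>r - 1) = 1\<close> than that. So they exhaust \<open>\<mu>\<close>, and its cardinality
  comes for free.
\<close>

lemma
  assumes r: "r > 0"
  shows mu_eq_teichmueller: "(mu r :: 'k::{alg_closed_field, field_prime_char} witt fract set) =
      (of_witt \<circ> teichmueller) ` {c. c ^ (CHAR('k) ^ r - 1) = 1}"
    and card_mu: "card (mu r :: 'k witt fract set) = CHAR('k) ^ r - 1"
    and finite_mu: "finite (mu r :: 'k witt fract set)"
proof -
  let ?N = "CHAR('k) ^ r - 1"
  let ?R = "{c :: 'k. c ^ ?N = 1}"
  let ?T = "(of_witt \<circ> teichmueller) ` ?R"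
  let ?Z = "{x :: 'k witt fract. x ^ ?N = 1}"
  have N: "?N > 0" using char_power_gt_1[OF r, where ?'k = 'k] by simp
  have "Suc ?N = CHAR('k) ^ r" using N by simp
  moreover have "\<not> CHAR('k) dvd ?N"
  proof
    assume "CHAR('k) dvd ?N"
    moreover have "CHAR('k) dvd ?N + 1"
      using r unfolding Suc_eq_plus1[symmetric] \<open>Suc ?N = CHAR('k) ^ r\<close> by simp
    ultimately have "CHAR('k) dvd 1" using dvd_add_right_iff by blast
    then show False using prime_gt_1_nat[of "CHAR('k)"] by simp
  qed
  ultimately have card: "card ?R = ?N"
    by (intro card_roots_of_unity_alg_closed) (simp only: of_nat_eq_0_iff_char_dvd, simp)
  have inj: "inj_on (of_witt \<circ> teichmueller) ?R"
    by (auto simp: inj_on_def) (metis witt_coeff_teichmueller)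
  have cT: "card ?T = ?N" using card_image[OF inj] card by simp
  let ?P = "Polynomial.monom 1 ?N - 1 :: 'k witt fract poly"
  have deg: "degree ?P = ?N"
    using N degree_add_eq_left[of "-1" "Polynomial.monom 1 ?N :: 'k witt fract poly"] by (simp add: degree_monom_eq)
  then have "?P \<noteq> 0" using N by auto
  then have "finite {x. poly ?P x = 0}" "card {x. poly ?P x = 0} \<le> degree ?P"
    by (rule poly_roots_finite, rule card_poly_roots_bound)
  moreover have "{x. poly ?P x = 0} = ?Z" by (simp add: poly_monom)
  ultimately have Zsub: "finite ?Z" "card ?Z \<le> ?N" unfolding deg by simp_all
  have "?T \<subseteq> mu r"
  proof safe
    fix c :: 'k assume c: "c ^ ?N = 1"
    have "c ^ (CHAR('k) ^ r) = c"
      using c power_Suc[of c ?N] \<open>Suc ?N = CHAR('k) ^ r\<close> by simp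
    then have "(of_witt (teichmueller c) :: 'k witt fract) \<in> unram_ints r"
      by (auto simp: unram_ints_def witt_coeff_teichmueller finite_subfield_def power_0_left)
    moreover have "of_witt (teichmueller c) ^ ?N = 1"
      by (simp only: of_witt_power[symmetric] teichmueller_power[symmetric] c teichmueller_1 of_witt_1)
    ultimately show "(of_witt \<circ> teichmueller) c \<in> mu r" by (simp add: mu_def)
  qed
  moreover have "mu r \<subseteq> ?Z" by (auto simp: mu_def)
  moreover have "?T = ?Z"
    using calculation cT Zsub by (intro card_seteq) auto
  ultimately show *: "mu r = ?T" by auto
  show "card (mu r :: 'k witt fract set) = ?N" using * cT by simp
  show "finite (mu r :: 'k witt fract set)" using * \<open>?T = ?Z\<close> Zsub by simp
qed

text \<open>
  Frobenius raises a Teichmueller representative to its \<open>p\<close>-th power. The values of a Laurent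
  polynomial with coefficients in \<open>\<mu>\<close> at points of \<open>\<mu>\<^sup>n\<close> are sums of elements of \<open>\<mu>\<close>, so this
  formula computes all the traces that occur in exponential sums and makes their additivity and
  Frobenius invariance visible.
\<close>

lemma unram_trace_sum_mu:
  fixes t :: "'i \<Rightarrow> 'k::{alg_closed_field, field_prime_char} witt fract"
  assumes r: "r > 0" and t: "\<And>u. u \<in> U \<Longrightarrow> t u \<in> mu r"
  shows "unram_trace r (\<Sum>u\<in>U. t u) = (\<Sum>u\<in>U. \<Sum>i<r. t u ^ (CHAR('k) ^ i))"
proof -
  have "\<forall>u\<in>U. \<exists>c. t u = of_witt (teichmueller c)"
    using t mu_eq_teichmueller[OF r, where ?'k = 'k] by auto
  then obtain c where c: "\<And>u. u \<in> U \<Longrightarrow> t u = of_witt (teichmueller (c u))" by metis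
  have t': "(\<Sum>u\<in>U. t u ^ k) = (\<Sum>u\<in>U. of_witt (teichmueller (c u)) ^ k)" for k
    by (intro sum.cong) (simp_all add: c)
  have "unram_trace r (\<Sum>u\<in>U. t u) = unram_trace r (of_witt (\<Sum>u\<in>U. teichmueller (c u)))"
    by (simp add: of_witt_sum c)
  also have "\<dots> = of_witt (\<Sum>i<r. (frob_witt ^^ i) (\<Sum>u\<in>U. teichmueller (c u)))"
    by (rule unram_trace_of_witt)
  also have "\<dots> = (\<Sum>i<r. \<Sum>u\<in>U. t u ^ (CHAR('k) ^ i))"
    by (simp only: frob_pow_sum frob_pow_teichmueller of_witt_sum of_witt_power t')
  finally show ?thesis by (simp add: sum.swap[of _ U])
qed

lemma power_minus_one_dvd: "(x::nat) ^ a - 1 dvd x ^ (a * l) - 1"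
proof (cases "x = 0")
  case False
  then have x: "x ^ a \<ge> 1" "x ^ (a * l) \<ge> 1" by simp_all
  have "int x ^ a - 1 dvd (int x ^ a) ^ l - 1 ^ l"
    using power_diff_sumr2[of "int x ^ a" l 1] by simp
  then have "int (x ^ a - 1) dvd int (x ^ (a * l) - 1)"
    using x by (simp add: of_nat_diff power_mult)
  then show ?thesis by (simp only: int_dvd_int_iff)
qed (auto simp: power_0_left)

lemma mu_mono:
  assumes "a > 0" "l > 0"
  shows "mu a \<subseteq> (mu (a * l) :: 'k::{alg_closed_field, field_prime_char} witt fract set)"
proof -
  obtain k where k: "CHAR('k) ^ (a * l) - 1 = (CHAR('k) ^ a - 1) * k"
    using power_minus_one_dvd[of "CHAR('k)" a l] by (elim dvdE)
  show ?thesis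
    using assms by (auto simp: mu_eq_teichmueller k power_mult[of _ _ k] simp del: One_nat_def)
qed

lemma mu_1: "1 \<in> mu r"
  by (simp add: mu_def unram_ints_1)

lemma mu_power: "x \<in> mu r \<Longrightarrow> x ^ k \<in> mu r"
  by (induction k) (simp_all add: mu_1 mu_mult)

lemma mu_prod: "(\<And>i. i \<in> I \<Longrightarrow> x i \<in> mu r) \<Longrightarrow> (\<Prod>i\<in>I. x i) \<in> mu r"
  by (induction I rule: infinite_finite_induct) (simp_all add: mu_1 mu_mult)

lemma mu_powi: "r > 0 \<Longrightarrow> x \<in> mu r \<Longrightarrow> x powi k \<in> mu r"
  by (auto simp: power_int_def mu_power mu_inverse)

lemma monomial_at_in_mu: "r > 0 \<Longrightarrow> (\<And>i. x $ i \<in> mu r) \<Longrightarrow> monomial_at x u \<in> mu r"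
  unfolding monomial_at_def by (intro mu_prod mu_powi)

lemma mu_power_order: "x \<in> mu r \<Longrightarrow> x ^ (CHAR('k) ^ r - 1) = 1"
  for x :: "'k::field_prime_char witt fract"
  by (simp add: mu_def)

lemma mu_powi_eq_1:
  fixes x :: "'k::field_prime_char witt fract"
  assumes "x \<in> mu r" "int (CHAR('k) ^ r - 1) dvd k"
  shows "x powi k = 1"
proof -
  obtain c where "k = int (CHAR('k) ^ r - 1) * c" using assms(2) by (elim dvdE)
  then have "x powi k = (x ^ (CHAR('k) ^ r - 1)) powi c"
    by (simp only: power_int_mult power_int_of_nat)
  then show ?thesis by (simp only: mu_power_order[OF assms(1)] power_int_1_left)
qed

section \<open>Characters of \<open>\<mu>\<^sup>n\<close> and Fourier inversion\<close>

context
  fixes r N :: nat and M :: "'k::{alg_closed_field, field_prime_char} witt fract set"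
  assumes r: "r > 0"
  defines "N \<equiv> CHAR('k) ^ r - 1" and "M \<equiv> mu r"
begin

lemma mu_order_pos: "N > 0"
  using char_power_gt_1[OF r, where ?'k = 'k] by (simp add: N_def)

lemma sum_exponents_powi:
  assumes x: "x \<in> M"
  shows "(\<Sum>k\<in>{0..<int N}. x powi k) = (if x = 1 then of_nat N else 0)"
proof -
  have "(\<Sum>k\<in>{0..<int N}. x powi k) = (\<Sum>k<N. x ^ k)"
    by (rule sum.reindex_bij_witness[of _ int nat]) (auto simp: power_int_def)
  then show ?thesis
    using geometric_sum[of x N] mu_power_order[OF x[unfolded M_def], folded N_def] by auto
qed

text \<open>
  Since \<open>\<mu>\<close> has \<open>N\<close> elements and \<open>y\<^sup>e = 1\<close> has at most \<open>e\<close> solutions, some \<open>y \<in> \<mu>\<close> satisfies \<open>y\<^sup>e \<noteq> 1\<close>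
  whenever \<open>0 < e < N\<close>, and substituting \<open>y x\<close> for \<open>x\<close> shows that the sum vanishes.
\<close>

lemma sum_mu_powi: "(\<Sum>x\<in>M. x powi c) = (if int N dvd c then of_nat N else 0)"
proof (cases "int N dvd c")
  case True
  have "x powi c = 1" if "x \<in> M" for x
    using mu_powi_eq_1[of x r c] that True by (simp only: M_def N_def)
  then show ?thesis using True card_mu[OF r, where ?'k = 'k] by (simp add: M_def N_def)
next
  case False
  define e where "e = nat (c mod int N)"
  have e: "int e = c mod int N" "0 < e" "e < N"
    using mu_order_pos False unfolding e_def
    by (auto simp: dvd_eq_mod_eq_0 nat_less_iff order.not_eq_order_implies_strict)
  have powi: "x powi c = x ^ e" if x: "x \<in> M" for x
  proof -
    have "x powi c = x powi (int N * (c div int N)) * x powi (int e)"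
      using mu_inverse(2)[OF r x[unfolded M_def]] by (simp add: e power_int_add[symmetric])
    moreover have "x powi (int N * (c div int N)) = 1"
      using x unfolding M_def N_def by (rule mu_powi_eq_1) simp
    ultimately show ?thesis by simp
  qed
  let ?P = "Polynomial.monom 1 e - 1 :: 'k witt fract poly"
  have deg: "degree ?P = e"
    using e degree_add_eq_left[of "-1" "Polynomial.monom 1 e :: 'k witt fract poly"] by (simp add: degree_monom_eq)
  then have "?P \<noteq> 0" using e by auto
  then have fin: "finite {x. poly ?P x = 0}" and "card {x. poly ?P x = 0} \<le> degree ?P"
    by (rule poly_roots_finite, rule card_poly_roots_bound)
  then have "card {x. poly ?P x = 0} < card M" using e card_mu[OF r, where ?'k = 'k] by (simp only: deg M_def N_def)
  then have "\<not> M \<subseteq> {x. poly ?P x = 0}" using card_mono[OF fin] by (auto simp: not_less[symmetric])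
  then obtain y where y: "y \<in> M" "y ^ e \<noteq> 1" by (auto simp: poly_monom)
  have y': "y \<noteq> 0" "inverse y \<in> M" using mu_inverse[OF r, of y] y(1) unfolding M_def by auto
  have "(\<Sum>x\<in>M. x powi c) = (\<Sum>x\<in>M. (y * x) powi c)"
    by (rule sum.reindex_bij_witness[of _ "\<lambda>x. y * x" "\<lambda>x. inverse y * x"])
      (use y(1) y' in \<open>auto simp: M_def mu_mult simp flip: mult.assoc\<close>)
  also have "\<dots> = y ^ e * (\<Sum>x\<in>M. x powi c)"
    by (simp add: power_int_mult_distrib powi[OF y(1)] sum_distrib_left)
  finally show ?thesis using y(2) False by simp
qed

end

lemma bij_betw_vec_lambda:
  "bij_betw vec_lambda (PiE UNIV (\<lambda>_. B)) {x. \<forall>i::'i::finite. x $ i \<in> B}"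
  by (rule bij_betw_byWitness[of _ vec_nth]) auto

lemma finite_vecs: "finite B \<Longrightarrow> finite {x. \<forall>i::'i::finite. x $ i \<in> B}"
  using bij_betw_finite[OF bij_betw_vec_lambda[of B, where ?'i = 'i]]
    finite_PiE[of "UNIV :: 'i set" "\<lambda>_. B"] by simp

lemma prod_sum_vecs:
  fixes f :: "'i::finite \<Rightarrow> 'b \<Rightarrow> 'c::comm_semiring_1"
  assumes "finite B"
  shows "(\<Prod>i\<in>UNIV. \<Sum>y\<in>B. f i y) = (\<Sum>x | \<forall>i. x $ i \<in> B. \<Prod>i\<in>UNIV. f i (x $ i))"
proof -
  have "(\<Prod>i\<in>UNIV. \<Sum>y\<in>B. f i y) = (\<Sum>g\<in>PiE UNIV (\<lambda>_. B). \<Prod>i\<in>UNIV. f i (g i))"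
    using assms by (intro prod_sum_PiE) auto
  also have "\<dots> = (\<Sum>x | \<forall>i. x $ i \<in> B. \<Prod>i\<in>UNIV. f i (x $ i))"
    using sum.reindex_bij_betw[OF bij_betw_vec_lambda[of B], of "\<lambda>x. \<Prod>i\<in>UNIV. f i (x $ i)"] by simp
  finally show ?thesis .
qed

text \<open>
  Up to the factor \<open>N\<^sup>n\<close>, the coefficient of \<open>F\<close> at the character \<open>x \<mapsto> x\<^sup>e\<close>. The exponential sum \<open>S\<^sub>h\<close> is the transform of
  \<open>x \<mapsto> \<psi>(h(x))\<close>, but the argument below applies to an arbitrary function.
\<close>

definition fourier ::
  "nat \<Rightarrow> ('k::field_prime_char witt fract ^ 'n::finite \<Rightarrow> 'k witt fract fps) \<Rightarrow> int ^ 'n \<Rightarrow> 'k witt fract fps" where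
  "fourier s F e = (\<Sum>x | \<forall>i. x $ i \<in> mu s. fps_const (monomial_at x (- e)) * F x)"

lemma monomial_at_add:
  "(\<And>i. x $ i \<noteq> 0) \<Longrightarrow> monomial_at x (u + w) = monomial_at x u * monomial_at x w"
  by (simp add: monomial_at_def power_int_add prod.distrib)

lemma monomial_at_0 [simp]: "monomial_at x 0 = 1"
  by (simp add: monomial_at_def)

lemma fps_const_sum: "fps_const (\<Sum>i\<in>I. c i) = (\<Sum>i\<in>I. fps_const (c i))"
  by (rule fps_ext) (simp add: fps_sum_nth)

lemma fps_const_prod: "fps_const (\<Prod>i\<in>I. c i) = (\<Prod>i\<in>I. fps_const (c i))"
  by (induction I rule: infinite_finite_induct) (simp_all flip: fps_const_mult)

lemma power_int_prod: "(\<Prod>i\<in>I. x i :: 'a::field) powi k = (\<Prod>i\<in>I. x i powi k)"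
  by (induction I rule: infinite_finite_induct) (simp_all add: power_int_mult_distrib)

text \<open>The substitution \<open>x\<^sub>i = \<Prod>\<^sub>k z\<^sub>i\<^sub>k ^ w\<^sub>k\<close>, under which \<open>x\<^sup>e\<close> becomes \<open>z ^ (e \<otimes> w)\<close>.\<close>

definition monomial_map :: "int ^ 'm::finite \<Rightarrow> 'a::field ^ ('n::finite \<times> 'm) \<Rightarrow> 'a ^ 'n" where
  "monomial_map w z = (\<chi> i. \<Prod>k\<in>UNIV. z $ (i, k) powi (w $ k))"

lemma monomial_at_monomial_map: "monomial_at (monomial_map w z) e = monomial_at z (tensor_vec e w)"
proof -
  have "monomial_at (monomial_map w z) e = (\<Prod>i\<in>UNIV. \<Prod>k\<in>UNIV. z $ (i, k) powi (e $ i * w $ k))"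
    by (simp add: monomial_at_def monomial_map_def power_int_prod power_int_mult[symmetric] mult.commute)
  also have "\<dots> = (\<Prod>(i, k)\<in>UNIV. z $ (i, k) powi (e $ i * w $ k))"
    by (simp add: prod.cartesian_product)
  finally show ?thesis by (simp add: monomial_at_def tensor_vec_def case_prod_beta)
qed

context
  fixes r N :: nat and M :: "'k::{alg_closed_field, field_prime_char} witt fract set"
  assumes r: "r > 0"
  defines "N \<equiv> CHAR('k) ^ r - 1" and "M \<equiv> mu r"
begin

lemma sum_box_monomial_at:
  fixes x :: "'k witt fract ^ 'n::finite"
  assumes x: "\<forall>i. x $ i \<in> M"
  shows "(\<Sum>e | \<forall>i. e $ i \<in> {0..<int N}. monomial_at x e) = (if x = 1 then of_nat N ^ CARD('n) else 0)"
proof -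
  have "(\<Sum>e | \<forall>i. e $ i \<in> {0..<int N}. monomial_at x e) = (\<Prod>i\<in>UNIV. \<Sum>k\<in>{0..<int N}. x $ i powi k)"
    unfolding monomial_at_def by (rule prod_sum_vecs[symmetric]) simp
  also have "\<dots> = (\<Prod>i\<in>(UNIV :: 'n set). if x $ i = 1 then of_nat N else 0)"
    using x unfolding M_def N_def by (intro prod.cong refl sum_exponents_powi[OF r]) auto
  also have "\<dots> = (if x = 1 then of_nat N ^ CARD('n) else 0)"
    by (auto simp: vec_eq_iff)
  finally show ?thesis .
qed

lemma sum_mu_monomial_at:
  fixes c :: "int ^ 'n::finite"
  shows "(\<Sum>x | \<forall>i. x $ i \<in> M. monomial_at x c) =
    (if \<forall>i. int N dvd c $ i then of_nat N ^ CARD('n) else 0)"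
proof -
  have "(\<Sum>x | \<forall>i. x $ i \<in> M. monomial_at x c) = (\<Prod>i\<in>UNIV. \<Sum>y\<in>M. y powi (c $ i))"
    unfolding monomial_at_def M_def using finite_mu[OF r] by (rule prod_sum_vecs[symmetric])
  also have "\<dots> = (\<Prod>i\<in>(UNIV :: 'n set). if int N dvd c $ i then of_nat N else 0)"
    unfolding M_def N_def by (intro prod.cong refl sum_mu_powi[OF r])
  also have "\<dots> = (if \<forall>i. int N dvd c $ i then of_nat N ^ CARD('n) else 0)"
    by auto
  finally show ?thesis .
qed

text \<open>
  Exchanging the sums leaves the kernel \<open>\<Sum>\<^sub>e (y/x)\<^sup>e\<close>, which is \<open>N\<^sup>n\<close> for \<open>x = y\<close> and vanishes otherwise.
\<close>

lemma fourier_inversion: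
  fixes F :: "'k witt fract ^ 'n::finite \<Rightarrow> 'k witt fract fps"
  assumes y: "\<forall>i. y $ i \<in> M"
  shows "(\<Sum>e | \<forall>i. e $ i \<in> {0..<int N}. fps_const (monomial_at y e) * fourier r F e) =
    fps_const (of_nat N ^ CARD('n)) * F y"
proof -
  let ?A = "{x :: 'k witt fract ^ 'n. \<forall>i. x $ i \<in> M}"
  let ?B = "{e :: int ^ 'n. \<forall>i. e $ i \<in> {0..<int N}}"
  have fin: "finite ?A" unfolding M_def by (intro finite_vecs finite_mu[OF r])
  let ?q = "\<lambda>x. (\<chi> i. y $ i * inverse (x $ i)) :: 'k witt fract ^ 'n"
  have M0: "x \<noteq> 0" if "x \<in> M" for x using that mu_inverse(2)[OF r] by (simp add: M_def)
  have quot: "monomial_at y e * monomial_at x (- e) = monomial_at (?q x) e" for x e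
    by (simp add: monomial_at_def power_int_mult_distrib prod.distrib power_int_inverse power_int_minus)
  have one: "?q x = 1 \<longleftrightarrow> x = y" if "x \<in> ?A" for x
    using that y M0 by (auto simp: vec_eq_iff field_simps)
  have "(\<Sum>e\<in>?B. fps_const (monomial_at y e) * fourier r F e) =
      (\<Sum>x\<in>?A. fps_const (\<Sum>e\<in>?B. monomial_at (?q x) e) * F x)"
    unfolding fourier_def M_def[symmetric] sum_distrib_left
    by (subst sum.swap) (simp add: quot fps_const_sum sum_distrib_right flip: mult.assoc)
  also have "\<dots> = (\<Sum>x\<in>?A. if x = y then fps_const (of_nat N ^ CARD('n)) * F x else 0)"
  proof (intro sum.cong refl)
    fix x assume x: "x \<in> ?A"
    have "\<forall>i. ?q x $ i \<in> M"
      using x y unfolding M_def by (auto intro!: mu_mult mu_inverse(1)[OF r])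
    from sum_box_monomial_at[OF this]
    show "fps_const (\<Sum>e\<in>?B. monomial_at (?q x) e) * F x =
      (if x = y then fps_const (of_nat N ^ CARD('n)) * F x else 0)"
      by (simp add: one[OF x])
  qed
  also have "\<dots> = fps_const (of_nat N ^ CARD('n)) * F y"
    using fin y by simp
  finally show ?thesis .
qed

text \<open>
  Expand each factor \<open>F\<^sub>j\<close> in characters of \<open>\<mu>\<^sup>n\<close>. A choice \<open>(e\<^sub>j)\<close> of one character per factor pulls back
  to the character of exponent \<open>\<Sum>\<^sub>j e\<^sub>j \<otimes> w\<^sub>j\<close> on \<open>\<mu>\<^sup>n\<^sup>m\<close>, and orthogonality keeps those choices for which
  this exponent is \<open>D\<close> modulo \<open>N\<close>. The powers of \<open>N\<close> cancel because there are as many factors \<open>F\<^sub>j\<close>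
  as vectors \<open>w\<^sub>j\<close> have entries.
\<close>

lemma fourier_monomial_maps:
  fixes F :: "'m::finite \<Rightarrow> 'k witt fract ^ 'n::finite \<Rightarrow> 'k witt fract fps"
    and w :: "'m \<Rightarrow> int ^ 'm" and D :: "int ^ ('n \<times> 'm)"
  shows "fourier r (\<lambda>z. \<Prod>j\<in>UNIV. F j (monomial_map (w j) z)) D =
    (\<Sum>e | (\<forall>j i. e $ j $ i \<in> {0..<int N}) \<and> (\<forall>ik. int N dvd (\<Sum>j\<in>UNIV. tensor_vec (e $ j) (w j)) $ ik - D $ ik).
      \<Prod>j\<in>UNIV. fourier r (F j) (e $ j))"
proof -
  let ?A = "{z :: 'k witt fract ^ ('n \<times> 'm). \<forall>ik. z $ ik \<in> M}"
  let ?B = "{e :: int ^ 'n. \<forall>i. e $ i \<in> {0..<int N}}"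
  let ?BB = "{e :: int ^ 'n ^ 'm. \<forall>j. e $ j \<in> ?B}"
  let ?c = "fps_const (of_nat N ^ CARD('n \<times> 'm)) :: 'k witt fract fps"
  let ?t = "\<lambda>e. (\<Sum>j\<in>UNIV. tensor_vec (e $ j) (w j)) :: int ^ ('n \<times> 'm)"
  let ?G = "\<lambda>e. \<Prod>j\<in>UNIV. fourier r (F j) (e $ j)"
  let ?ok = "\<lambda>e. \<forall>ik. int N dvd ?t e $ ik - D $ ik"
  have "N > 0" using mu_order_pos[OF r, where ?'k = 'k] by (simp only: N_def)
  then have N0: "?c \<noteq> 0" by simp
  have finB: "finite ?B" by (intro finite_vecs) simp
  then have finBB: "finite ?BB" by (rule finite_vecs)
  have c: "?c = fps_const (of_nat N ^ CARD('n)) ^ CARD('m)"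
    by (simp add: power_mult)
  have prod: "?c * (\<Prod>j\<in>UNIV. F j (monomial_map (w j) z)) =
      (\<Sum>e\<in>?BB. fps_const (monomial_at z (?t e)) * ?G e)" if z: "z \<in> ?A" for z
  proof -
    have z0: "z $ ik \<noteq> 0" for ik
      using z mu_inverse(2)[OF r, of "z $ ik"] by (cases ik) (auto simp: M_def)
    have t: "(\<Prod>j\<in>J. monomial_at z (tensor_vec (e $ j) (w j))) =
        monomial_at z (\<Sum>j\<in>J. tensor_vec (e $ j) (w j))" for e :: "int ^ 'n ^ 'm" and J
      by (induction J rule: infinite_finite_induct) (simp_all add: monomial_at_add[OF z0])
    have m: "\<forall>i. monomial_map (w j) z $ i \<in> M" for j
      using z unfolding M_def by (auto simp: monomial_map_def intro!: mu_prod mu_powi[OF r])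
    have "?c * (\<Prod>j\<in>UNIV. F j (monomial_map (w j) z)) =
        (\<Prod>j\<in>UNIV. \<Sum>e\<in>?B. fps_const (monomial_at (monomial_map (w j) z) e) * fourier r (F j) e)"
      unfolding c by (simp only: fourier_inversion[OF m] prod.distrib prod_constant)
    also have "\<dots> = (\<Sum>e\<in>?BB. \<Prod>j\<in>UNIV. fps_const (monomial_at (monomial_map (w j) z) (e $ j)) * fourier r (F j) (e $ j))"
      using finB by (rule prod_sum_vecs)
    also have "\<dots> = (\<Sum>e\<in>?BB. fps_const (monomial_at z (?t e)) * ?G e)"
      by (simp only: prod.distrib monomial_at_monomial_map fps_const_prod[symmetric] t)
    finally show ?thesis .
  qed
  have "?c * fourier r (\<lambda>z. \<Prod>j\<in>UNIV. F j (monomial_map (w j) z)) D =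
      (\<Sum>z\<in>?A. fps_const (monomial_at z (- D)) * (?c * (\<Prod>j\<in>UNIV. F j (monomial_map (w j) z))))"
    unfolding fourier_def M_def sum_distrib_left by (intro sum.cong refl) (simp only: mult_ac)
  also have "\<dots> = (\<Sum>z\<in>?A. \<Sum>e\<in>?BB. fps_const (monomial_at z (?t e - D)) * ?G e)"
  proof (intro sum.cong refl)
    fix z assume z: "z \<in> ?A"
    have z0: "z $ ik \<noteq> 0" for ik
      using z mu_inverse(2)[OF r, of "z $ ik"] by (cases ik) (auto simp: M_def)
    have "monomial_at z (- D) * monomial_at z u = monomial_at z (u - D)" for u
      using monomial_at_add[OF z0, of u "- D"] by (simp add: mult.commute)
    then show "fps_const (monomial_at z (- D)) * (?c * (\<Prod>j\<in>UNIV. F j (monomial_map (w j) z))) =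
      (\<Sum>e\<in>?BB. fps_const (monomial_at z (?t e - D)) * ?G e)"
      by (simp only: prod[OF z] sum_distrib_left mult.assoc[symmetric] fps_const_mult)
  qed
  also have "\<dots> = (\<Sum>e\<in>?BB. fps_const (\<Sum>z\<in>?A. monomial_at z (?t e - D)) * ?G e)"
    by (subst sum.swap) (simp only: fps_const_sum sum_distrib_right)
  also have "\<dots> = (\<Sum>e\<in>?BB. if ?ok e then ?c * ?G e else 0)"
    by (intro sum.cong refl)
      (simp only: sum_mu_monomial_at vector_minus_component if_distrib[of fps_const] if_distribR
        fps_const_0_eq_0 mult_zero_left if_distrib[of "\<lambda>x. x * _"])
  also have "\<dots> = ?c * (\<Sum>e\<in>{e \<in> ?BB. ?ok e}. ?G e)"
    unfolding sum_distrib_left by (rule sum.inter_filter[OF finBB, symmetric])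
  finally have "fourier r (\<lambda>z. \<Prod>j\<in>UNIV. F j (monomial_map (w j) z)) D = (\<Sum>e\<in>{e \<in> ?BB. ?ok e}. ?G e)"
    using N0 by (simp only: mult_cancel_left) simp
  then show ?thesis by simp
qed

end

section \<open>Exponential sums of a diagonal base change\<close>

lemma exp_sum_eq_fourier:
  "exp_sum h e r = fourier r (\<lambda>x. fps_binomial (unram_trace r (laurent_eval h x))) e"
  by (simp add: exp_sum_def fourier_def)

lemma fps_binomial_sum: "fps_binomial (\<Sum>i\<in>I. c i) = (\<Prod>i\<in>I. fps_binomial (c i))"
  by (induction I rule: infinite_finite_induct) (simp_all add: fps_binomial_add_mult)

lemma laurent_eval_superset:
  assumes "finite S" "Poly_Mapping.keys h \<subseteq> S"
  shows "laurent_eval h x = (\<Sum>u\<in>S. Poly_Mapping.lookup h u * monomial_at x u)"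
  unfolding laurent_eval_def using assms
  by (intro sum.mono_neutral_left) (auto simp: not_in_keys_iff_lookup_eq_zero)

lemma laurent_eval_add: "laurent_eval (g + h) x = laurent_eval g x + laurent_eval h x"
proof -
  let ?S = "Poly_Mapping.keys g \<union> Poly_Mapping.keys h"
  have "Poly_Mapping.keys (g + h) \<subseteq> ?S" by (rule Poly_Mapping.keys_add)
  then show ?thesis
    by (simp add: laurent_eval_superset[of ?S] lookup_add algebra_simps sum.distrib)
qed

lemma laurent_eval_single: "laurent_eval (Poly_Mapping.single u c) x = c * monomial_at x u"
  by (cases "c = 0") (auto simp: laurent_eval_def)

lemma laurent_eval_0: "laurent_eval 0 x = 0"
  by (simp add: laurent_eval_def)

lemma laurent_eval_sum: "laurent_eval (\<Sum>i\<in>I. h i) x = (\<Sum>i\<in>I. laurent_eval (h i) x)"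
  by (induction I rule: infinite_finite_induct) (simp_all add: laurent_eval_0 laurent_eval_add)

text \<open>
  The monomials \<open>u \<otimes> v\<^sub>j\<close> need not be distinct (all of them coincide for \<open>u = 0\<close>), but evaluation is
  additive, so \<open>(f \<otimes> g)(z)\<close> is always the sum over \<open>j\<close> of the values of \<open>f(b\<^sub>j x)\<close> at the image of \<open>z\<close>.
\<close>

lemma laurent_eval_diag_base_change:
  fixes f :: "('a::field, 'n::finite) laurent" and v :: "'m::finite \<Rightarrow> int ^ 'm"
  assumes v: "inj v" and b: "\<And>j. b j \<noteq> 0"
  shows "laurent_eval (diag_base_change f (\<Sum>j\<in>UNIV. Poly_Mapping.single (v j) (b j))) z =
    (\<Sum>j\<in>UNIV. laurent_eval
      (\<Sum>u\<in>Poly_Mapping.keys f. Poly_Mapping.single u (Poly_Mapping.lookup f u * monomial_at (b j) u))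
      (monomial_map (v j) z))"
proof -
  let ?g = "\<Sum>j\<in>UNIV. Poly_Mapping.single (v j) (b j)"
  have lk: "Poly_Mapping.lookup ?g (v j) = b j" for j
    using v by (simp add: lookup_sum lookup_single when_def inj_eq)
  have "Poly_Mapping.keys ?g \<subseteq> range v"
    by (auto simp: in_keys_iff lookup_sum lookup_single when_def split: if_splits
        elim!: sum.not_neutral_contains_not_neutral)
  moreover have "v j \<in> Poly_Mapping.keys ?g" for j by (simp add: in_keys_iff lk b)
  ultimately have keys: "Poly_Mapping.keys ?g = range v" by auto
  have "laurent_eval (diag_base_change f ?g) z = (\<Sum>u\<in>Poly_Mapping.keys f. \<Sum>j\<in>UNIV.
      Poly_Mapping.lookup f u * monomial_at (b j) u * monomial_at z (tensor_vec u (v j)))"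
    by (simp add: diag_base_change_def laurent_eval_sum laurent_eval_single keys sum.reindex[OF v] lk)
  then show ?thesis
    by (subst (asm) sum.swap) (simp add: laurent_eval_sum laurent_eval_single monomial_at_monomial_map)
qed

context
  fixes r :: nat and f :: "('k::{alg_closed_field, field_prime_char} witt fract, 'n::finite) laurent"
  assumes r: "r > 0" and f: "\<forall>u\<in>Poly_Mapping.keys f. Poly_Mapping.lookup f u \<in> mu r"
begin

text \<open>
  The additive character turns the sum over \<open>j\<close> into a product of functions of the images of \<open>z\<close> under
  the monomial maps, and the transform of \<open>\<psi>(f(b\<^sub>j x))\<close> is that of \<open>\<psi>(f(x))\<close> times \<open>b\<^sub>j\<^sup>e\<close>.
\<close>

lemma exp_sum_diag_base_change:
  fixes v :: "'m::finite \<Rightarrow> int ^ 'm" and b :: "'m \<Rightarrow> 'k witt fract ^ 'n"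
  assumes v: "inj v" and b: "\<forall>j i. b j $ i \<in> mu r"
  shows "exp_sum (diag_base_change f (\<Sum>j\<in>UNIV. Poly_Mapping.single (v j) (b j))) D r =
    (\<Sum>e | (\<forall>j i. e $ j $ i \<in> {0..<int (CHAR('k) ^ r - 1)}) \<and>
          (\<forall>ik. int (CHAR('k) ^ r - 1) dvd (\<Sum>j\<in>UNIV. tensor_vec (e $ j) (v j)) $ ik - D $ ik).
      \<Prod>j\<in>UNIV. fps_const (monomial_at (b j) (e $ j)) * exp_sum f (e $ j) r)"
proof -
  let ?h = "\<lambda>j. \<Sum>u\<in>Poly_Mapping.keys f.
    Poly_Mapping.single u (Poly_Mapping.lookup f u * monomial_at (b j) u)"
  let ?F = "\<lambda>j x. fps_binomial (unram_trace r (laurent_eval (?h j) x))"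
  let ?g = "\<Sum>j\<in>UNIV. Poly_Mapping.single (v j) (b j)"
  have b0: "b j \<noteq> 0" for j
    using b mu_inverse(2)[OF r, of "b j $ undefined"] by auto
  have "exp_sum (diag_base_change f ?g) D r = fourier r (\<lambda>z. \<Prod>j\<in>UNIV. ?F j (monomial_map (v j) z)) D"
    unfolding exp_sum_eq_fourier fourier_def
  proof (intro sum.cong refl arg_cong2[where f = "(*)"])
    fix z :: "'k witt fract ^ ('n \<times> 'm)"
    assume z: "z \<in> {z. \<forall>ik. z $ ik \<in> mu r}"
    have x: "monomial_map (v j) z $ i \<in> mu r" for i j
      using z by (auto simp: monomial_map_def intro!: mu_prod mu_powi[OF r])
    let ?t = "\<lambda>j u. Poly_Mapping.lookup f u * monomial_at (b j) u * monomial_at (monomial_map (v j) z) u"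
    have t: "?t j u \<in> mu r" if "u \<in> Poly_Mapping.keys f" for j u
      using f b x that by (intro mu_mult monomial_at_in_mu[OF r]) auto
    have ev: "laurent_eval (?h j) (monomial_map (v j) z) = (\<Sum>u\<in>Poly_Mapping.keys f. ?t j u)" for j
      by (simp add: laurent_eval_sum laurent_eval_single)
    let ?K = "Poly_Mapping.keys f"
    have "unram_trace r (laurent_eval (diag_base_change f ?g) z) =
        unram_trace r (\<Sum>(j, u)\<in>UNIV \<times> ?K. ?t j u)"
      by (simp add: laurent_eval_diag_base_change[OF v b0] ev sum.cartesian_product)
    also have "\<dots> = (\<Sum>(j, u)\<in>UNIV \<times> ?K. \<Sum>i<r. ?t j u ^ (CHAR('k) ^ i))"
      using t by (subst unram_trace_sum_mu[OF r]) (auto simp: case_prod_beta)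
    also have "\<dots> = (\<Sum>j\<in>UNIV. \<Sum>u\<in>?K. \<Sum>i<r. ?t j u ^ (CHAR('k) ^ i))"
      by (rule sum.cartesian_product[symmetric])
    also have "\<dots> = (\<Sum>j\<in>UNIV. unram_trace r (laurent_eval (?h j) (monomial_map (v j) z)))"
      unfolding ev using t by (simp add: unram_trace_sum_mu[OF r])
    finally show "fps_binomial (unram_trace r (laurent_eval (diag_base_change f ?g) z)) =
      (\<Prod>j\<in>UNIV. ?F j (monomial_map (v j) z))"
      by (simp add: fps_binomial_sum)
  qed
  also have "\<dots> = (\<Sum>e | (\<forall>j i. e $ j $ i \<in> {0..<int (CHAR('k) ^ r - 1)}) \<and>
          (\<forall>ik. int (CHAR('k) ^ r - 1) dvd (\<Sum>j\<in>UNIV. tensor_vec (e $ j) (v j)) $ ik - D $ ik).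
      \<Prod>j\<in>UNIV. exp_sum (?h j) (e $ j) r)"
    unfolding exp_sum_eq_fourier by (rule fourier_monomial_maps[OF r, where F = ?F])
  also have "\<dots> = (\<Sum>e | (\<forall>j i. e $ j $ i \<in> {0..<int (CHAR('k) ^ r - 1)}) \<and>
          (\<forall>ik. int (CHAR('k) ^ r - 1) dvd (\<Sum>j\<in>UNIV. tensor_vec (e $ j) (v j)) $ ik - D $ ik).
      \<Prod>j\<in>UNIV. fps_const (monomial_at (b j) (e $ j)) * exp_sum f (e $ j) r)"
    using b by (intro sum.cong prod.cong refl exp_sum_scale[OF r]) auto
  finally show ?thesis .
qed

end

lemma monomial_at_cong_mod:
  fixes x :: "'k::{alg_closed_field, field_prime_char} witt fract ^ 'n::finite"
  assumes r: "r > 0" and x: "\<forall>i. x $ i \<in> mu r"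
    and c: "\<forall>i. int (CHAR('k) ^ r - 1) dvd c $ i - c' $ i"
  shows "monomial_at x c = monomial_at x c'"
  unfolding monomial_at_def
proof (intro prod.cong refl)
  fix i
  have "x $ i powi c $ i = x $ i powi (c $ i - c' $ i) * x $ i powi c' $ i"
    using mu_inverse(2)[OF r, of "x $ i"] x by (simp flip: power_int_add)
  then show "x $ i powi c $ i = x $ i powi c' $ i"
    using mu_powi_eq_1[of "x $ i" r "c $ i - c' $ i"] x c by simp
qed

lemma exp_sum_cong_mod:
  fixes f :: "('k::{alg_closed_field, field_prime_char} witt fract, 'n::finite) laurent"
  assumes r: "r > 0" and e: "\<forall>i. int (CHAR('k) ^ r - 1) dvd e $ i - e' $ i"
  shows "exp_sum f e r = exp_sum f e' r"
  unfolding exp_sum_def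
proof (intro sum.cong refl arg_cong2[where f = "(*)"] arg_cong[where f = fps_const])
  fix x :: "'k witt fract ^ 'n" assume "x \<in> {x. \<forall>i. x $ i \<in> mu r}"
  then have "monomial_at x e = monomial_at x e'"
    using e by (intro monomial_at_cong_mod[OF r]) auto
  then show "monomial_at x (- e) = monomial_at x (- e')" by (simp add: monomial_at_minus)
qed

lemma mu_power_card:
  fixes x :: "'k::{alg_closed_field, field_prime_char} witt fract"
  assumes "a > 0" "x \<in> mu a"
  shows "x ^ (CHAR('k) ^ (a * k)) = x"
proof -
  have *: "x ^ (CHAR('k) ^ a) = x"
    using mu_power_order[OF assms(2)] char_power_gt_1[OF assms(1), where ?'k = 'k]
    by (metis One_nat_def Suc_pred less_imp_Suc_add mult.right_neutral power_Suc zero_less_Suc)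
  show ?thesis
    by (induction k) (simp_all add: power_add power_mult *)
qed

text \<open>Frobenius permutes the conjugates of \<open>t\<close> cyclically, as \<open>t ^ (p\<^sup>r) = t\<close>.\<close>

lemma sum_frobenius_power:
  fixes t :: "'k::{alg_closed_field, field_prime_char} witt fract"
  assumes r: "r > 0" and t: "t \<in> mu r"
  shows "(\<Sum>i<r. (t ^ (CHAR('k) ^ a)) ^ (CHAR('k) ^ i)) = (\<Sum>i<r. t ^ (CHAR('k) ^ i))"
proof (induction a)
  case (Suc a)
  let ?s = "t ^ (CHAR('k) ^ a)"
  have s: "?s ^ (CHAR('k) ^ r) = ?s"
    using mu_power_card[OF r, of ?s 1] mu_power[OF t] by simp
  have "(\<Sum>i<r. (t ^ (CHAR('k) ^ Suc a)) ^ (CHAR('k) ^ i)) = (\<Sum>i<r. ?s ^ (CHAR('k) ^ Suc i))"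
    by (simp add: mult_ac flip: power_mult)
  also have "\<dots> = (\<Sum>i<r. ?s ^ (CHAR('k) ^ i))"
    using sum.lessThan_Suc_shift[of "\<lambda>i. ?s ^ (CHAR('k) ^ i)" r] s by (simp add: add.commute)
  finally show ?case using Suc by simp
qed simp

lemma monomial_at_power: "monomial_at (\<chi> i. x $ i ^ k) u = monomial_at x u ^ k"
proof -
  have "(y ^ k) powi c = (y powi c) ^ k" for y :: 'a and c
    by (metis mult.commute power_int_mult power_int_of_nat)
  then show ?thesis by (simp add: monomial_at_def prod_power_distrib)
qed

lemma monomial_at_times_exponent: "monomial_at x (\<chi> i. int k * u $ i) = monomial_at x u ^ k"
proof -
  have "y powi (int k * c) = (y powi c) ^ k" for y :: 'a and c
    by (metis mult.commute power_int_mult power_int_of_nat)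
  then show ?thesis by (simp add: monomial_at_def prod_power_distrib)
qed

text \<open>
  For \<open>q = p\<^sup>a\<close> the map \<open>x \<mapsto> x\<^sup>q\<close> permutes \<open>\<mu>\<^sup>n\<close>. As \<open>q\<close>-th powers fix the coefficients of \<open>f\<close>, the terms
  of \<open>f(x\<^sup>q)\<close> are the \<open>q\<close>-th powers of those of \<open>f(x)\<close>, and the trace does not change. So an exponential
  sum depends only on the orbit of its twist.
\<close>

lemma exp_sum_frobenius:
  fixes f :: "('k::{alg_closed_field, field_prime_char} witt fract, 'n::finite) laurent"
  assumes a: "a > 0" and l: "l > 0"
    and f: "\<forall>u\<in>Poly_Mapping.keys f. Poly_Mapping.lookup f u \<in> mu a"
  shows "exp_sum f (\<chi> i. int (CHAR('k) ^ a) * e $ i) (a * l) = exp_sum f e (a * l)"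
proof -
  let ?q = "CHAR('k) ^ a" and ?r = "a * l"
  have r: "?r > 0" using a l by simp
  let ?A = "{x :: 'k witt fract ^ 'n. \<forall>i. x $ i \<in> mu ?r}"
  \<comment> \<open>On \<open>\<mu>\<close> the inverse of \<open>x \<mapsto> x ^ (p\<^sup>a)\<close> is \<open>x \<mapsto> x ^ (p ^ (a (l - 1)))\<close>, as \<open>x ^ (p ^ (a l)) = x\<close>.\<close>
  let ?\<phi> = "\<lambda>k x. (\<chi> i. x $ i ^ (CHAR('k) ^ k)) :: 'k witt fract ^ 'n"
  have inv: "(x $ i ^ (CHAR('k) ^ (a * (l - 1)))) ^ ?q = x $ i"
    "(x $ i ^ ?q) ^ (CHAR('k) ^ (a * (l - 1))) = x $ i" if "x \<in> ?A" for x i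
  proof -
    have "a * (l - 1) + a = a * l" using l by (cases l) auto
    then show "(x $ i ^ (CHAR('k) ^ (a * (l - 1)))) ^ ?q = x $ i"
      "(x $ i ^ ?q) ^ (CHAR('k) ^ (a * (l - 1))) = x $ i"
      using mu_power_card[OF r, of "x $ i" 1] that
      by (simp_all flip: power_mult power_add add: add.commute)
  qed
  have summand: "fps_const (monomial_at (?\<phi> a x) (- e)) * fps_binomial (unram_trace ?r (laurent_eval f (?\<phi> a x))) =
      fps_const (monomial_at x (- (\<chi> i. int ?q * e $ i))) * fps_binomial (unram_trace ?r (laurent_eval f x))"
    if x: "x \<in> ?A" for x
  proof -
    note mon = monomial_at_power[of x ?q]
    let ?t = "\<lambda>u. Poly_Mapping.lookup f u * monomial_at x u"
    have t: "?t u \<in> mu ?r" if "u \<in> Poly_Mapping.keys f" for u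
      using f x that mu_mono[OF a l, where ?'k = 'k] by (intro mu_mult monomial_at_in_mu[OF r]) auto
    have "laurent_eval f (?\<phi> a x) = (\<Sum>u\<in>Poly_Mapping.keys f. ?t u ^ ?q)"
      unfolding laurent_eval_def mon
      using f mu_power_card[OF a, of _ 1, where ?'k = 'k]
      by (intro sum.cong) (simp_all add: power_mult_distrib)
    then have "unram_trace ?r (laurent_eval f (?\<phi> a x)) = unram_trace ?r (laurent_eval f x)"
      using t mu_power[OF t] unfolding laurent_eval_def
      by (simp add: unram_trace_sum_mu[OF r] sum_frobenius_power[OF r])
    moreover have "monomial_at x (\<chi> i. int ?q * e $ i) = monomial_at x e ^ ?q"
      by (simp add: monomial_at_times_exponent del: of_nat_power)
    ultimately show ?thesis by (simp add: monomial_at_minus mon)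
  qed
  have "exp_sum f e ?r = (\<Sum>x\<in>?A. fps_const (monomial_at (?\<phi> a x) (- e)) *
      fps_binomial (unram_trace ?r (laurent_eval f (?\<phi> a x))))"
    unfolding exp_sum_def
    by (rule sum.reindex_bij_witness[of _ "?\<phi> a" "?\<phi> (a * (l - 1))"])
      (auto simp: inv vec_eq_iff intro!: mu_power simp del: One_nat_def)
  also have "\<dots> = exp_sum f (\<chi> i. int ?q * e $ i) ?r"
    unfolding exp_sum_def by (intro sum.cong summand refl)
  finally show ?thesis ..
qed

section \<open>Orbits of multiplication by \<open>q\<close>\<close>

text \<open>
  By the first hypothesis equality of two terms is not affected by a shift. So one recurrence of the
  initial term makes the sequence periodic, the terms within a least period are distinct, and that
  period is the number of values.
\<close>

lemma card_range_periodic: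
  fixes f :: "nat \<Rightarrow> 'b"
  assumes step: "\<And>i j. f i = f j \<longleftrightarrow> f (Suc i) = f (Suc j)" and L: "L > 0" "f L = f 0"
  shows "card (range f) > 0" "f l = f 0 \<longleftrightarrow> card (range f) dvd l"
    "range (\<lambda>s. f (k + s)) = range f"
proof -
  have shift: "f (s + i) = f (s + j) \<longleftrightarrow> f i = f j" for s i j
    by (induction s) (simp_all flip: step)
  define r where "r = (LEAST l. l > 0 \<and> f l = f 0)"
  have r: "r > 0" "f r = f 0"
    using LeastI[of "\<lambda>l. l > 0 \<and> f l = f 0" L] L by (auto simp: r_def)
  have least: "l = 0" if "l < r" "f l = f 0" for l
    using not_less_Least[of l "\<lambda>l. l > 0 \<and> f l = f 0"] that by (auto simp: r_def)
  have period: "f (i + r * n) = f i" for i n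
  proof (induction n)
    case (Suc n)
    have "f (i + r * n + r) = f (i + r * n + 0)" unfolding shift using r(2) by simp
    then show ?case using Suc by (simp add: algebra_simps)
  qed simp
  have mod: "f l = f (l mod r)" for l
    using period[of "l mod r" "l div r"] by simp
  have inj: "inj_on f {..<r}"
  proof (rule linorder_inj_onI)
    fix i j assume ij: "i < j" "i \<in> {..<r}" "j \<in> {..<r}"
    show "f i \<noteq> f j"
    proof
      assume "f i = f j"
      then have "f (i + 0) = f (i + (j - i))" using ij by simp
      then have "f (j - i) = f 0" unfolding shift by simp
      moreover have "j - i < r" using ij by auto
      ultimately have "j - i = 0" by (rule least[rotated])
      then show False using ij(1) by simp
    qed
  qed auto
  have "f l \<in> f ` {..<r}" for l
    using mod[of l] r(1) by (intro image_eqI[of _ _ "l mod r"]) auto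
  then have range: "range f = f ` {..<r}" by auto
  then have card: "card (range f) = r" using card_image[OF inj] by simp
  show "card (range f) > 0" unfolding card by (rule r(1))
  show "f l = f 0 \<longleftrightarrow> card (range f) dvd l"
    unfolding card dvd_eq_mod_eq_0
  proof
    assume "f l = f 0"
    then have "f (l mod r) = f 0" by (simp only: mod[symmetric])
    with mod_less_divisor[OF r(1)] show "l mod r = 0" by (rule least)
  qed (subst mod, simp only:)
  have "f l \<in> range (\<lambda>s. f (k + s))" for l
  proof -
    have "k \<le> l + r * k" using r(1) by (cases r) auto
    then have "f l = f (k + (l + r * k - k))" by (simp add: period)
    then show ?thesis by blast
  qed
  then show "range (\<lambda>s. f (k + s)) = range f" by auto
qed

lemma mod_Z_class_eq_iff:
  "mod_Z_class u = mod_Z_class w \<longleftrightarrow> (\<forall>j i. u $ j $ i - w $ j $ i \<in> \<int>)"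
proof
  assume "mod_Z_class u = mod_Z_class w"
  moreover have "u \<in> mod_Z_class u" by (simp add: mod_Z_class_def)
  ultimately show "\<forall>j i. u $ j $ i - w $ j $ i \<in> \<int>" by (simp add: mod_Z_class_def)
next
  assume *: "\<forall>j i. u $ j $ i - w $ j $ i \<in> \<int>"
  have "x $ j $ i - u $ j $ i \<in> \<int> \<longleftrightarrow> x $ j $ i - w $ j $ i \<in> \<int>" for x j i
    using Ints_add[of "x $ j $ i - u $ j $ i" "u $ j $ i - w $ j $ i"]
      Ints_diff[of "x $ j $ i - w $ j $ i" "u $ j $ i - w $ j $ i"] * by auto
  then show "mod_Z_class u = mod_Z_class w" by (simp add: mod_Z_class_def)
qed

definition q_mult :: "nat \<Rightarrow> nat \<Rightarrow> rat ^ 'n ^ 'm \<Rightarrow> rat ^ 'n ^ 'm" where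
  "q_mult q k u = (\<chi> j i. of_nat q ^ k * u $ j $ i)"

lemma q_orbit_altdef: "q_orbit q u = range (\<lambda>k. mod_Z_class (q_mult q k u))"
  by (auto simp: q_orbit_def q_mult_def)

lemma q_mult_add: "q_mult q (k + l) u = q_mult q k (q_mult q l u)"
  by (simp add: q_mult_def power_add vec_eq_iff mult_ac)

lemma q_mult_0 [simp]: "q_mult q 0 u = u"
  by (simp add: q_mult_def vec_eq_iff)

lemma mod_Z_class_q_mult:
  assumes "mod_Z_class u = mod_Z_class w"
  shows "mod_Z_class (q_mult q k u) = mod_Z_class (q_mult q k w)"
  unfolding mod_Z_class_eq_iff
proof (intro allI)
  fix j i
  have "of_nat q ^ k * (u $ j $ i - w $ j $ i) \<in> \<int>"
    using assms unfolding mod_Z_class_eq_iff by (intro Ints_mult Ints_power) auto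
  then show "q_mult q k u $ j $ i - q_mult q k w $ j $ i \<in> \<int>"
    by (simp add: q_mult_def algebra_simps)
qed

lemma q_orbit_cong: "mod_Z_class u = mod_Z_class w \<Longrightarrow> q_orbit q u = q_orbit q w"
  unfolding q_orbit_altdef by (rule arg_cong[of _ _ range], rule ext) (rule mod_Z_class_q_mult)

lemma mod_Z_class_in_q_orbit: "mod_Z_class u \<in> q_orbit q u"
  unfolding q_orbit_altdef by (rule image_eqI[of _ _ 0]) simp_all

lemma q_orbit_eqD:
  assumes "q_orbit q u = q_orbit q w"
  obtains k where "mod_Z_class u = mod_Z_class (q_mult q k w)"
  using mod_Z_class_in_q_orbit[of u q] unfolding assms by (auto simp: q_orbit_altdef)

text \<open>
  For \<open>c = q\<^sup>l - 1\<close> this says that multiplication by \<open>q\<^sup>l\<close> fixes the class of \<open>u\<close>, and then \<open>c u\<close> is a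
  tuple of twists for the field with \<open>q\<^sup>l\<close> elements.
\<close>

definition killed_by :: "rat \<Rightarrow> rat ^ 'n ^ 'm \<Rightarrow> bool" where
  "killed_by c u \<longleftrightarrow> (\<forall>j i. c * u $ j $ i \<in> \<int>)"

lemma killed_by_iff_class:
  "killed_by (of_nat q ^ l - 1) u \<longleftrightarrow> mod_Z_class (q_mult q l u) = mod_Z_class u"
  by (simp add: killed_by_def mod_Z_class_eq_iff q_mult_def algebra_simps)

lemma q_orbit_periodic:
  fixes u :: "rat ^ 'n ^ 'm"
  assumes L: "L > 0" "killed_by (of_nat q ^ L - 1) u"
  shows "card (q_orbit q u) > 0"
    and "killed_by (of_nat q ^ l - 1) u \<longleftrightarrow> card (q_orbit q u) dvd l"
    and "q_orbit q (q_mult q k u) = q_orbit q u"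
proof -
  let ?f = "\<lambda>k. mod_Z_class (q_mult q k u)"
  have L0: "?f L = ?f 0" using L(2) by (simp add: killed_by_iff_class)
  have shift: "?f (s + i) = ?f (s + j)" if "?f i = ?f j" for s i j
    unfolding q_mult_add using that by (rule mod_Z_class_q_mult)
  have step: "?f i = ?f j \<longleftrightarrow> ?f (Suc i) = ?f (Suc j)" for i j
  proof
    assume "?f i = ?f j"
    then show "?f (Suc i) = ?f (Suc j)" using shift[of i j 1] by simp
  next
    have per: "?f (L + i) = ?f i" for i using shift[OF L0, of i] by (simp add: add.commute)
    assume "?f (Suc i) = ?f (Suc j)"
    then have "?f (L - 1 + Suc i) = ?f (L - 1 + Suc j)" by (rule shift)
    moreover have "L - 1 + Suc i = L + i" for i using L(1) by simp
    ultimately show "?f i = ?f j" by (simp only: per)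
  qed
  note * = card_range_periodic[of ?f L, OF step L(1) L0]
  show "card (q_orbit q u) > 0" using *(1) by (simp add: q_orbit_altdef)
  show "killed_by (of_nat q ^ l - 1) u \<longleftrightarrow> card (q_orbit q u) dvd l"
    using *(2)[of l] by (simp add: q_orbit_altdef killed_by_iff_class)
  show "q_orbit q (q_mult q k u) = q_orbit q u"
    unfolding q_orbit_altdef q_mult_add[symmetric] add.commute[of _ k] by (rule *(3))
qed

text \<open>
  Denominators of elements of \<open>\<int>\<^sub>(\<^sub>p\<^sub>)\<close> are prime to \<open>p\<close>, so by Euler's theorem some \<open>q\<^sup>L - 1\<close> is a common
  multiple of them. In particular all orbits are finite.
\<close>

lemma loc_tuples_killed:
  fixes u :: "rat ^ 'n::finite ^ 'm::finite"
  assumes p: "prime p" and u: "u \<in> loc_tuples p"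
  obtains L where "L > 0" "killed_by (of_nat (p ^ a) ^ L - 1) u"
proof -
  define b where "b j i = (SOME b. \<exists>c. u $ j $ i = of_int c / of_int b \<and> \<not> int p dvd b)" for j i
  have b: "\<exists>c. u $ j $ i = of_int c / of_int (b j i) \<and> \<not> int p dvd b j i" for j i
  proof -
    have "u $ j $ i \<in> Z_loc p" using u by (simp add: loc_tuples_def)
    then have "\<exists>b. \<exists>c. u $ j $ i = of_int c / of_int b \<and> \<not> int p dvd b"
      unfolding Z_loc_def by fast
    then show ?thesis unfolding b_def by (rule someI_ex)
  qed
  define B where "B = (\<Prod>j\<in>UNIV. \<Prod>i\<in>UNIV. nat \<bar>b j i\<bar>)"
  have b0: "b j i \<noteq> 0" for j i using b[of j i] by auto
  have "coprime p (nat \<bar>b j i\<bar>)" for j i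
    using b[of j i] by (intro prime_imp_coprime[OF p]) (simp add: dvd_nat_abs_iff)
  then have "coprime p B" unfolding B_def by (intro prod_coprime_right) auto
  then have "coprime (p ^ a) B" by simp
  then have "B dvd (p ^ a) ^ totient B - 1" by (rule cong_to_1_nat[OF euler_theorem])
  then have "int B dvd int ((p ^ a) ^ totient B - 1)" by (simp only: int_dvd_int_iff)
  also have "int ((p ^ a) ^ totient B - 1) = int (p ^ a) ^ totient B - 1"
    using prime_gt_0_nat[OF p] by (simp add: of_nat_diff)
  finally have dvd: "int B dvd int (p ^ a) ^ totient B - 1" .
  have "killed_by (of_nat (p ^ a) ^ totient B - 1) u"
    unfolding killed_by_def
  proof (intro allI)
    fix j i
    obtain c where c: "u $ j $ i = of_int c / of_int (b j i)" using b by blast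
    have "nat \<bar>b j i\<bar> dvd (\<Prod>i\<in>UNIV. nat \<bar>b j i\<bar>)" by (rule dvd_prodI) auto
    also have "\<dots> dvd B" unfolding B_def by (rule dvd_prodI) auto
    finally have "b j i dvd int B" by (simp add: nat_abs_dvd_iff)
    then have "b j i dvd int (p ^ a) ^ totient B - 1" using dvd by (rule dvd_trans)
    then obtain k where k: "int (p ^ a) ^ totient B - 1 = b j i * k" by (rule dvdE)
    have "(of_nat (p ^ a) ^ totient B - 1 :: rat) = of_int (int (p ^ a) ^ totient B - 1)" by simp
    also have "\<dots> * u $ j $ i = of_int (k * c)" unfolding k c using b0 by simp
    finally show "(of_nat (p ^ a) ^ totient B - 1) * u $ j $ i \<in> \<int>"
      by (simp only: Ints_of_int)
  qed
  moreover have "B > 0" using b0 by (auto simp: B_def intro!: prod_pos)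
  then have "totient B > 0" by simp
  ultimately show ?thesis by (rule that[rotated])
qed

lemma killed_in_loc_tuples:
  assumes p: "prime p" and a: "a > 0" and l: "l > 0" and u: "killed_by (of_nat (p ^ a) ^ l - 1) u"
  shows "u \<in> loc_tuples p"
  unfolding loc_tuples_def
proof (intro CollectI allI)
  fix j i
  let ?N = "int (p ^ a) ^ l - 1"
  have pl: "int p dvd int (p ^ a) ^ l" using a l dvd_power[of "a * l" "int p"] by (simp flip: power_mult)
  have ndvd: "\<not> int p dvd ?N"
  proof
    assume "int p dvd ?N"
    then have "int p dvd int (p ^ a) ^ l - ?N" by (rule dvd_diff[OF pl])
    then have "p dvd 1" using int_dvd_int_iff[of p 1] by simp
    then show False using prime_gt_1_nat[OF p] by simp
  qed
  then have N: "?N \<noteq> 0" by auto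
  obtain c where "(of_nat (p ^ a) ^ l - 1) * u $ j $ i = of_int c"
    using u by (auto simp: killed_by_def elim!: Ints_cases)
  then have c: "of_int ?N * u $ j $ i = of_int c" by simp
  have "u $ j $ i = of_int c / of_int ?N"
    unfolding c[symmetric] using N by (subst nonzero_mult_div_cancel_left) (simp_all only: of_int_eq_0_iff not_False_eq_True)
  then show "u $ j $ i \<in> Z_loc p" using ndvd by (auto simp only: Z_loc_def)
qed

definition frac_point :: "nat \<Rightarrow> int ^ 'n ^ 'm \<Rightarrow> rat ^ 'n ^ 'm" where
  "frac_point N e = (\<chi> j i. of_int (e $ j $ i) / of_nat N)"

lemma Ints_divide_iff:
  assumes "N > 0"
  shows "(of_int c / of_nat N :: rat) \<in> \<int> \<longleftrightarrow> int N dvd c"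
proof
  assume "(of_int c / of_nat N :: rat) \<in> \<int>"
  then obtain k where "(of_int c / of_nat N :: rat) = of_int k" by (elim Ints_cases)
  then have "(of_int c :: rat) = of_int (int N * k)" using assms by (simp add: field_simps)
  then show "int N dvd c" by (simp only: of_int_eq_iff) simp
qed (use assms in \<open>auto elim!: dvdE\<close>)

lemma mod_Z_class_frac_point_eq_iff:
  assumes "N > 0"
  shows "mod_Z_class (frac_point N e) = mod_Z_class (frac_point N e') \<longleftrightarrow>
    (\<forall>j i. int N dvd e $ j $ i - e' $ j $ i)"
proof -
  have "frac_point N e $ j $ i - frac_point N e' $ j $ i = of_int (e $ j $ i - e' $ j $ i) / of_nat N" for j i
    by (simp add: frac_point_def diff_divide_distrib)
  then show ?thesis by (simp only: mod_Z_class_eq_iff Ints_divide_iff[OF assms])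
qed

lemma q_mult_frac_point: "q_mult q k (frac_point N e) = frac_point N (\<chi> j i. int q ^ k * e $ j $ i)"
  by (simp add: q_mult_def frac_point_def vec_eq_iff)

lemma frac_point_box_inj:
  assumes N: "N > 0" and e: "\<forall>j i. e $ j $ i \<in> {0..<int N}" "\<forall>j i. e' $ j $ i \<in> {0..<int N}"
    and eq: "mod_Z_class (frac_point N e) = mod_Z_class (frac_point N e')"
  shows "e = e'"
proof -
  have "e $ j $ i mod int N = e' $ j $ i mod int N" for j i
    using eq unfolding mod_Z_class_frac_point_eq_iff[OF N] mod_eq_dvd_iff by simp
  moreover have "e $ j $ i mod int N = e $ j $ i" "e' $ j $ i mod int N = e' $ j $ i" for j i
    using e by (auto intro!: mod_pos_pos_trivial)
  ultimately have "e $ j $ i = e' $ j $ i" for j i by (simp only:)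
  then show ?thesis by (simp add: vec_eq_iff)
qed

lemma frac_point_int_multiple:
  assumes "N > 0" "killed_by (of_nat N) u"
  shows "frac_point N (\<chi> j. int_multiple (of_nat N) (u $ j)) = u"
  using assms by (simp add: killed_by_def frac_point_def int_multiple_def vec_eq_iff of_int_floor_cancel)

lemma frac_point_box_ex:
  assumes N: "N > 0" and u: "killed_by (of_nat N) u"
  obtains e where "\<forall>j i. e $ j $ i \<in> {0..<int N}" "mod_Z_class (frac_point N e) = mod_Z_class u"
proof
  define c where "c = (\<chi> j. int_multiple (of_nat N) (u $ j))"
  have u_eq: "u = frac_point N c" unfolding c_def by (rule frac_point_int_multiple[OF assms, symmetric])
  show "\<forall>j i. (\<chi> j i. c $ j $ i mod int N) $ j $ i \<in> {0..<int N}" using N by simp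
  show "mod_Z_class (frac_point N (\<chi> j i. c $ j $ i mod int N)) = mod_Z_class u"
    unfolding u_eq mod_Z_class_frac_point_eq_iff[OF N] by (simp add: mod_eq_dvd_iff[symmetric])
qed

text \<open>
  The classes in the orbit of \<open>w\<close> that have denominator \<open>q\<^sup>l - 1\<close> are either all or none of them,
  according to whether \<open>q\<^sup>l\<close> fixes \<open>w\<close>, which means that the length of the orbit divides \<open>l\<close>; and each
  such class has one representative with numerators in \<open>[0, q\<^sup>l - 1)\<close>.
\<close>

lemma card_orbit_fibre:
  fixes w :: "rat ^ 'n::finite ^ 'm::finite"
  assumes p: "prime p" and a: "a > 0" and l: "l > 0" and w: "w \<in> loc_tuples p" and q: "q = p ^ a"
  shows "card {e. (\<forall>j i. e $ j $ i \<in> {0..<int (q ^ l - 1)}) \<and> q_orbit q (frac_point (q ^ l - 1) e) = q_orbit q w} =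
    (if card (q_orbit q w) dvd l then card (q_orbit q w) else 0)"
proof -
  let ?N = "q ^ l - 1"
  have q1: "q ^ l > 1"
    using prime_gt_1_nat[OF p] a l unfolding q power_mult[symmetric] by (intro one_less_power) auto
  then have N: "?N > 0" by simp
  have Nrat: "(of_nat ?N :: rat) = of_nat q ^ l - 1"
    using q1 by (simp add: of_nat_diff)
  obtain L where L: "L > 0" "killed_by (of_nat q ^ L - 1) w"
    using loc_tuples_killed[OF p w, of a] unfolding q by blast
  note periodic = q_orbit_periodic[OF L]
  have killed_class: "killed_by (of_nat ?N) u = killed_by (of_nat ?N) u'"
    if "mod_Z_class u = mod_Z_class u'" for u u' :: "rat ^ 'n ^ 'm"
    using that mod_Z_class_q_mult[OF that] unfolding Nrat killed_by_iff_class by simp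
  have killed_mult: "killed_by (of_nat ?N) (q_mult q k u)" if "killed_by (of_nat ?N) u" for k and u :: "rat ^ 'n ^ 'm"
  proof -
    have "of_nat q ^ k * (of_nat ?N * u $ j $ i) \<in> \<int>" for j i
      using that unfolding killed_by_def by (intro Ints_mult[of "of_nat q ^ k"]) auto
    moreover have "of_nat ?N * q_mult q k u $ j $ i = of_nat q ^ k * (of_nat ?N * u $ j $ i)" for j i
      unfolding q_mult_def by (simp only: vec_lambda_beta mult.left_commute)
    ultimately show ?thesis by (simp only: killed_by_def simp_thms)
  qed
  have killed_frac: "killed_by (of_nat ?N) (frac_point ?N e)" for e :: "int ^ 'n ^ 'm"
    using N by (simp add: killed_by_def frac_point_def)
  let ?S = "{e :: int ^ 'n ^ 'm. (\<forall>j i. e $ j $ i \<in> {0..<int ?N}) \<and> q_orbit q (frac_point ?N e) = q_orbit q w}"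
  show ?thesis
  proof (cases "card (q_orbit q w) dvd l")
    case True
    then have Nw: "killed_by (of_nat ?N) w" using periodic(2)[of l] unfolding Nrat by simp
    have "bij_betw (\<lambda>e. mod_Z_class (frac_point ?N e)) ?S (q_orbit q w)"
      unfolding bij_betw_def
    proof
      show "inj_on (\<lambda>e. mod_Z_class (frac_point ?N e)) ?S"
        by (intro inj_onI frac_point_box_inj[OF N]) simp_all
      show "(\<lambda>e. mod_Z_class (frac_point ?N e)) ` ?S = q_orbit q w"
      proof (intro equalityI subsetI)
        fix c assume "c \<in> q_orbit q w"
        then obtain k where c: "c = mod_Z_class (q_mult q k w)" by (auto simp: q_orbit_altdef)
        obtain e where e: "\<forall>j i. e $ j $ i \<in> {0..<int ?N}"
          "mod_Z_class (frac_point ?N e) = mod_Z_class (q_mult q k w)"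
          using N killed_mult[OF Nw] by (rule frac_point_box_ex)
        then have "q_orbit q (frac_point ?N e) = q_orbit q w"
          using q_orbit_cong[OF e(2), of q] periodic(3) by simp
        then show "c \<in> (\<lambda>e. mod_Z_class (frac_point ?N e)) ` ?S" using e c by blast
      qed (auto dest: sym intro: mod_Z_class_in_q_orbit)
    qed
    then show ?thesis using True by (simp add: bij_betw_same_card)
  next
    case False
    have "?S = {}"
    proof (intro equals0I)
      fix e assume "e \<in> ?S"
      then have "q_orbit q w = q_orbit q (frac_point ?N e)" by simp
      then obtain k where k: "mod_Z_class w = mod_Z_class (q_mult q k (frac_point ?N e))"
        by (rule q_orbit_eqD)
      then have "killed_by (of_nat ?N) w" using killed_class[OF k] killed_mult[OF killed_frac] by simp
      then show False using False periodic(2)[of l] unfolding Nrat by simp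
    qed
    then show ?thesis using False by (simp only: card.empty if_False)
  qed
qed

section \<open>Solutions of the tensor congruence\<close>

lemma orbit_solution_altdef:
  "orbit_solution v d q u \<longleftrightarrow>
    (\<forall>i k. (\<Sum>j\<in>UNIV. u $ j $ i * of_int (v j $ k)) - of_int (d $ (i, k)) / (of_nat q - 1) \<in> \<int>)"
  by (simp add: orbit_solution_def tensor_vec_def)

text \<open>
  Multiplication by \<open>q\<close> fixes the class of \<open>d/(q - 1)\<close>, because \<open>(q\<^sup>k - 1)/(q - 1)\<close> is an integer. So
  the congruence is a condition on orbits.
\<close>

lemma orbit_solution_cong:
  assumes q: "q > 1" and u: "mod_Z_class u = mod_Z_class (q_mult q k w)" and w: "orbit_solution v d q w"
  shows "orbit_solution v d q u"
  unfolding orbit_solution_altdef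
proof (intro allI)
  fix i s
  let ?x = "of_nat q :: rat" and ?d = "of_int (d $ (i, s)) :: rat" and ?v = "\<lambda>j. of_int (v j $ s) :: rat"
  have diff: "u $ j $ i - ?x ^ k * w $ j $ i \<in> \<int>" for j
    using u by (simp add: mod_Z_class_eq_iff q_mult_def)
  have geo: "(\<Sum>t<k. ?x ^ t) = (?x ^ k - 1) / (?x - 1)"
    using q by (intro geometric_sum) simp
  have "(\<Sum>j\<in>UNIV. (u $ j $ i - ?x ^ k * w $ j $ i) * ?v j) \<in> \<int>"
    using diff by (intro Ints_sum Ints_mult[OF _ Ints_of_int]) auto
  moreover have "?x ^ k * ((\<Sum>j\<in>UNIV. w $ j $ i * ?v j) - ?d / (?x - 1)) \<in> \<int>"
    using w unfolding orbit_solution_altdef by (intro Ints_mult) auto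
  moreover have "?d * (\<Sum>t<k. ?x ^ t) \<in> \<int>"
    by (intro Ints_mult Ints_sum) auto
  ultimately have "(\<Sum>j\<in>UNIV. (u $ j $ i - ?x ^ k * w $ j $ i) * ?v j) +
      (?x ^ k * ((\<Sum>j\<in>UNIV. w $ j $ i * ?v j) - ?d / (?x - 1)) + ?d * (\<Sum>t<k. ?x ^ t)) \<in> \<int>"
    by (intro Ints_add)
  also have "(\<Sum>j\<in>UNIV. (u $ j $ i - ?x ^ k * w $ j $ i) * ?v j) =
      (\<Sum>j\<in>UNIV. u $ j $ i * ?v j) - ?x ^ k * (\<Sum>j\<in>UNIV. w $ j $ i * ?v j)"
    by (simp add: left_diff_distrib sum_subtractf sum_distrib_left mult.assoc)
  also have "\<dots> + (?x ^ k * ((\<Sum>j\<in>UNIV. w $ j $ i * ?v j) - ?d / (?x - 1)) + ?d * (\<Sum>t<k. ?x ^ t)) =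
      (\<Sum>j\<in>UNIV. u $ j $ i * ?v j) - ?d / (?x - 1)"
    unfolding geo by (simp add: algebra_simps diff_divide_distrib)
  finally show "(\<Sum>j\<in>UNIV. u $ j $ i * ?v j) - ?d / (?x - 1) \<in> \<int>" .
qed

lemma orbit_solution_frac_point:
  assumes q: "q > 1" and l: "l > 0"
  shows "orbit_solution v d q (frac_point (q ^ l - 1) e) \<longleftrightarrow>
    (\<forall>ik. int (q ^ l - 1) dvd
      (\<Sum>j\<in>UNIV. tensor_vec (e $ j) (v j)) $ ik - (\<chi> ik. d $ ik * int ((q ^ l - 1) div (q - 1))) $ ik)"
proof -
  let ?N = "q ^ l - 1" and ?M = "(q ^ l - 1) div (q - 1)"
  have "q - 1 dvd q ^ l - 1" using power_minus_one_dvd[of q 1 l] by simp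
  then have NM: "?N = ?M * (q - 1)" by simp
  have N: "?N > 0" using one_less_power[OF q l] by simp
  then have M: "?M > 0" using NM by (metis gr0I mult_zero_left)
  have Nr: "(of_nat ?N :: rat) = of_nat ?M * (of_nat q - 1)"
    using arg_cong[OF NM, of "of_nat :: nat \<Rightarrow> rat"] q by (simp only: of_nat_mult) (simp add: of_nat_diff)
  have "(\<Sum>j\<in>UNIV. frac_point ?N e $ j $ i * of_int (v j $ k)) - of_int (d $ (i, k)) / (of_nat q - 1) =
      (of_int ((\<Sum>j\<in>UNIV. e $ j $ i * v j $ k) - d $ (i, k) * int ?M) / of_nat ?N :: rat)" for i k
  proof -
    have "of_int (d $ (i, k)) / (of_nat q - 1) = (of_int (d $ (i, k) * int ?M) / of_nat ?N :: rat)"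
      unfolding Nr using M by simp
    moreover have "(\<Sum>j\<in>UNIV. frac_point ?N e $ j $ i * of_int (v j $ k)) =
        (of_int (\<Sum>j\<in>UNIV. e $ j $ i * v j $ k) / of_nat ?N :: rat)"
      by (simp add: frac_point_def sum_divide_distrib)
    ultimately show ?thesis by (simp only: of_int_diff diff_divide_distrib)
  qed
  then show ?thesis
    unfolding orbit_solution_altdef by (simp only: Ints_divide_iff[OF N]) (simp add: tensor_vec_def)
qed

lemma det_of_int: "det (\<chi> i j. of_int (A $ i $ j)) = (of_int (det A) :: 'a::comm_ring_1)"
  by (simp add: det_def)

lemma integral_basis_det_nonzero:
  assumes "integral_basis v"
  shows "det (\<chi> k j. v j $ k) \<noteq> 0"
proof -
  let ?v = "\<lambda>j. (\<chi> i. real_of_int (v j $ i)) :: real ^ 'a"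
  let ?A = "(\<chi> j. ?v j) :: real ^ 'a ^ 'a"
  have "rows ?A = range ?v" by (auto simp: rows_def row_def)
  moreover have "span (range ?v) = UNIV" using assms by (simp add: integral_basis_def Let_def)
  ultimately have "\<exists>B. B ** ?A = mat 1" by (simp add: matrix_left_invertible_span_rows)
  then have "det ?A \<noteq> 0"
    using invertible_left_inverse invertible_det_nz by blast
  moreover have "?A = (\<chi> j k. real_of_int ((\<chi> j k. v j $ k) $ j $ k))" by (simp add: vec_eq_iff)
  ultimately have "det (\<chi> j k. v j $ k) \<noteq> 0" by (simp only: det_of_int of_int_eq_0_iff not_False_eq_True)
  moreover have "(\<chi> k j. v j $ k) = transpose (\<chi> j k. v j $ k)"
    by (simp add: transpose_def vec_eq_iff)
  ultimately show ?thesis by (simp only: det_transpose not_False_eq_True)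
qed

lemma Ints_det: "(\<And>i j. A $ i $ j \<in> \<int>) \<Longrightarrow> det A \<in> \<int>"
  unfolding det_def by (intro Ints_sum Ints_mult Ints_prod) auto

text \<open>
  For fixed \<open>i\<close> the congruence says that the matrix with columns \<open>v\<^sub>j\<close> sends the vector of all
  \<open>(q - 1) u\<^sub>j\<^sub>i\<close> to an integral vector. By Cramer's rule the determinant of the matrix clears the
  denominators of that vector.
\<close>

lemma orbit_solution_killed:
  assumes q: "q > 1" and sol: "orbit_solution v d q u"
  shows "killed_by (of_int (det (\<chi> k j. v j $ k)) * (of_nat q - 1)) u"
  unfolding killed_by_def
proof (intro allI)
  fix j i
  let ?A = "(\<chi> k j. of_int (v j $ k)) :: rat ^ 'a ^ 'a"
  let ?x = "(\<chi> j. (of_nat q - 1) * u $ j $ i) :: rat ^ 'a"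
  have det: "det ?A = of_int (det (\<chi> k j. v j $ k))"
    unfolding det_of_int[symmetric] by simp
  have "(?A *v ?x) $ k \<in> \<int>" for k
  proof -
    have "(of_nat q - 1) * ((\<Sum>j\<in>UNIV. u $ j $ i * of_int (v j $ k)) - of_int (d $ (i, k)) / (of_nat q - 1)) \<in> \<int>"
      using sol unfolding orbit_solution_altdef by (intro Ints_mult) auto
    then have "(of_nat q - 1) * ((\<Sum>j\<in>UNIV. u $ j $ i * of_int (v j $ k)) - of_int (d $ (i, k)) / (of_nat q - 1)) +
        of_int (d $ (i, k)) \<in> \<int>"
      by (rule Ints_add) simp
    also have "(of_nat q - 1) * ((\<Sum>j\<in>UNIV. u $ j $ i * of_int (v j $ k)) - of_int (d $ (i, k)) / (of_nat q - 1)) +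
        of_int (d $ (i, k)) = (of_nat q - 1) * (\<Sum>j\<in>UNIV. u $ j $ i * of_int (v j $ k))"
      using q by (simp add: right_diff_distrib)
    also have "\<dots> = (?A *v ?x) $ k"
      by (simp add: matrix_vector_mult_def sum_distrib_left mult_ac)
    finally show ?thesis .
  qed
  then have "det (\<chi> k j'. if j' = j then (?A *v ?x) $ k else ?A $ k $ j') \<in> \<int>"
    by (intro Ints_det) auto
  then show "of_int (det (\<chi> k j. v j $ k)) * (of_nat q - 1) * u $ j $ i \<in> \<int>"
    unfolding cramer_lemma det by (simp add: mult_ac)
qed

lemma finite_killed_orbits:
  assumes N: "N > 0"
  shows "finite (q_orbit q ` {u :: rat ^ 'n::finite ^ 'm::finite. killed_by (of_nat N) u})"
proof (rule finite_subset)
  let ?B = "{e :: int ^ 'n ^ 'm. \<forall>j. e $ j \<in> {e. \<forall>i. e $ i \<in> {0..<int N}}}"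
  show "finite ((\<lambda>e. q_orbit q (frac_point N e)) ` ?B)"
    by (intro finite_imageI finite_vecs) simp
  show "q_orbit q ` {u. killed_by (of_nat N) u} \<subseteq> (\<lambda>e. q_orbit q (frac_point N e)) ` ?B"
  proof safe
    fix u :: "rat ^ 'n ^ 'm" assume "killed_by (of_nat N) u"
    with N obtain e where e: "\<forall>j i. e $ j $ i \<in> {0..<int N}" "mod_Z_class (frac_point N e) = mod_Z_class u"
      by (rule frac_point_box_ex)
    from q_orbit_cong[OF e(2)] e(1)
    show "q_orbit q u \<in> (\<lambda>e. q_orbit q (frac_point N e)) ` ?B"
      by (intro image_eqI[of _ _ e]) simp_all
  qed
qed

lemma finite_solution_orbits:
  assumes v: "integral_basis v" and q: "q > 1" and rep: "\<forall>X\<in>S. q_orbit q (rep X) = X"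
  shows "finite {X \<in> S. orbit_solution v d q (rep X)}"
proof -
  let ?D = "det (\<chi> k j. v j $ k)"
  let ?N = "nat \<bar>?D\<bar> * (q - 1)"
  have N: "?N > 0" using integral_basis_det_nonzero[OF v] q by simp
  have Nr: "(of_nat ?N :: rat) = of_int (sgn ?D) * (of_int ?D * (of_nat q - 1))"
  proof -
    have "int (nat \<bar>?D\<bar>) = sgn ?D * ?D" by (simp add: sgn_if abs_if)
    then have "(of_nat (nat \<bar>?D\<bar>) :: rat) = of_int (sgn ?D * ?D)"
      by (metis of_int_of_nat_eq)
    then show ?thesis using q by (simp add: of_nat_diff)
  qed
  have "killed_by (of_nat ?N) u" if "orbit_solution v d q u" for u
    using orbit_solution_killed[OF q that]
    unfolding killed_by_def Nr by (simp only: mult.assoc[of "of_int (sgn ?D)"] Ints_mult Ints_of_int simp_thms)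
  then have "{X \<in> S. orbit_solution v d q (rep X)} \<subseteq> q_orbit q ` {u. killed_by (of_nat ?N) u}"
    using rep by (auto intro!: image_eqI[OF sym])
  then show ?thesis using finite_killed_orbits[OF N] by (rule finite_subset)
qed

text \<open>
  Regroup the exponents modulo \<open>q\<^sup>l - 1\<close> by the orbit of \<open>e/(q\<^sup>l - 1)\<close>. The summand is constant on
  each group, and the size of the group is that of the orbit if this divides \<open>l\<close>, and zero otherwise.
\<close>

lemma sum_solutions_by_orbit:
  fixes G :: "int ^ 'n::finite ^ 'm::finite \<Rightarrow> 'c::comm_ring_1"
  assumes p: "prime p" and a: "a > 0" and q: "q = p ^ a" and l: "l > 0"
    and rep: "\<forall>X\<in>q_orbits p q. rep X \<in> loc_tuples p \<and> q_orbit q (rep X) = X"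
    and fin: "finite {X \<in> q_orbits p q. orbit_solution v d q (rep X)}"
    and G: "\<And>e e' k. \<forall>j i. int (q ^ l - 1) dvd e $ j $ i - int q ^ k * e' $ j $ i \<Longrightarrow> G e = G e'"
  shows "(\<Sum>e | (\<forall>j i. e $ j $ i \<in> {0..<int (q ^ l - 1)}) \<and> orbit_solution v d q (frac_point (q ^ l - 1) e). G e) =
    (\<Sum>X | X \<in> q_orbits p q \<and> orbit_solution v d q (rep X).
      if card X dvd l then of_nat (card X) * G (\<chi> j. int_multiple (of_nat q ^ l - 1) (rep X $ j)) else 0)"
proof -
  let ?N = "q ^ l - 1"
  let ?B = "{e :: int ^ 'n ^ 'm. \<forall>j i. e $ j $ i \<in> {0..<int ?N}}"
  let ?S = "{e. (\<forall>j i. e $ j $ i \<in> {0..<int ?N}) \<and> orbit_solution v d q (frac_point ?N e)}"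
  let ?O = "{X \<in> q_orbits p q. orbit_solution v d q (rep X)}"
  let ?g = "\<lambda>e. q_orbit q (frac_point ?N e)"
  have q1: "q > 1" unfolding q using prime_gt_1_nat[OF p] a by (intro one_less_power)
  have N: "?N > 0" using one_less_power[OF q1 l] by simp
  have Nr: "(of_nat ?N :: rat) = of_nat q ^ l - 1"
    using one_less_power[OF q1 l] by (simp add: of_nat_diff)
  have "finite {e :: int ^ 'n ^ 'm. \<forall>j. e $ j \<in> {e. \<forall>i. e $ i \<in> {0..<int ?N}}}"
    by (intro finite_vecs) simp
  then have finS: "finite ?S" by (rule finite_subset[rotated]) auto
  have sol: "orbit_solution v d q u" if eq: "q_orbit q u = q_orbit q w" and w: "orbit_solution v d q w" for u w :: "rat ^ 'n ^ 'm"
  proof -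
    obtain k where "mod_Z_class u = mod_Z_class (q_mult q k w)" using eq by (rule q_orbit_eqD)
    then show ?thesis using w by (rule orbit_solution_cong[OF q1])
  qed
  have orb: "?g e \<in> q_orbits p q" for e :: "int ^ 'n ^ 'm"
  proof -
    have "killed_by (of_nat ?N) (frac_point ?N e)" using N by (simp add: killed_by_def frac_point_def)
    then have "killed_by (of_nat q ^ l - 1) (frac_point ?N e)" by (simp only: Nr)
    then have "frac_point ?N e \<in> loc_tuples p"
      by (rule killed_in_loc_tuples[OF p a l, folded q])
    then show ?thesis by (simp add: q_orbits_def)
  qed
  have gO: "?g ` ?S \<subseteq> ?O"
  proof safe
    fix e assume e: "orbit_solution v d q (frac_point ?N e)"
    show "?g e \<in> q_orbits p q" by (rule orb)
    then have "q_orbit q (rep (?g e)) = ?g e" using rep by blast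
    then show "orbit_solution v d q (rep (?g e))" using e by (rule sol)
  qed
  have "sum G ?S = (\<Sum>X\<in>?O. sum G {e \<in> ?S. ?g e = X})"
    using sum.group[OF finS fin gO, of G] by simp
  also have "\<dots> = (\<Sum>X\<in>?O. if card X dvd l then of_nat (card X) * G (\<chi> j. int_multiple (of_nat q ^ l - 1) (rep X $ j)) else 0)"
  proof (intro sum.cong refl)
    fix X assume X: "X \<in> ?O"
    then have w: "rep X \<in> loc_tuples p" "q_orbit q (rep X) = X" "orbit_solution v d q (rep X)"
      using rep by auto
    let ?F = "{e. (\<forall>j i. e $ j $ i \<in> {0..<int ?N}) \<and> ?g e = q_orbit q (rep X)}"
    have fibre: "{e \<in> ?S. ?g e = X} = ?F"
      using w(2) sol[OF _ w(3)] by auto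
    have card: "card ?F = (if card X dvd l then card X else 0)"
      using card_orbit_fibre[OF p a l w(1) q] unfolding w(2) .
    show "sum G {e \<in> ?S. ?g e = X} =
      (if card X dvd l then of_nat (card X) * G (\<chi> j. int_multiple (of_nat q ^ l - 1) (rep X $ j)) else 0)"
    proof (cases "card X dvd l")
      case True
      obtain L where L: "L > 0" "killed_by (of_nat q ^ L - 1) (rep X)"
        using loc_tuples_killed[OF p w(1), of a] unfolding q by blast
      have "killed_by (of_nat ?N) (rep X)"
        unfolding Nr using q_orbit_periodic(2)[OF L, of l] True w(2) by simp
      then have rep_eq: "rep X = frac_point ?N (\<chi> j. int_multiple (of_nat ?N) (rep X $ j))"
        by (rule frac_point_int_multiple[OF N, symmetric])
      have "G e = G (\<chi> j. int_multiple (of_nat ?N) (rep X $ j))" if e: "e \<in> ?F" for e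
      proof -
        have "?g e = q_orbit q (rep X)" using e by simp
        then obtain k where "mod_Z_class (frac_point ?N e) = mod_Z_class (q_mult q k (rep X))"
          by (rule q_orbit_eqD)
        then have "mod_Z_class (frac_point ?N e) =
            mod_Z_class (q_mult q k (frac_point ?N (\<chi> j. int_multiple (of_nat ?N) (rep X $ j))))"
          using rep_eq by (simp only:)
        then show ?thesis
          unfolding q_mult_frac_point mod_Z_class_frac_point_eq_iff[OF N] by (intro G) simp
      qed
      then have "sum G ?F = of_nat (card ?F) * G (\<chi> j. int_multiple (of_nat ?N) (rep X $ j))"
        by (simp only: sum_constant[symmetric] cong: sum.cong)
      then show ?thesis unfolding fibre card Nr using True by (simp only: if_True)
    next
      case False
      moreover have "finite ?F" unfolding fibre[symmetric] by (rule finite_subset[OF _ finS]) auto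
      ultimately have "?F = {}" using card by simp
      then show ?thesis unfolding fibre using False by (simp only: sum.empty if_False)
    qed
  qed
  finally show ?thesis by simp
qed

section \<open>Exponentials of power series\<close>

lemma exp_fps_nth_0 [simp]: "fps_nth (exp_fps F) 0 = 1"
  by (simp add: exp_fps_def)

lemma fps_deriv_exp_fps:
  fixes F :: "'a::field_char_0 fps fps"
  assumes "fps_nth F 0 = 0"
  shows "fps_deriv (exp_fps F) = exp_fps F * fps_deriv F"
proof -
  let ?E = "Abs_fps (\<lambda>n. fps_const (1 / fact n)) :: 'a fps fps"
  have "fps_deriv ?E = ?E"
  proof (rule fps_ext)
    fix n
    have "fps_nth (fps_deriv ?E) n = fps_const (of_nat (Suc n) * (1 / fact (Suc n)))"
      by (simp only: fps_deriv_nth fps_nth_Abs_fps Suc_eq_plus1[symmetric]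
          fps_of_nat[symmetric] fps_const_mult)
    also have "of_nat (Suc n) * (1 / fact (Suc n)) = (1 / fact n :: 'a)"
      by (simp only: fact_Suc) (simp del: of_nat_Suc)
    finally show "fps_nth (fps_deriv ?E) n = fps_nth ?E n" by (simp only: fps_nth_Abs_fps)
  qed
  then show ?thesis
    using fps_compose_deriv[OF assms, of ?E] by (simp add: exp_fps_def)
qed

lemma fps_linear_ode_unique:
  fixes H1 H2 K :: "'a::field_char_0 fps fps"
  assumes "fps_deriv H1 = H1 * K" "fps_deriv H2 = H2 * K" "fps_nth H1 0 = fps_nth H2 0"
  shows "H1 = H2"
proof (rule fps_ext)
  fix n
  show "fps_nth H1 n = fps_nth H2 n"
  proof (induction n rule: less_induct)
    case (less n)
    show ?case
    proof (cases n)
      case (Suc m)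
      have "fps_nth (H1 * K) m = fps_nth (H2 * K) m"
        unfolding fps_mult_nth using less Suc by (intro sum.cong) auto
      then have "of_nat (Suc m) * fps_nth H1 (Suc m) = of_nat (Suc m) * fps_nth H2 (Suc m)"
        unfolding assms(1,2)[symmetric] by (simp only: fps_deriv_nth Suc_eq_plus1)
      moreover have "(of_nat (Suc m) :: 'a fps) \<noteq> 0"
        by (simp only: fps_of_nat[symmetric] fps_const_eq_0_iff of_nat_eq_0_iff)
      ultimately show ?thesis unfolding Suc by (metis mult_cancel_left)
    qed (use assms(3) in simp)
  qed
qed

text \<open>Both sides solve \<open>H' = H (F' + G')\<close> with constant term \<open>1\<close>.\<close>

lemma exp_fps_add:
  assumes "fps_nth F 0 = 0" "fps_nth G 0 = 0"
  shows "exp_fps (F + G) = exp_fps F * exp_fps G"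
proof (rule fps_linear_ode_unique)
  show "fps_deriv (exp_fps (F + G)) = exp_fps (F + G) * (fps_deriv F + fps_deriv G)"
    using fps_deriv_exp_fps[of "F + G"] assms by simp
  show "fps_deriv (exp_fps F * exp_fps G) = exp_fps F * exp_fps G * (fps_deriv F + fps_deriv G)"
    using assms by (simp add: fps_deriv_exp_fps algebra_simps)
qed simp

lemma zeta_exp_sum: "zeta_exp (\<lambda>k. \<Sum>x\<in>I. a x k) = (\<Prod>x\<in>I. zeta_exp (a x))"
proof -
  have zero: "zeta_exp (\<lambda>_. 0) = (1 :: 'a::field_char_0 fps fps)"
  proof -
    have "Abs_fps (\<lambda>k. if k = 0 then 0 else - fps_const (1 / of_nat k) * 0) = (0 :: 'a fps fps)"
      by (rule fps_ext) simp
    then show ?thesis unfolding zeta_exp_def by (simp only:) (simp add: exp_fps_def)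
  qed
  have add: "zeta_exp (\<lambda>k. a k + b k) = zeta_exp a * zeta_exp b" for a b :: "nat \<Rightarrow> 'a fps"
    unfolding zeta_exp_def
    by (subst exp_fps_add[symmetric]) (simp_all, rule arg_cong[of _ _ exp_fps], simp add: fps_eq_iff algebra_simps)
  show ?thesis
    by (induction I rule: infinite_finite_induct) (simp_all add: zero add)
qed

lemma fps_nth_compose_scaled_X_power:
  fixes F :: "'a::comm_ring_1 fps"
  assumes r: "r > 0"
  shows "fps_nth (fps_compose F (fps_const c * fps_X ^ r)) n =
    (if r dvd n then c ^ (n div r) * fps_nth F (n div r) else 0)"
proof -
  have "fps_nth ((fps_const c * fps_X ^ r) ^ i) n = (if n = r * i then c ^ i else 0)" for i
    by (simp add: power_mult_distrib flip: power_mult)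
  then have "fps_nth (fps_compose F (fps_const c * fps_X ^ r)) n =
      (\<Sum>i=0..n. if n = r * i then fps_nth F i * c ^ i else 0)"
    by (simp only: fps_compose_nth if_distrib[of "(*) _"] mult_zero_right)
  also have "\<dots> = (\<Sum>i\<in>{0..n}. if i = n div r then (if r dvd n then c ^ i * fps_nth F i else 0) else 0)"
    using r by (intro sum.cong refl) (auto simp: mult.commute)
  finally show ?thesis by simp
qed

text \<open>
  A term \<open>(s\<^sup>r)\<^sup>k/k\<close> of the logarithm is \<open>r\<close> times \<open>s\<^sup>l/l\<close> for \<open>l = r k\<close>. In the product formula this
  factor \<open>r\<close> counts the points of an orbit.
\<close>

lemma zeta_exp_compose:
  fixes a :: "nat \<Rightarrow> 'a::field_char_0 fps"
  assumes r: "r > 0"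
  shows "fps_compose (zeta_exp a) (fps_const c * fps_X ^ r) =
    zeta_exp (\<lambda>l. if r dvd l then of_nat r * (c ^ (l div r) * a (l div r)) else 0)"
proof -
  let ?F = "\<lambda>a :: nat \<Rightarrow> 'a fps. Abs_fps (\<lambda>k. if k = 0 then 0 else - fps_const (1 / of_nat k) * a k)"
  let ?b = "\<lambda>l. if r dvd l then of_nat r * (c ^ (l div r) * a (l div r)) else 0"
  let ?G = "fps_const c * fps_X ^ r"
  have *: "fps_compose (?F a) ?G = ?F ?b"
  proof (rule fps_ext)
    fix l
    show "fps_nth (fps_compose (?F a) ?G) l = fps_nth (?F ?b) l"
    proof (cases "r dvd l \<and> l > 0")
      case True
      then obtain k where l: "l = r * k" "k > 0" by auto
      have "fps_const (1 / of_nat k) = fps_const (1 / of_nat (r * k)) * (of_nat r :: 'a fps)"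
        using r by (simp only: fps_of_nat[symmetric] fps_const_mult) simp
      then show ?thesis
        using r l by (simp add: fps_nth_compose_scaled_X_power mult_ac flip: fps_const_neg)
    next
      case False
      then show ?thesis
        by (auto simp: fps_nth_compose_scaled_X_power[OF r])
    qed
  qed
  have "fps_compose (zeta_exp a) ?G =
      fps_compose (Abs_fps (\<lambda>n. fps_const (1 / fact n))) (fps_compose (?F a) ?G)"
    unfolding zeta_exp_def exp_fps_def using r by (intro fps_compose_assoc[symmetric]) simp_all
  then show ?thesis unfolding * by (simp only: zeta_exp_def exp_fps_def)
qed

section \<open>The product formula\<close>

lemma C_fun_eq_zeta_exp:
  fixes h :: "('k::field_prime_char witt fract, 'n::finite) laurent"
  shows "C_fun h e r = zeta_exp (\<lambda>l. fps_const (1 / (of_nat CHAR('k) ^ (r * l) - 1) ^ CARD('n)) *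
    exp_sum h (\<chi> i. e $ i * int ((CHAR('k) ^ (r * l) - 1) div (CHAR('k) ^ r - 1))) (r * l))"
  unfolding C_fun_def zeta_exp_def
proof (intro arg_cong[where f = exp_fps] arg_cong[where f = Abs_fps] ext if_cong refl)
  fix l
  let ?x = "(of_nat CHAR('k) ^ (r * l) - 1) ^ CARD('n) :: 'k witt fract"
  have "fps_const (- 1 / ?x / of_nat l) = - fps_const (1 / of_nat l) * fps_const (1 / ?x)"
    by (simp add: fps_const_neg mult.commute)
  then show "fps_const (- 1 / ?x / of_nat l) * S = - fps_const (1 / of_nat l) * (fps_const (1 / ?x) * S)" for S
    by (simp only: mult.assoc)
qed

lemma int_multiple_scale:
  fixes u :: "rat ^ 'n::finite"
  assumes "\<And>i. c * u $ i \<in> \<int>"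
  shows "int_multiple (c * of_int M) u = (\<chi> i. int_multiple c u $ i * M)"
proof -
  have "\<lfloor>c * of_int M * u $ i\<rfloor> = \<lfloor>c * u $ i\<rfloor> * M" for i
  proof -
    obtain z where "c * u $ i = of_int z" using assms[of i] by (elim Ints_cases)
    then have "c * of_int M * u $ i = of_int (z * M)" by (simp add: mult.commute mult.left_commute)
    then show ?thesis using \<open>c * u $ i = of_int z\<close> by (simp only: floor_of_int)
  qed
  then show ?thesis by (simp add: int_multiple_def vec_eq_iff)
qed

text \<open>The quotient is a sum of \<open>k\<close> powers of \<open>q\<^sup>r\<close>, each of which is \<open>1\<close> modulo \<open>q - 1\<close>.\<close>

lemma geometric_quotient_cong:
  fixes q r k :: nat
  assumes "q > 1" "r > 0"
  shows "int (q - 1) dvd int ((q ^ (r * k) - 1) div (q ^ r - 1)) - int k"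
proof -
  let ?x = "int q ^ r"
  have x: "q ^ r > 1" using assms by (intro one_less_power)
  have "int ((q ^ (r * k) - 1) div (q ^ r - 1)) = (?x ^ k - 1) div (?x - 1)"
    using x by (simp add: zdiv_int of_nat_diff power_mult)
  also have "?x ^ k - 1 = (\<Sum>t<k. ?x ^ t) * (?x - 1)"
    using power_diff_1_eq[of ?x k] by (simp add: mult.commute)
  also have "\<dots> div (?x - 1) = (\<Sum>t<k. ?x ^ t)"
  proof -
    have "?x \<noteq> 1" using x by (metis of_nat_1 of_nat_eq_iff of_nat_power less_irrefl)
    then show ?thesis by simp
  qed
  finally have "int ((q ^ (r * k) - 1) div (q ^ r - 1)) - int k = (\<Sum>t<k. ?x ^ t - 1)"
    by (simp add: sum_subtractf)
  moreover have "int q - 1 dvd int q ^ s - 1" for s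
    using power_diff_1_eq[of "int q" s] by simp
  ultimately show ?thesis
    using assms by (auto simp: of_nat_diff simp flip: power_mult intro!: dvd_sum)
qed

text \<open>
  Over the extension of degree \<open>k\<close> of the field with \<open>q\<^sup>r\<close> elements the scalar \<open>b\<^sup>e\<close> becomes its \<open>k\<close>-th power, since \<open>b\<close> consists of
  \<open>(q - 1)\<close>-th roots of unity. Therefore the scalars can be absorbed into the variable \<open>s\<close>.
\<close>

lemma monomial_at_geometric_quotient:
  fixes b :: "'k::{alg_closed_field, field_prime_char} witt fract ^ 'n::finite"
  assumes a: "a > 0" and r: "r > 0" and b: "\<forall>i. b $ i \<in> mu a" and q: "q = CHAR('k) ^ a"
  shows "monomial_at b (\<chi> i. e $ i * int ((q ^ (r * k) - 1) div (q ^ r - 1))) = monomial_at b e ^ k"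
proof -
  have q1: "q > 1" unfolding q by (rule char_power_gt_1[OF a])
  have "monomial_at b (\<chi> i. e $ i * int ((q ^ (r * k) - 1) div (q ^ r - 1))) = monomial_at b (\<chi> i. int k * e $ i)"
  proof (rule monomial_at_cong_mod[OF a b], intro allI)
    fix i
    have "int (q - 1) dvd e $ i * (int ((q ^ (r * k) - 1) div (q ^ r - 1)) - int k)"
      by (intro dvd_mult geometric_quotient_cong q1 r)
    then show "int (CHAR('k) ^ a - 1) dvd
        (\<chi> i. e $ i * int ((q ^ (r * k) - 1) div (q ^ r - 1))) $ i - (\<chi> i. int k * e $ i) $ i"
      unfolding q[symmetric] vec_lambda_beta by (simp only: right_diff_distrib mult.commute[of "int k"])
  qed
  then show ?thesis by (simp only: monomial_at_times_exponent)
qed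

text \<open>
  Raising to the \<open>q\<close>-th power fixes the entries of the \<open>b\<^sub>j\<close>, so the scalars do not notice that a twist
  is multiplied by \<open>q\<close>, and neither do the exponential sums by \<open>exp_sum_frobenius\<close>.
\<close>

lemma exp_sum_orbit_invariant:
  fixes f :: "('k::{alg_closed_field, field_prime_char} witt fract, 'n::finite) laurent"
    and b :: "'m::finite \<Rightarrow> 'k witt fract ^ 'n"
  assumes a: "a > 0" and l: "l > 0" and q: "q = CHAR('k) ^ a"
    and f: "\<forall>u\<in>Poly_Mapping.keys f. Poly_Mapping.lookup f u \<in> mu a"
    and b: "\<forall>j i. b j $ i \<in> mu a"
    and e: "\<forall>j i. int (q ^ l - 1) dvd e $ j $ i - int q ^ k * e' $ j $ i"
  shows "(\<Prod>j\<in>UNIV. fps_const (monomial_at (b j) (e $ j)) * exp_sum f (e $ j) (a * l)) =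
    (\<Prod>j\<in>UNIV. fps_const (monomial_at (b j) (e' $ j)) * exp_sum f (e' $ j) (a * l))"
proof (intro prod.cong refl)
  fix j
  have al: "a * l > 0" using a l by simp
  have ql: "q ^ l = CHAR('k) ^ (a * l)" by (simp add: q power_mult)
  let ?e = "\<lambda>k. \<chi> i. int q ^ k * e' $ j $ i"
  have bl: "\<forall>i. b j $ i \<in> mu (a * l)" using b mu_mono[OF a l, where ?'k = 'k] by auto
  have cong: "\<forall>i. int (CHAR('k) ^ (a * l) - 1) dvd e $ j $ i - ?e k $ i"
    using e unfolding ql by simp
  have S: "exp_sum f (?e k) (a * l) = exp_sum f (e' $ j) (a * l)" for k
  proof (induction k)
    case (Suc k)
    have e: "?e (Suc k) = (\<chi> i. int (CHAR('k) ^ a) * ?e k $ i)" by (simp add: q mult.assoc vec_eq_iff)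
    show ?case unfolding e exp_sum_frobenius[OF a l f] by (rule Suc)
  qed simp
  have "monomial_at (b j) (?e k) = monomial_at (b j) (\<chi> i. int (q ^ k) * e' $ j $ i)" by simp
  also have "\<dots> = monomial_at (b j) (e' $ j) ^ (q ^ k)" by (rule monomial_at_times_exponent)
  also have "\<dots> = monomial_at (\<chi> i. b j $ i ^ (CHAR('k) ^ (a * k))) (e' $ j)"
    by (simp only: monomial_at_power q power_mult)
  also have "(\<chi> i. b j $ i ^ (CHAR('k) ^ (a * k))) = b j"
    using b mu_power_card[OF a, where ?'k = 'k] by (simp add: vec_eq_iff)
  finally have B: "monomial_at (b j) (?e k) = monomial_at (b j) (e' $ j)" .
  show "fps_const (monomial_at (b j) (e $ j)) * exp_sum f (e $ j) (a * l) =
      fps_const (monomial_at (b j) (e' $ j)) * exp_sum f (e' $ j) (a * l)"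
    using monomial_at_cong_mod[OF al bl cong] exp_sum_cong_mod[OF al cong, of f] S B by simp
qed

lemma distribute_scalars_over_prod:
  fixes S :: "'m::finite \<Rightarrow> 'a::field fps"
  shows "fps_const (w ^ CARD('m)) * (N * (\<Prod>j\<in>UNIV. fps_const (\<beta> j ^ k) * S j)) =
    N * (fps_const (\<Prod>j\<in>UNIV. \<beta> j) ^ k * (\<Prod>j\<in>UNIV. fps_const w * S j))"
proof -
  have "(\<Prod>j\<in>(UNIV :: 'm set). fps_const (\<beta> j ^ k)) = fps_const (\<Prod>j\<in>UNIV. \<beta> j) ^ k"
    by (simp only: fps_const_power[symmetric] prod_power_distrib[symmetric] fps_const_prod)
  moreover have "(\<Prod>j\<in>(UNIV :: 'm set). fps_const w) = fps_const (w ^ CARD('m))"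
    by (simp only: prod_constant fps_const_power)
  ultimately show ?thesis by (simp only: prod.distrib mult_ac)
qed

theorem theorem1p19:
  fixes f :: "('k::{alg_closed_field, field_prime_char} witt fract, 'n::finite) laurent"
    and v :: "'m::finite \<Rightarrow> int ^ 'm"
    and b :: "'m \<Rightarrow> 'k witt fract ^ 'n"
    and d :: "int ^ ('n \<times> 'm)"
    and p q a :: nat
    and rep :: "(rat ^ 'n ^ 'm) set set \<Rightarrow> rat ^ 'n ^ 'm"
  assumes p: "p = CHAR('k)" and a: "a > 0" and q: "q = p ^ a"
    and f_coeffs: "\<forall>u\<in>Poly_Mapping.keys f. Poly_Mapping.lookup f u \<in> mu a"
    and f_nonconstant: "\<not> Poly_Mapping.keys f \<subseteq> {0}"
    and v_basis: "integral_basis v"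
    and b_coeffs: "\<forall>j i. b j $ i \<in> mu a"
    and rep: "\<forall>X\<in>q_orbits p q. rep X \<in> loc_tuples p \<and> q_orbit q (rep X) = X"
  shows "finite {X \<in> q_orbits p q. orbit_solution v d q (rep X)} \<and>
    C_fun (diag_base_change f (\<Sum>j\<in>UNIV. Poly_Mapping.single (v j) (b j))) d a =
    (\<Prod>X | X \<in> q_orbits p q \<and> orbit_solution v d q (rep X).
       let u = rep X; r = card X; e = (\<lambda>j. int_multiple (of_nat q ^ r - 1) (u $ j)) in
       fps_compose
         (tensor_fps UNIV (\<lambda>j. C_fun f (e j) (a * r)))
         (fps_const (fps_const (\<Prod>j\<in>UNIV. monomial_at (b j) (e j))) * fps_X ^ r))"
proof
  have prime: "prime p" unfolding p by simp
  have qk: "q = CHAR('k) ^ a" by (simp add: q p)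
  have q1: "q > 1" unfolding qk by (rule char_power_gt_1[OF a])
  have inj: "inj v"
    using v_basis by (auto simp: integral_basis_def Let_def inj_def vec_eq_iff)
  show fin: "finite {X \<in> q_orbits p q. orbit_solution v d q (rep X)}"
    using rep by (intro finite_solution_orbits[OF v_basis q1]) auto
  let ?O = "{X \<in> q_orbits p q. orbit_solution v d q (rep X)}"
  let ?h = "diag_base_change f (\<Sum>j\<in>UNIV. Poly_Mapping.single (v j) (b j))"
  let ?e = "\<lambda>X j. int_multiple (of_nat q ^ card X - 1) (rep X $ j)"
  let ?B = "\<lambda>X. \<Prod>j\<in>UNIV. monomial_at (b j) (?e X j)"
  let ?M = "\<lambda>r k. int ((CHAR('k) ^ (a * r * k) - 1) div (CHAR('k) ^ (a * r) - 1))"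
  \<comment> \<open>The normalizing factors of \<open>C\<close>: that of the \<open>n m\<close>-dimensional sum is the product of \<open>m\<close> factors of
    the \<open>n\<close>-dimensional ones.\<close>
  define w where "w l n = (1 / (of_nat CHAR('k) ^ (a * l) - 1) ^ n :: 'k witt fract)" for l n
  let ?c = "\<lambda>X j k. fps_const (w (card X * k) CARD('n)) *
    exp_sum f (\<chi> i. ?e X j $ i * ?M (card X) k) (a * (card X * k))"
  let ?A = "\<lambda>X l. if card X dvd l then of_nat (card X) *
    (fps_const (?B X) ^ (l div card X) * (\<Prod>j\<in>UNIV. ?c X j (l div card X))) else 0"
  have w: "w l CARD('n \<times> 'm) = w l CARD('n) ^ CARD('m)" for l
    by (simp add: w_def power_mult power_one_over)
  have period: "card X > 0" "killed_by (of_nat q ^ card X - 1) (rep X)" if "X \<in> ?O" for X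
  proof -
    have X: "rep X \<in> loc_tuples p" "q_orbit q (rep X) = X" using rep that by auto
    obtain L where L: "L > 0" "killed_by (of_nat q ^ L - 1) (rep X)"
      using loc_tuples_killed[OF prime X(1), of a] unfolding q by blast
    show "card X > 0" "killed_by (of_nat q ^ card X - 1) (rep X)"
      using q_orbit_periodic(1)[OF L] q_orbit_periodic(2)[OF L, of "card X"] unfolding X(2) by auto
  qed
  have factor: "fps_compose (tensor_fps UNIV (\<lambda>j. C_fun f (?e X j) (a * card X)))
      (fps_const (fps_const (?B X)) * fps_X ^ card X) = zeta_exp (?A X)" if "X \<in> ?O" for X
    unfolding C_fun_eq_zeta_exp tensor_fps_zeta_exp zeta_exp_compose[OF period(1)[OF that]]
    by (simp only: w_def mult.assoc)
  let ?G = "\<lambda>l e. \<Prod>j\<in>UNIV. fps_const (monomial_at (b j) (e $ j)) * exp_sum f (e $ j) (a * l)"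
  let ?d = "\<lambda>l. \<chi> ik. d $ ik * int ((CHAR('k) ^ (a * l) - 1) div (CHAR('k) ^ a - 1))"
  \<comment> \<open>\<open>?A X l\<close> is the contribution of the orbit \<open>X\<close> to the coefficient of \<open>-s\<^sup>l/l\<close>.\<close>
  have coeff: "fps_const (w l CARD('n \<times> 'm)) * exp_sum ?h (?d l) (a * l) = (\<Sum>X\<in>?O. ?A X l)" if l: "l > 0" for l
  proof -
    have al: "a * l > 0" using a l by simp
    have ql: "CHAR('k) ^ (a * l) = q ^ l" by (simp add: qk power_mult)
    have f': "\<forall>u\<in>Poly_Mapping.keys f. Poly_Mapping.lookup f u \<in> mu (a * l)"
      and b': "\<forall>j i. b j $ i \<in> mu (a * l)"
      using f_coeffs b_coeffs mu_mono[OF a l, where ?'k = 'k] by auto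
    have "exp_sum ?h (?d l) (a * l) =
        (\<Sum>e | (\<forall>j i. e $ j $ i \<in> {0..<int (q ^ l - 1)}) \<and> orbit_solution v d q (frac_point (q ^ l - 1) e). ?G l e)"
      unfolding exp_sum_diag_base_change[OF al f' inj b'] ql qk[symmetric]
      by (simp only: orbit_solution_frac_point[OF q1 l])
    also have "\<dots> = (\<Sum>X\<in>?O. if card X dvd l
        then of_nat (card X) * ?G l (\<chi> j. int_multiple (of_nat q ^ l - 1) (rep X $ j)) else 0)"
      by (rule sum_solutions_by_orbit[OF prime a q l rep fin])
        (rule exp_sum_orbit_invariant[OF a l qk f_coeffs b_coeffs])
    finally have "fps_const (w l CARD('n \<times> 'm)) * exp_sum ?h (?d l) (a * l) =
        (\<Sum>X\<in>?O. fps_const (w l CARD('n \<times> 'm)) * (if card X dvd l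
        then of_nat (card X) * ?G l (\<chi> j. int_multiple (of_nat q ^ l - 1) (rep X $ j)) else 0))"
      by (simp only: sum_distrib_left)
    also have "\<dots> = (\<Sum>X\<in>?O. ?A X l)"
    proof (intro sum.cong refl)
      fix X assume X: "X \<in> ?O"
      show "fps_const (w l CARD('n \<times> 'm)) * (if card X dvd l
        then of_nat (card X) * ?G l (\<chi> j. int_multiple (of_nat q ^ l - 1) (rep X $ j)) else 0) = ?A X l"
      proof (cases "card X dvd l")
        case True
        then obtain k where lk: "l = card X * k" by (elim dvdE)
        have r: "card X > 0" by (rule period(1)[OF X])
        let ?M' = "int ((q ^ (card X * k) - 1) div (q ^ card X - 1))"
        have M: "?M (card X) k = ?M'" by (simp only: qk power_mult[symmetric] mult.assoc)
        have "q ^ card X - 1 dvd q ^ (card X * k) - 1" by (rule power_minus_one_dvd)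
        then have "q ^ l - 1 = (q ^ card X - 1) * ((q ^ (card X * k) - 1) div (q ^ card X - 1))"
          unfolding lk by simp
        from arg_cong[OF this, of "of_nat :: nat \<Rightarrow> rat"]
        have "of_nat q ^ l - 1 = (of_nat q ^ card X - 1) * (of_int ?M' :: rat)"
          using one_less_power[OF q1 r] one_less_power[OF q1 l] by (simp add: of_nat_diff)
        then have e: "int_multiple (of_nat q ^ l - 1) (rep X $ j) = (\<chi> i. ?e X j $ i * ?M')" for j
          using period(2)[OF X] unfolding killed_by_def by (simp only: int_multiple_scale)
        have bj: "\<forall>i. b j $ i \<in> mu a" for j using b_coeffs by blast
        have G: "?G l (\<chi> j. int_multiple (of_nat q ^ l - 1) (rep X $ j)) =
            (\<Prod>j\<in>UNIV. fps_const (monomial_at (b j) (?e X j) ^ k) * exp_sum f (\<chi> i. ?e X j $ i * ?M') (a * l))"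
          by (simp only: vec_lambda_beta e monomial_at_geometric_quotient[OF a r bj qk])
        have *: "fps_const (w l CARD('n \<times> 'm)) *
            (of_nat (card X) * ?G l (\<chi> j. int_multiple (of_nat q ^ l - 1) (rep X $ j))) =
            of_nat (card X) * (fps_const (?B X) ^ k *
              (\<Prod>j\<in>UNIV. fps_const (w l CARD('n)) * exp_sum f (\<chi> i. ?e X j $ i * ?M') (a * l)))"
          unfolding G w by (rule distribute_scalars_over_prod)
        have "l div card X = k" using lk r by simp
        with True * show ?thesis by (simp only: if_True M lk[symmetric])
      qed simp
    qed
    finally show ?thesis .
  qed
  have "C_fun ?h d a = zeta_exp (\<lambda>l. fps_const (w l CARD('n \<times> 'm)) * exp_sum ?h (?d l) (a * l))"
    by (simp only: C_fun_eq_zeta_exp w_def)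
  also have "\<dots> = zeta_exp (\<lambda>l. \<Sum>X\<in>?O. ?A X l)"
    by (rule zeta_exp_cong) (rule coeff)
  also have "\<dots> = (\<Prod>X\<in>?O. zeta_exp (?A X))" by (rule zeta_exp_sum)
  also have "\<dots> = (\<Prod>X\<in>?O. fps_compose (tensor_fps UNIV (\<lambda>j. C_fun f (?e X j) (a * card X)))
      (fps_const (fps_const (?B X)) * fps_X ^ card X))"
    by (intro prod.cong refl factor[symmetric])
  finally show "C_fun ?h d a =
    (\<Prod>X | X \<in> q_orbits p q \<and> orbit_solution v d q (rep X).
       let u = rep X; r = card X; e = (\<lambda>j. int_multiple (of_nat q ^ r - 1) (u $ j)) in
       fps_compose
         (tensor_fps UNIV (\<lambda>j. C_fun f (e j) (a * r)))
         (fps_const (fps_const (\<Prod>j\<in>UNIV. monomial_at (b j) (e j))) * fps_X ^ r))"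
    by (simp only: Let_def)
qed

end
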